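(* There exist local examples of non-trivial closed strongly integrable generalised $G_2$-manifolds and of non-trivial closed integrable generalised $Spin(7)$-manifolds of either type. That is: there exist a (not necessarily compact) 7-manifold carrying a closed strongly integrable generalised $G_2$-structure with torsion $T\neq0$, and (not necessarily compact) 8-manifolds carrying a closed integrable generalised $Spin(7)$-structure with torsion $T\neq0$ of even type, respectively of odd type.
   Context: For an orientable $n$-manifold $M$, $TM\oplus T^*M$ with contraction pairing acts on forms by $(v+\xi)\bullet\tau=v\llcorner\tau+\xi\wedge\tau$, so that $\Lambda^{ev}$ and $\Lambda^{od}$ are the half-spin modules of $Spin(n,n)$. A topological generalised $G_2$-structure on $M^7$ is an even or odd form $\rho$ whose stabiliser in $Spin(7,7)$ is at every point conjugate to $G_2\times G_2$ (via $SO(7)\times SO(7)\subset SO(7,7)$); a topological generalised $Spin(7)$-structure of even/odd type on $M^8$ is an even/odd form $\rho$ whose stabiliser in $Spin(8,8)$ is at every point conjugate to $Spin(7)\times Spin(7)$ (via $SO(8)\times SO(8)\subset SO(8,8)$, each $Spin(7)\subset SO(8)$ by the spin representation). Such structures determine an orientation, a metric $g$, a 2-form $b$, a function $F$ and unit spinors $\Psi_\pm$ for $(M,g)$ (in dimension 8 half-spinors, of equal chirality for even and opposite chirality for odd type), such that $\rho+\Box_{g,b}\rho=e^{-F}L_b(\Psi_+\otimes\Psi_-)$ for $n=7$ and $\rho=e^{-F}L_b(\Psi_+\otimes\Psi_-)$ for $n=8$. Here the Clifford relation is $x\cdot x=-g(x,x)$, for $n=7$ the spinor bundle $\Delta$ is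 real of rank 8 with oriented volume element acting as $+\mathrm{Id}$, for $n=8$ $\Delta=\Delta_+\oplus\Delta_-$; $q_\Delta$ is the invariant inner product; $L(\varphi\otimes\psi)=\sum_Iq_\Delta(e_I\cdot\psi,\varphi)e_I$ (increasing multi-indices, orthonormal frame), $L_b=e^{b/2}\wedge L$; $\sigma$ acts on $p$-forms by $+1$ if $p\equiv0,3$ and $-1$ if $p\equiv1,2$ mod 4; $\Box_{g,b}\rho=e^{b/2}\wedge\star_g\sigma(e^{-b/2}\wedge\rho)$. For a closed 3-form $H$ put $d_H\tau=d\tau+H\wedge\tau$. A generalised $G_2$-structure is closed strongly integrable if $d_H\rho=0$ and $d_H\Box_{g,b}\rho=0$ for some closed $H$; a generalised $Spin(7)$-structure is closed integrable if $d_H\rho=0$ for some closed $H$. The torsion is $T=\frac12db+H$, and the structure is non-trivial if $T\neq0$. *)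

theory Defs
  imports "HOL-Analysis.Analysis"
begin

section \<open>Exterior algebra of $\mathbb{R}^n$\<close>

text \<open>
  A mixed-degree form is stored through its components: \<open>\<tau> $ I\<close> is the coefficient of
  $dx^{i_1}\wedge\dots\wedge dx^{i_p}$ for $I=\{i_1<\dots<i_p\}$.  The numeral types \<open>7\<close> and \<open>8\<close>
  are ordered as $0<1<\dots<6$ and $0<1<\dots<7$.  Vectors and covectors are both coordinate
  vectors, so that $\xi(v)$ is \<open>\<xi> \<bullet> v\<close>.
\<close>

type_synonym 'n coords = "(real, 'n) vec"
type_synonym 'n matrix = "((real, 'n) vec, 'n) vec"
type_synonym 'n form = "(real, 'n set) vec"

text \<open>\<open>shuffle_sign I J\<close> is the sign in $dx^I\wedge dx^J=\pm dx^{I\cup J}$ for disjoint \<open>I\<close>, \<open>J\<close>.\<close>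

definition shuffle_sign :: "'n::{finite,linorder} set \<Rightarrow> 'n set \<Rightarrow> real" where
  "shuffle_sign I J = (- 1) ^ card {(i, j). i \<in> I \<and> j \<in> J \<and> j < i}"

definition wedge :: "'n::{finite,linorder} form \<Rightarrow> 'n form \<Rightarrow> 'n form" where
  "wedge \<alpha> \<beta> = (\<chi> K. \<Sum>I\<in>Pow K. shuffle_sign I (K - I) * \<alpha> $ I * \<beta> $ (K - I))"

definition unit_form :: "'n::{finite,linorder} form" where
  "unit_form = axis {} 1"

definition covector_wedge :: "'n coords \<Rightarrow> 'n::{finite,linorder} form \<Rightarrow> 'n form" where
  "covector_wedge \<xi> \<tau> = (\<chi> K. \<Sum>i\<in>K. shuffle_sign {i} (K - {i}) * \<xi> $ i * \<tau> $ (K - {i}))"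

definition interior_mult :: "'n coords \<Rightarrow> 'n::{finite,linorder} form \<Rightarrow> 'n form" where
  "interior_mult v \<tau> = (\<chi> K. \<Sum>i\<in>- K. shuffle_sign {i} K * v $ i * \<tau> $ (insert i K))"

text \<open>The exponential series; the powers of a form without degree-0 part vanish beyond degree \<open>n\<close>.\<close>

definition exp_form :: "'n::{finite,linorder} form \<Rightarrow> 'n form" where
  "exp_form \<beta> = (\<Sum>k\<le>CARD('n). (1 / fact k) *\<^sub>R ((wedge \<beta> ^^ k) unit_form))"

definition sigma_form :: "'n::{finite,linorder} form \<Rightarrow> 'n form" where
  "sigma_form \<tau> = (\<chi> I. (if card I mod 4 \<in> {0, 3} then 1 else - 1) * \<tau> $ I)"

definition homogeneous :: "nat \<Rightarrow> 'n::{finite,linorder} form \<Rightarrow> bool" where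
  "homogeneous p \<tau> \<longleftrightarrow> (\<forall>I. card I \<noteq> p \<longrightarrow> \<tau> $ I = 0)"

definition even_form :: "'n::{finite,linorder} form \<Rightarrow> bool" where
  "even_form \<tau> \<longleftrightarrow> (\<forall>I. odd (card I) \<longrightarrow> \<tau> $ I = 0)"

definition odd_form :: "'n::{finite,linorder} form \<Rightarrow> bool" where
  "odd_form \<tau> \<longleftrightarrow> (\<forall>I. even (card I) \<longrightarrow> \<tau> $ I = 0)"


section \<open>$Spin(n,n)$ acting on forms\<close>

definition pairing :: "'n::finite coords \<times> 'n coords \<Rightarrow> 'n coords \<times> 'n coords \<Rightarrow> real" where
  "pairing X Y = (snd X \<bullet> fst Y + snd Y \<bullet> fst X) / 2"

definition clifford_form ::
    "'n coords \<times> 'n coords \<Rightarrow> 'n::{finite,linorder} form \<Rightarrow> 'n form" where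
  "clifford_form X \<tau> = interior_mult (fst X) \<tau> + covector_wedge (snd X) \<tau>"

text \<open>
  Since \<open>clifford_form X \<circ> clifford_form X\<close> is multiplication by \<open>pairing X X\<close> and the resulting
  action of the Clifford algebra of signature $(n,n)$ on forms is faithful, $Spin(n,n)$ is
  realised as a group of operators on forms.  It is the connected group, i.e. the double cover of
  the identity component of $SO(n,n)$: products of an even number of vectors of square $+1$ and an
  even number of vectors of square $-1$.  (In the larger group allowing any even total number,
  the stabilisers for $n=7$ would contain in addition one of plus or minus the volume element,
  which covers $-\mathrm{Id}$.)
\<close>

definition spin_group :: "('n::{finite,linorder} form \<Rightarrow> 'n form) set" where
  "spin_group = {foldr (\<lambda>X f. clifford_form X \<circ> f) Xs id | Xs.
     (\<forall>X\<in>set Xs. pairing X X = 1 \<or> pairing X X = - 1) \<and>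
     even (length (filter (\<lambda>X. pairing X X = 1) Xs)) \<and>
     even (length (filter (\<lambda>X. pairing X X = - 1) Xs))}"

definition spin_covers ::
    "('n::{finite,linorder} form \<Rightarrow> 'n form) \<Rightarrow>
     ('n coords \<times> 'n coords \<Rightarrow> 'n coords \<times> 'n coords) \<Rightarrow> bool" where
  "spin_covers a f \<longleftrightarrow> (\<forall>X. a \<circ> clifford_form X = clifford_form (f X) \<circ> a)"

definition stabiliser :: "'n::{finite,linorder} form \<Rightarrow> ('n form \<Rightarrow> 'n form) set" where
  "stabiliser \<rho> = {a \<in> spin_group. a \<rho> = \<rho>}"

text \<open>
  Conjugacy of the stabiliser to $G\times G$, where $G\subset SO(V)$ and $V\oplus V$ carries the
  quadratic form $|p|^2-|q|^2$.  The isometry \<open>A\<close> of $V\oplus V$ onto $T\oplus T^*$ comprises both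
  the embedding $SO(V)\times SO(V)\subset SO(n,n)$ and the conjugation.  As $-1$ does not
  stabilise a non-zero form, the stabiliser is mapped injectively to $SO(n,n)$ by the covering, and
  comparing the images in $SO(n,n)$ suffices.
\<close>

definition stabiliser_conjugate_to_square ::
    "('v::euclidean_space \<Rightarrow> 'v) set \<Rightarrow> 'n::{finite,linorder} form \<Rightarrow> bool" where
  "stabiliser_conjugate_to_square G \<rho> \<longleftrightarrow> \<rho> \<noteq> 0 \<and>
     (\<exists>A :: 'v \<times> 'v \<Rightarrow> 'n coords \<times> 'n coords. linear A \<and> bij A \<and>
        (\<forall>p q. pairing (A (p, q)) (A (p, q)) = p \<bullet> p - q \<bullet> q) \<and>
        {f. \<exists>a\<in>stabiliser \<rho>. spin_covers a f} =
          {A \<circ> map_prod h k \<circ> inv A | h k. h \<in> G \<and> k \<in> G})"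


section \<open>$G_2$, $Spin(7)$ and the spin representations\<close>

text \<open>
  The 3-form $\sum_{i\in\mathbb{Z}/7} e^i\wedge e^{i+1}\wedge e^{i+3}$ of the octonions with
  $e_ie_{i+1}=e_{i+3}$; indices in the type \<open>7\<close> are residues modulo 7.
\<close>

definition phi0 :: "real ^ 7 \<Rightarrow> real ^ 7 \<Rightarrow> real ^ 7 \<Rightarrow> real" where
  "phi0 x y z = (\<Sum>i\<in>UNIV.
      x $ i * (y $ (i + 1) * z $ (i + 3) - y $ (i + 3) * z $ (i + 1))
    + x $ (i + 1) * (y $ (i + 3) * z $ i - y $ i * z $ (i + 3))
    + x $ (i + 3) * (y $ i * z $ (i + 1) - y $ (i + 1) * z $ i))"

definition G2 :: "(real ^ 7 \<Rightarrow> real ^ 7) set" where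
  "G2 = {h. linear h \<and> bij h \<and> (\<forall>x y z. phi0 (h x) (h y) (h z) = phi0 x y z)}"

definition cross7 :: "real ^ 7 \<Rightarrow> real ^ 7 \<Rightarrow> real ^ 7" where
  "cross7 x y = (\<chi> k. phi0 x y (axis k 1))"

text \<open>
  The octonions, as the 8-dimensional spin module of $\mathbb{R}^7$.  The sign of the cross
  product is the one for which $e_0\cdot e_1\cdots e_6$ acts as $+\mathrm{Id}$.
\<close>

type_synonym spinor7 = "real \<times> (real ^ 7)"

definition clifford7 :: "real ^ 7 \<Rightarrow> spinor7 \<Rightarrow> spinor7" where
  "clifford7 x s = (- (x \<bullet> snd s), fst s *\<^sub>R x - cross7 x (snd s))"

definition Spin7 :: "(spinor7 \<Rightarrow> spinor7) set" where
  "Spin7 = {foldr (\<lambda>x f. clifford7 x \<circ> f) xs id | xs.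
     even (length xs) \<and> (\<forall>x\<in>set xs. norm x = 1)}"

text \<open>
  The module $\Delta=\Delta_+\oplus\Delta_-$ of $\mathbb{R}^8$.  The vectors $e_0,\dots,e_6$ act by
  $(p,q)\mapsto(e_i\cdot q,e_i\cdot p)$ and $e_7$ by $(p,q)\mapsto(-q,p)$, whence
  $e_0\cdots e_7=\mathrm{diag}(1,-1)$.
\<close>

type_synonym spinor8 = "spinor7 \<times> spinor7"

definition first7 :: "real ^ 8 \<Rightarrow> real ^ 7" where
  "first7 x = (\<chi> i. x $ (of_nat (card {j. j < i})))"

definition clifford8 :: "real ^ 8 \<Rightarrow> spinor8 \<Rightarrow> spinor8" where
  "clifford8 x s = (clifford7 (first7 x) (snd s) - (x $ 7) *\<^sub>R snd s,
                    clifford7 (first7 x) (fst s) + (x $ 7) *\<^sub>R fst s)"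

definition Delta_plus :: "spinor8 set" where
  "Delta_plus = {s. snd s = 0}"

definition Delta_minus :: "spinor8 set" where
  "Delta_minus = {s. fst s = 0}"


section \<open>Smooth fields on an open set\<close>

primrec C_k_on :: "nat \<Rightarrow> 'a::real_normed_vector set \<Rightarrow> ('a \<Rightarrow> 'b::real_normed_vector) \<Rightarrow> bool" where
  "C_k_on 0 U f \<longleftrightarrow> continuous_on U f"
| "C_k_on (Suc k) U f \<longleftrightarrow> (\<forall>x\<in>U. f differentiable (at x)) \<and>
     (\<forall>v. C_k_on k U (\<lambda>x. frechet_derivative f (at x) v))"

definition smooth_on :: "'a::real_normed_vector set \<Rightarrow> ('a \<Rightarrow> 'b::real_normed_vector) \<Rightarrow> bool" where
  "smooth_on U f \<longleftrightarrow> (\<forall>k. C_k_on k U f)"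

definition ext_deriv ::
    "('n coords \<Rightarrow> 'n::{finite,linorder} form) \<Rightarrow> 'n coords \<Rightarrow> 'n form" where
  "ext_deriv \<tau> x = (\<chi> K. \<Sum>i\<in>K. shuffle_sign {i} (K - {i}) *
     frechet_derivative \<tau> (at x) (axis i 1) $ (K - {i}))"

definition twisted_deriv ::
    "('n coords \<Rightarrow> 'n form) \<Rightarrow> ('n coords \<Rightarrow> 'n form) \<Rightarrow>
     'n coords \<Rightarrow> 'n::{finite,linorder} form" where
  "twisted_deriv H \<tau> x = ext_deriv \<tau> x + wedge (H x) (\<tau> x)"

definition smooth_form_on ::
    "nat \<Rightarrow> 'n coords set \<Rightarrow> ('n coords \<Rightarrow> 'n::{finite,linorder} form) \<Rightarrow> bool" where
  "smooth_form_on p U \<tau> \<longleftrightarrow> smooth_on U \<tau> \<and> (\<forall>x\<in>U. homogeneous p (\<tau> x))"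

definition closed_3form_on ::
    "'n coords set \<Rightarrow> ('n coords \<Rightarrow> 'n::{finite,linorder} form) \<Rightarrow> bool" where
  "closed_3form_on U H \<longleftrightarrow> smooth_form_on 3 U H \<and> (\<forall>x\<in>U. ext_deriv H x = 0)"

definition metric_on :: "'n::finite coords set \<Rightarrow> ('n coords \<Rightarrow> 'n matrix) \<Rightarrow> bool" where
  "metric_on U g \<longleftrightarrow> smooth_on U g \<and>
     (\<forall>x\<in>U. transpose (g x) = g x \<and> (\<forall>v. v \<noteq> 0 \<longrightarrow> (g x *v v) \<bullet> v > 0))"

text \<open>Oriented means oriented with respect to the coordinates.\<close>

definition oriented_orthonormal_frame_on ::
    "'n::finite coords set \<Rightarrow> ('n coords \<Rightarrow> 'n matrix) \<Rightarrow> ('n coords \<Rightarrow> 'n \<Rightarrow> 'n coords) \<Rightarrow> bool" where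
  "oriented_orthonormal_frame_on U g E \<longleftrightarrow>
     (\<forall>i. smooth_on U (\<lambda>x. E x i)) \<and>
     (\<forall>x\<in>U. (\<forall>i j. (g x *v E x i) \<bullet> E x j = (if i = j then 1 else 0)) \<and>
            det (\<chi> i. E x i) > 0)"


section \<open>Hodge star, spinors and forms\<close>

text \<open>
  In the following \<open>g\<close> is a metric at a point and \<open>E\<close> an oriented \<open>g\<close>-orthonormal frame there;
  \<open>frame_form g E I\<close> is $e_I=e_{i_1}\wedge\dots\wedge e_{i_p}$, with vectors turned into covectors
  by \<open>g\<close>, and \<open>frame_eval E \<tau> I\<close> is $\tau(e_{i_1},\dots,e_{i_p})$.  The Hodge star
  $\star e_I=\pm e_{I^c}$, with $e_I\wedge\star e_I$ the volume form, does not depend on the choice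
  of \<open>E\<close>.
\<close>

definition frame_form ::
    "'n matrix \<Rightarrow> ('n \<Rightarrow> 'n coords) \<Rightarrow> 'n::{finite,linorder} set \<Rightarrow> 'n form" where
  "frame_form g E I = foldr (\<lambda>i. covector_wedge (g *v E i)) (sorted_list_of_set I) unit_form"

definition frame_eval ::
    "('n \<Rightarrow> 'n coords) \<Rightarrow> 'n::{finite,linorder} form \<Rightarrow> 'n set \<Rightarrow> real" where
  "frame_eval E \<tau> I = fold (\<lambda>i. interior_mult (E i)) (sorted_list_of_set I) \<tau> $ {}"

definition hodge_star ::
    "'n matrix \<Rightarrow> ('n \<Rightarrow> 'n coords) \<Rightarrow> 'n::{finite,linorder} form \<Rightarrow> 'n form" where
  "hodge_star g E \<tau> =
     (\<Sum>I\<in>UNIV. (frame_eval E \<tau> I * shuffle_sign I (- I)) *\<^sub>R frame_form g E (- I))"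

definition box_form ::
    "'n matrix \<Rightarrow> ('n \<Rightarrow> 'n coords) \<Rightarrow> 'n form \<Rightarrow> 'n::{finite,linorder} form \<Rightarrow> 'n form" where
  "box_form g E b \<rho> = wedge (exp_form ((1/2) *\<^sub>R b))
     (hodge_star g E (sigma_form (wedge (exp_form ((- 1/2) *\<^sub>R b)) \<rho>)))"

text \<open>
  The spinor bundle is trivialised by the frame, so spinors have values in the fixed Clifford
  module \<open>'s\<close> with action \<open>cl\<close>, the frame vector $e_i$ acting as the \<open>i\<close>-th standard basis vector,
  and the invariant inner product is the standard one.
\<close>

definition spinor_form ::
    "('n coords \<Rightarrow> 's \<Rightarrow> 's::real_inner) \<Rightarrow> 'n matrix \<Rightarrow> ('n \<Rightarrow> 'n coords) \<Rightarrow>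
     's \<Rightarrow> 's \<Rightarrow> 'n::{finite,linorder} form" where
  "spinor_form cl g E \<phi> \<psi> =
     (\<Sum>I\<in>UNIV. (foldr (\<lambda>i. cl (axis i 1)) (sorted_list_of_set I) \<psi> \<bullet> \<phi>) *\<^sub>R frame_form g E I)"

definition spinor_form_b ::
    "('n coords \<Rightarrow> 's \<Rightarrow> 's::real_inner) \<Rightarrow> 'n matrix \<Rightarrow> ('n \<Rightarrow> 'n coords) \<Rightarrow>
     'n form \<Rightarrow> 's \<Rightarrow> 's \<Rightarrow> 'n::{finite,linorder} form" where
  "spinor_form_b cl g E b \<phi> \<psi> = wedge (exp_form ((1/2) *\<^sub>R b)) (spinor_form cl g E \<phi> \<psi>)"


section \<open>Generalised $G_2$- and $Spin(7)$-structures on an open set of Euclidean space\<close>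

definition generalised_G2_structure ::
    "(real ^ 7) set \<Rightarrow> (real ^ 7 \<Rightarrow> 7 form) \<Rightarrow> bool" where
  "generalised_G2_structure U \<rho> \<longleftrightarrow> smooth_on U \<rho> \<and>
     ((\<forall>x\<in>U. even_form (\<rho> x)) \<or> (\<forall>x\<in>U. odd_form (\<rho> x))) \<and>
     (\<forall>x\<in>U. stabiliser_conjugate_to_square G2 (\<rho> x))"

definition even_generalised_Spin7_structure ::
    "(real ^ 8) set \<Rightarrow> (real ^ 8 \<Rightarrow> 8 form) \<Rightarrow> bool" where
  "even_generalised_Spin7_structure U \<rho> \<longleftrightarrow> smooth_on U \<rho> \<and>
     (\<forall>x\<in>U. even_form (\<rho> x) \<and> stabiliser_conjugate_to_square Spin7 (\<rho> x))"

definition odd_generalised_Spin7_structure ::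
    "(real ^ 8) set \<Rightarrow> (real ^ 8 \<Rightarrow> 8 form) \<Rightarrow> bool" where
  "odd_generalised_Spin7_structure U \<rho> \<longleftrightarrow> smooth_on U \<rho> \<and>
     (\<forall>x\<in>U. odd_form (\<rho> x) \<and> stabiliser_conjugate_to_square Spin7 (\<rho> x))"

text \<open>
  The data \<open>g\<close>, \<open>b\<close>, \<open>F\<close>, $\Psi_\pm$ determined by a structure (\<open>F\<close>, \<open>g\<close>, \<open>b\<close> uniquely; the
  spinors, relative to a frame \<open>E\<close>, up to simultaneous change of sign).
\<close>

definition background_fields_on ::
    "'n::{finite,linorder} coords set \<Rightarrow> ('n coords \<Rightarrow> 'n matrix) \<Rightarrow>
     ('n coords \<Rightarrow> 'n \<Rightarrow> 'n coords) \<Rightarrow> ('n coords \<Rightarrow> 'n form) \<Rightarrow> ('n coords \<Rightarrow> real) \<Rightarrow>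
     ('n coords \<Rightarrow> 's::real_inner) \<Rightarrow> ('n coords \<Rightarrow> 's) \<Rightarrow> bool" where
  "background_fields_on U g E b F \<Psi>p \<Psi>m \<longleftrightarrow>
     metric_on U g \<and> oriented_orthonormal_frame_on U g E \<and> smooth_form_on 2 U b \<and>
     smooth_on U F \<and> smooth_on U \<Psi>p \<and> smooth_on U \<Psi>m \<and>
     (\<forall>x\<in>U. norm (\<Psi>p x) = 1 \<and> norm (\<Psi>m x) = 1)"

definition G2_structure_data ::
    "(real ^ 7) set \<Rightarrow> (real ^ 7 \<Rightarrow> 7 form) \<Rightarrow> (real ^ 7 \<Rightarrow> real ^ 7 ^ 7) \<Rightarrow>
     (real ^ 7 \<Rightarrow> 7 \<Rightarrow> real ^ 7) \<Rightarrow> (real ^ 7 \<Rightarrow> 7 form) \<Rightarrow> (real ^ 7 \<Rightarrow> real) \<Rightarrow>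
     (real ^ 7 \<Rightarrow> spinor7) \<Rightarrow> (real ^ 7 \<Rightarrow> spinor7) \<Rightarrow> bool" where
  "G2_structure_data U \<rho> g E b F \<Psi>p \<Psi>m \<longleftrightarrow>
     background_fields_on U g E b F \<Psi>p \<Psi>m \<and>
     (\<forall>x\<in>U. \<rho> x + box_form (g x) (E x) (b x) (\<rho> x) =
        exp (- F x) *\<^sub>R spinor_form_b clifford7 (g x) (E x) (b x) (\<Psi>p x) (\<Psi>m x))"

definition Spin7_structure_data ::
    "(real ^ 8) set \<Rightarrow> (real ^ 8 \<Rightarrow> 8 form) \<Rightarrow> (real ^ 8 \<Rightarrow> real ^ 8 ^ 8) \<Rightarrow>
     (real ^ 8 \<Rightarrow> 8 \<Rightarrow> real ^ 8) \<Rightarrow> (real ^ 8 \<Rightarrow> 8 form) \<Rightarrow> (real ^ 8 \<Rightarrow> real) \<Rightarrow>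
     (real ^ 8 \<Rightarrow> spinor8) \<Rightarrow> (real ^ 8 \<Rightarrow> spinor8) \<Rightarrow> bool" where
  "Spin7_structure_data U \<rho> g E b F \<Psi>p \<Psi>m \<longleftrightarrow>
     background_fields_on U g E b F \<Psi>p \<Psi>m \<and>
     (\<forall>x\<in>U. \<rho> x =
        exp (- F x) *\<^sub>R spinor_form_b clifford8 (g x) (E x) (b x) (\<Psi>p x) (\<Psi>m x))"

definition equal_chirality :: "spinor8 \<Rightarrow> spinor8 \<Rightarrow> bool" where
  "equal_chirality \<phi> \<psi> \<longleftrightarrow>
     \<phi> \<in> Delta_plus \<and> \<psi> \<in> Delta_plus \<or> \<phi> \<in> Delta_minus \<and> \<psi> \<in> Delta_minus"

definition opposite_chirality :: "spinor8 \<Rightarrow> spinor8 \<Rightarrow> bool" where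
  "opposite_chirality \<phi> \<psi> \<longleftrightarrow>
     \<phi> \<in> Delta_plus \<and> \<psi> \<in> Delta_minus \<or> \<phi> \<in> Delta_minus \<and> \<psi> \<in> Delta_plus"

definition closed_strongly_integrable_with ::
    "'n coords set \<Rightarrow> ('n coords \<Rightarrow> 'n form) \<Rightarrow> ('n coords \<Rightarrow> 'n matrix) \<Rightarrow>
     ('n coords \<Rightarrow> 'n \<Rightarrow> 'n coords) \<Rightarrow> ('n coords \<Rightarrow> 'n::{finite,linorder} form) \<Rightarrow>
     ('n coords \<Rightarrow> 'n form) \<Rightarrow> bool" where
  "closed_strongly_integrable_with U \<rho> g E b H \<longleftrightarrow> closed_3form_on U H \<and>
     (\<forall>x\<in>U. twisted_deriv H \<rho> x = 0 \<and>
            twisted_deriv H (\<lambda>y. box_form (g y) (E y) (b y) (\<rho> y)) x = 0)"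

definition closed_integrable_with ::
    "'n coords set \<Rightarrow> ('n coords \<Rightarrow> 'n form) \<Rightarrow>
     ('n coords \<Rightarrow> 'n::{finite,linorder} form) \<Rightarrow> bool" where
  "closed_integrable_with U \<rho> H \<longleftrightarrow> closed_3form_on U H \<and> (\<forall>x\<in>U. twisted_deriv H \<rho> x = 0)"

definition torsion ::
    "('n coords \<Rightarrow> 'n form) \<Rightarrow> ('n coords \<Rightarrow> 'n form) \<Rightarrow>
     'n coords \<Rightarrow> 'n::{finite,linorder} form" where
  "torsion b H x = (1/2) *\<^sub>R ext_deriv b x + H x"

definition non_trivial_on ::
    "'n coords set \<Rightarrow> ('n coords \<Rightarrow> 'n form) \<Rightarrow>
     ('n coords \<Rightarrow> 'n::{finite,linorder} form) \<Rightarrow> bool" where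
  "non_trivial_on U b H \<longleftrightarrow> (\<exists>x\<in>U. torsion b H x \<noteq> 0)"

end

theory Submission
  imports Defs
begin

text \<open>
  The example is the five-brane smeared along three of its four transverse directions, in dimension 7
  or 8: the metric is $h(dy^2+dx_1^2+dx_2^2+dx_3^2)$ plus a flat part with $h=2y$ harmonic, \<open>b\<close> vanishes,
  $e^{2F}=h$, and $H=\pm 2\,dx_1\wedge dx_2\wedge dx_3$ is closed.  The spinors are constant in the
  conformal frame and of opposite chirality on the transverse 4-space, so that $\rho$ only has components
  with one or three transverse legs; then $d_H\rho=0$ reduces to the cancellation of $dh$ against \<open>H\<close>.

  The stabiliser of a bispinor is computed through covariants: inserting elements of $T\oplus T^*$
  into the \<open>Spin(n,n)\<close>-invariant pairing of $\rho$ with itself yields the difference of the 3-forms (for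
  $n=7$) or the sum of the Cayley forms (for $n=8$) of the two definite subspaces of $T\oplus T^*$.
  An isometry preserving this covariant preserves the two subspaces, hence lies in $G_2\times G_2$ or
  $Spin(7)\times Spin(7)$; conversely these groups lift by Schur's lemma.
\<close>

section \<open>The Clifford action on forms\<close>

text \<open>Stabilisers are computed only for two constant forms, \<open>rho7\<close> and
  \<open>rho8\<close>, in which both spinors are the octonion unit. The spinors of the example need
  opposite transverse chirality and so cannot coincide. Clifford multiplication by vectors of square
  -1 moves one of them; each such vector covers minus a reflection, which keeps the conjugacy class
  of the stabiliser. The dependence on the point is a diagonal rescaling and a positive factor. The
  invariant pairing relates forms of opposite parity for n = 7 and of equal parity for n = 8, hence
  three inserted vectors in one case and four in the other. Two obstacles shape the rest.
  \<open>G2\<close> is defined by the 3-form alone, so that its elements are isometries has to be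
  proved. Isometries lift to spinors as products of reflecting vectors of unknown number, whereas
  \<open>spin_group\<close> and \<open>Spin7\<close> want even products; the volume element decides
  the parity. Lifts are unique only up to sign, which does no harm since -1 lies in
  \<open>spin_group\<close> and in \<open>Spin7\<close>.\<close>

lemmas bilinear_simps = bilinear_ladd bilinear_radd bilinear_lmul bilinear_rmul bilinear_lneg bilinear_rneg
  bilinear_lsub bilinear_rsub bilinear_lzero bilinear_rzero

text \<open>Symmetric difference with \<open>{i}\<close>. Contraction with and exterior
  multiplication by the i-th axis both relate \<open>K\<close> to this one other set, so a single
  formula treats them together.\<close>

definition flip :: "'n \<Rightarrow> 'n set \<Rightarrow> 'n set" where
  "flip i K = (if i \<in> K then K - {i} else insert i K)"

lemma flip_flip [simp]: "flip i (flip i K) = K"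
  by (auto simp: flip_def)

lemma flip_commute: "flip i (flip j K) = flip j (flip i K)"
  by (auto simp: flip_def)

lemma mem_flip: "j \<in> flip i K \<longleftrightarrow> (if i = j then j \<notin> K else j \<in> K)"
  by (auto simp: flip_def)

lemma bij_flip: "bij (flip i)"
  by (rule o_bij[of "flip i"]) auto

definition sg :: "'n::{finite,linorder} \<Rightarrow> 'n set \<Rightarrow> real" where
  "sg i K = (- 1) ^ card {k \<in> K. k < i}"

lemma shuffle_sign_singleton: "shuffle_sign {i} K = sg i K"
proof -
  have "{(a, b). a \<in> {i} \<and> b \<in> K \<and> b < a} = Pair i ` {k \<in> K. k < i}"
    by auto
  then show ?thesis
    by (simp add: shuffle_sign_def sg_def card_image inj_on_def)
qed

lemma sg_square [simp]: "sg i K * sg i K = 1"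
  by (simp add: sg_def flip: power_add)

lemma sg_flip: "sg i (flip j K) = (if j < i then - sg i K else sg i K)"
proof -
  have "card {k \<in> flip j K. k < i} = (if j < i then (if j \<in> K then card {k \<in> K. k < i} - 1
      else Suc (card {k \<in> K. k < i})) else card {k \<in> K. k < i})"
  proof -
    have "{k \<in> flip j K. k < i} = (if j < i then (if j \<in> K then {k \<in> K. k < i} - {j}
        else insert j {k \<in> K. k < i}) else {k \<in> K. k < i})"
      by (auto simp: flip_def)
    then show ?thesis by auto
  qed
  moreover have "j \<in> K \<Longrightarrow> j < i \<Longrightarrow> card {k \<in> K. k < i} > 0"
    by (subst card_gt_0_iff) auto
  ultimately show ?thesis
    by (cases "card {k \<in> K. k < i}") (auto simp: sg_def)
qed

lemma sg_flip_self [simp]: "sg i (flip i K) = sg i K" by (simp add: sg_flip)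
lemma sg_minus_self [simp]: "sg i (K - {i}) = sg i K"
  unfolding sg_def by (rule arg_cong[where f="\<lambda>S. (-1) ^ card S"]) auto

definition ccoef :: "'n::finite coords \<times> 'n coords \<Rightarrow> 'n \<Rightarrow> 'n set \<Rightarrow> real" where
  "ccoef X i K = (if i \<in> K then snd X $ i else fst X $ i)"

text \<open>An index inside \<open>K\<close> can only come from the covector half of
  \<open>X\<close>, one outside only from the contracted half; \<open>ccoef\<close> picks the
  relevant half, and the two sums fuse into one over all indices.\<close>

lemma clifford_form_nth:
  fixes \<tau> :: "'n::{finite,linorder} form"
  shows "clifford_form X \<tau> $ K = (\<Sum>i\<in>UNIV. sg i K * ccoef X i K * \<tau> $ flip i K)"
proof -
  let ?f = "\<lambda>i. sg i K * ccoef X i K * \<tau> $ flip i K"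
  have "(\<Sum>i\<in>UNIV. ?f i) = (\<Sum>i\<in>K. ?f i) + (\<Sum>i\<in>-K. ?f i)"
    by (simp add: sum.union_disjoint[symmetric])
  also have "(\<Sum>i\<in>K. ?f i) = covector_wedge (snd X) \<tau> $ K"
    by (simp add: covector_wedge_def shuffle_sign_singleton ccoef_def flip_def)
  also have "(\<Sum>i\<in>-K. ?f i) = interior_mult (fst X) \<tau> $ K"
    by (simp add: interior_mult_def shuffle_sign_singleton ccoef_def flip_def)
  finally show ?thesis by (simp add: clifford_form_def)
qed

lemma ccoef_linear [simp]:
  "ccoef (X + Y) i K = ccoef X i K + ccoef Y i K"
  "ccoef (c *\<^sub>R X) i K = c * ccoef X i K"
  "ccoef (- X) i K = - ccoef X i K"
  by (auto simp: ccoef_def)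

lemma bilinear_clifford_form:
  "bilinear (clifford_form :: _ \<Rightarrow> 'n::{finite,linorder} form \<Rightarrow> _)"
  unfolding bilinear_def
  by (intro conjI allI; rule linearI;
      simp add: vec_eq_iff clifford_form_nth algebra_simps sum.distrib sum_distrib_left)

lemmas clifford_form_simps = bilinear_simps[OF bilinear_clifford_form]

lemma linear_clifford_form: "linear (clifford_form X)"
  using bilinear_clifford_form unfolding bilinear_def by blast

text \<open>The terms (i,j) and (j,i) with i \<noteq> j cancel: flipping the smaller index changes
  the sign attached to the larger one, but not conversely. The diagonal terms are the anticommutator
  of contraction and exterior multiplication.\<close>

lemma clifford_relation:
  fixes \<tau> :: "'n::{finite,linorder} form"
  shows "clifford_form X (clifford_form Y \<tau>) + clifford_form Y (clifford_form X \<tau>)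
    = (2 * pairing X Y) *\<^sub>R \<tau>"
proof (rule vec_eq_iff[THEN iffD2], rule allI)
  fix K :: "'n set"
  let ?t = "\<lambda>X Y i j. sg i K * ccoef X i K * (sg j (flip i K) * ccoef Y j (flip i K) *
      \<tau> $ flip j (flip i K))"
  have XY: "clifford_form X (clifford_form Y \<tau>) $ K = (\<Sum>i\<in>UNIV. \<Sum>j\<in>UNIV. ?t X Y i j)" for X Y
    by (simp add: clifford_form_nth sum_distrib_left)
  have "(\<Sum>i\<in>UNIV. \<Sum>j\<in>UNIV. ?t Y X i j) = (\<Sum>i\<in>UNIV. \<Sum>j\<in>UNIV. ?t Y X j i)"
    by (rule sum.swap)
  moreover have "?t X Y i j + ?t Y X j i =
      (if i = j then (snd X $ i * fst Y $ i + fst X $ i * snd Y $ i) * \<tau> $ K else 0)" for i j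
  proof (cases "i = j")
    case True
    have "?t X Y i i + ?t Y X i i = (sg i K * sg i K) * (ccoef X i K * ccoef Y i (flip i K) +
        ccoef Y i K * ccoef X i (flip i K)) * \<tau> $ K"
      by (simp only: flip_flip sg_flip_self) (simp only: algebra_simps)
    with True show ?thesis by (simp add: ccoef_def mem_flip algebra_simps)
  next
    case False
    have "ccoef Y j (flip i K) = ccoef Y j K" "ccoef X i (flip j K) = ccoef X i K"
      using False by (auto simp: ccoef_def mem_flip)
    with False show ?thesis
      by (cases "i < j") (auto simp: sg_flip flip_commute[of j i])
  qed
  ultimately have "(clifford_form X (clifford_form Y \<tau>) + clifford_form Y (clifford_form X \<tau>)) $ K
      = (\<Sum>i\<in>UNIV. (snd X $ i * fst Y $ i + fst X $ i * snd Y $ i) * \<tau> $ K)"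
    unfolding vector_add_component XY by (simp flip: sum.distrib)
  also have "\<dots> = ((2 * pairing X Y) *\<^sub>R \<tau>) $ K"
    by (simp add: pairing_def inner_vec_def flip: sum_distrib_right) (simp add: sum.distrib algebra_simps)
  finally show "(clifford_form X (clifford_form Y \<tau>) + clifford_form Y (clifford_form X \<tau>)) $ K
      = ((2 * pairing X Y) *\<^sub>R \<tau>) $ K" .
qed

lemma clifford_square: "clifford_form X (clifford_form X \<tau>) = pairing X X *\<^sub>R \<tau>"
proof -
  have "2 *\<^sub>R clifford_form X (clifford_form X \<tau>) = 2 *\<^sub>R (pairing X X *\<^sub>R \<tau>)"
    using clifford_relation[of X X \<tau>] by (simp add: scaleR_2)
  then show ?thesis by (simp only: scaleR_cancel_left) simp
qed

lemma bilinear_pairing: "bilinear (pairing :: 'n::finite coords \<times> 'n coords \<Rightarrow> _)"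
  unfolding bilinear_def
  by (intro conjI allI; rule linearI; simp add: pairing_def algebra_simps inner_simps add_divide_distrib)

lemma pairing_commute: "pairing X Y = pairing Y X"
  by (simp add: pairing_def inner_commute add.commute)

lemma pairing_nondegenerate:
  assumes "\<And>Y. pairing X Y = 0" shows "X = 0"
  \<comment> \<open>Swapping the halves of \<open>X\<close> turns the pairing into half of the
    squared Euclidean norm.\<close>
  using assms[of "(snd X, fst X)"]
  by (auto simp: pairing_def prod_eq_iff add_nonneg_eq_0_iff)

text \<open>Anticommuting with every \<open>Z\<close> on \<open>unit_form\<close> recovers all
  pairings of \<open>X - Y\<close>. Through this lemma, properties of a covered map on vectors are
  read off from operators.\<close>

lemma clifford_form_inject:
  assumes "\<And>\<tau> :: 'n::{finite,linorder} form. clifford_form X \<tau> = clifford_form Y \<tau>"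
  shows "X = Y"
proof -
  have "clifford_form (X - Y) \<tau> = 0" for \<tau> :: "'n form"
    using assms by (simp add: clifford_form_simps)
  then have "(2 * pairing (X - Y) Z) *\<^sub>R (unit_form :: 'n form) = 0" for Z
    using clifford_relation[of "X - Y" Z "unit_form :: 'n form"]
    by (simp add: clifford_form_simps)
  then have "pairing (X - Y) Z = 0" for Z
    by (simp add: unit_form_def axis_eq_0_iff)
  then have "X - Y = 0" by (rule pairing_nondegenerate)
  then show ?thesis by simp
qed

text \<open>Contraction with and exterior multiplication by an axis are transposes, whence the
  swapped halves. Vectors (x,x) are therefore symmetric and vectors (-x,x) skew for the Euclidean
  inner product of forms.\<close>

lemma clifford_form_adjoint:
  fixes \<tau> \<tau>' :: "'n::{finite,linorder} form"
  shows "clifford_form X \<tau> \<bullet> \<tau>' = \<tau> \<bullet> clifford_form (snd X, fst X) \<tau>'"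
proof -
  have "clifford_form X \<tau> \<bullet> \<tau>' =
      (\<Sum>i\<in>UNIV. \<Sum>K\<in>UNIV. sg i K * ccoef X i K * \<tau> $ flip i K * \<tau>' $ K)"
    by (subst sum.swap) (simp add: inner_vec_def clifford_form_nth sum_distrib_right)
  also have "\<dots> = (\<Sum>i\<in>UNIV. \<Sum>K\<in>UNIV. sg i K * ccoef (snd X, fst X) i K * \<tau> $ K * \<tau>' $ flip i K)"
  proof (rule sum.cong[OF refl])
    fix i :: 'n
    have "(\<Sum>K\<in>UNIV. sg i K * ccoef X i K * \<tau> $ flip i K * \<tau>' $ K) =
      (\<Sum>K\<in>UNIV. sg i (flip i K) * ccoef X i (flip i K) * \<tau> $ flip i (flip i K) * \<tau>' $ flip i K)"
      by (rule sum.reindex_bij_betw[symmetric, OF bij_flip])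
    then show "(\<Sum>K\<in>UNIV. sg i K * ccoef X i K * \<tau> $ flip i K * \<tau>' $ K) =
      (\<Sum>K\<in>UNIV. sg i K * ccoef (snd X, fst X) i K * \<tau> $ K * \<tau>' $ flip i K)"
      by (simp add: ccoef_def mem_flip if_distrib cong: if_cong)
        (auto intro!: sum.cong)
  qed
  also have "\<dots> = \<tau> \<bullet> clifford_form (snd X, fst X) \<tau>'"
    by (subst sum.swap) (simp add: inner_vec_def clifford_form_nth sum_distrib_left mult_ac)
  finally show ?thesis .
qed

text \<open>The degree involution, which anticommutes with every vector. It keeps the two definite
  subspaces anticommuting although they act on different spinor factors.\<close>

definition par :: "'n::{finite,linorder} form \<Rightarrow> 'n form" where
  "par \<tau> = (\<chi> K. (- 1) ^ card K * \<tau> $ K)"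

lemma linear_par: "linear par"
  by (rule linearI) (simp_all add: par_def vec_eq_iff algebra_simps)

lemma par_par [simp]: "par (par \<tau>) = \<tau>"
  by (simp add: par_def vec_eq_iff mult.assoc[symmetric] flip: power_add)

lemma minus_one_power_card_flip:
  "(- 1 :: real) ^ card (flip i K) = - ((- 1) ^ card (K :: 'n::finite set))"
proof (cases "i \<in> K")
  case True
  then have "card K = Suc (card (K - {i}))" by (metis card.remove finite)
  with True show ?thesis by (simp only: flip_def if_True power_Suc)
qed (simp add: flip_def)

lemma clifford_form_par: "clifford_form X (par \<tau>) = - par (clifford_form X \<tau>)"
  by (simp add: vec_eq_iff clifford_form_nth par_def minus_one_power_card_flip
      sum_distrib_left sum_negf[symmetric] algebra_simps)

lemma par_inner: "par \<tau> \<bullet> \<tau>' = \<tau> \<bullet> par \<tau>'"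
  by (simp add: par_def inner_vec_def algebra_simps)

section \<open>Clifford modules and bispinor forms\<close>

text \<open>The vectors (x,x) and (-x,x) form a maximal positive and a maximal negative definite
  subspace for \<open>pairing\<close>, each a copy of Euclidean n-space up to sign.\<close>

abbreviation pos_act :: "'n coords \<Rightarrow> 'n::{finite,linorder} form \<Rightarrow> 'n form" where
  "pos_act x \<equiv> clifford_form (x, x)"

abbreviation neg_act :: "'n coords \<Rightarrow> 'n::{finite,linorder} form \<Rightarrow> 'n form" where
  "neg_act x \<equiv> clifford_form (- x, x)"

definition cprod :: "('x \<Rightarrow> 'a \<Rightarrow> 'a) \<Rightarrow> 'x list \<Rightarrow> 'a \<Rightarrow> 'a" where
  "cprod c xs = foldr (\<lambda>x f. c x \<circ> f) xs id"

lemma cprod_simps [simp]: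
  "cprod c [] s = s" "cprod c (x # xs) s = c x (cprod c xs s)"
  by (simp_all add: cprod_def)

lemma cprod_append [simp]: "cprod c (xs @ ys) s = cprod c xs (cprod c ys s)"
  by (induction xs) auto

lemma cprod_map: "cprod c (map f xs) s = cprod (\<lambda>x. c (f x)) xs s"
  by (induction xs) auto

lemma foldr_eq_cprod: "foldr c xs s = cprod c xs s"
  by (induction xs) auto

lemma linear_cprod: "(\<And>x. linear (c x)) \<Longrightarrow> linear (cprod c xs)"
proof (induction xs)
  case Nil
  have "cprod c [] = id" by (simp add: fun_eq_iff)
  then show ?case using linear_id by (simp only:)
next
  case (Cons x xs)
  have "cprod c (x # xs) = c x \<circ> cprod c xs" by (simp add: fun_eq_iff)
  with Cons show ?case by (simp only: linear_compose)
qed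

lemma minus_one_power_cases: "(- 1 :: real) ^ k = 1 \<or> (- 1 :: real) ^ k = - 1"
  by (cases "even k") auto

text \<open>Instantiated by the two spin modules and also by the forms under their negative vectors,
  so that the signs of ordered products are computed once.\<close>

locale clifford_module =
  fixes cl :: "'n::{finite,linorder} coords \<Rightarrow> 's::euclidean_space \<Rightarrow> 's"
  assumes bilinear_cl: "bilinear cl"
    and cl_square: "cl x (cl x s) = - (x \<bullet> x) *\<^sub>R s"
    and cl_skew: "cl x s \<bullet> t = - (s \<bullet> cl x t)"
begin

lemmas cl_simps = bilinear_simps[OF bilinear_cl]

lemma linear_cl: "linear (cl x)"
  using bilinear_cl unfolding bilinear_def by blast

lemma cl_anticommute: "cl x (cl y s) = - cl y (cl x s) - (2 * (x \<bullet> y)) *\<^sub>R s"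
proof -
  have "cl (x + y) (cl (x + y) s) = - ((x + y) \<bullet> (x + y)) *\<^sub>R s"
    by (rule cl_square)
  then have "cl x (cl y s) + (cl y (cl x s) + (2 * (x \<bullet> y)) *\<^sub>R s) = 0"
    by (simp add: cl_simps cl_square inner_simps algebra_simps inner_commute)
  then show ?thesis by (simp add: eq_neg_iff_add_eq_0 algebra_simps)
qed

lemma norm_cl: "norm (cl x s) = norm x * norm s"
proof -
  have "cl x s \<bullet> cl x s = (norm x * norm s)\<^sup>2"
    by (simp add: cl_skew cl_square power_mult_distrib power2_norm_eq_inner)
  then show ?thesis by (simp add: norm_eq_sqrt_inner)
qed

lemma cl_inner_cl: "cl x s \<bullet> cl x t = (x \<bullet> x) * (s \<bullet> t)"
  by (simp add: cl_skew cl_square)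

lemma cl_sum_axis: "cl x s = (\<Sum>i\<in>UNIV. x $ i *\<^sub>R cl (axis i 1) s)"
proof -
  have "x = (\<Sum>i\<in>UNIV. x $ i *\<^sub>R axis i 1)"
    by (simp add: basis_expansion flip: scalar_mult_eq_scaleR)
  then have "cl x s = cl (\<Sum>i\<in>UNIV. x $ i *\<^sub>R axis i 1) s" by simp
  also have "\<dots> = (\<Sum>i\<in>UNIV. cl (x $ i *\<^sub>R axis i 1) s)"
    using bilinear_cl by (intro linear_sum) (auto simp: bilinear_def)
  finally show ?thesis by (simp add: cl_simps)
qed

definition eI :: "'n set \<Rightarrow> 's \<Rightarrow> 's" where
  "eI I s = cprod (\<lambda>i. cl (axis i 1)) (sorted_list_of_set I) s"

lemma linear_eI: "linear (eI I)"
  unfolding eI_def using linear_cprod linear_cl by (metis (no_types, lifting) ext)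

lemma eI_empty [simp]: "eI {} s = s"
  by (simp add: eI_def)

lemma cl_axis_anticommute: "i \<noteq> j \<Longrightarrow> cl (axis i 1) (cl (axis j 1) s) = - cl (axis j 1) (cl (axis i 1) s)"
  by (subst cl_anticommute) (simp add: inner_axis_axis)

lemma cl_axis_square: "cl (axis i 1) (cl (axis i 1) s) = - s"
  by (simp add: cl_square inner_axis_axis)

lemma cprod_insort:
  assumes "sorted xs" "i \<notin> set xs"
  shows "cprod (\<lambda>i. cl (axis i 1)) (insort i xs) s =
    (- 1) ^ length (filter (\<lambda>k. k < i) xs) *\<^sub>R cl (axis i 1) (cprod (\<lambda>i. cl (axis i 1)) xs s)"
  using assms
proof (induction xs)
  case (Cons y ys)
  show ?case
  proof (cases "i \<le> y")
    case True
    with Cons.prems have "filter (\<lambda>k. k < i) (y # ys) = []"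
      by (auto simp: filter_empty_conv)
    with True show ?thesis by (simp del: filter.simps)
  next
    case False
    with Cons show ?thesis
      by (auto simp: cl_simps cl_axis_anticommute[of y i])
  qed
qed simp

lemma eI_insert: "i \<notin> K \<Longrightarrow> eI (insert i K) s = sg i K *\<^sub>R cl (axis i 1) (eI K s)"
proof -
  assume "i \<notin> K"
  moreover have "length (filter (\<lambda>k. k < i) (sorted_list_of_set K)) = card {k \<in> K. k < i}"
  proof -
    have "length (filter (\<lambda>k. k < i) (sorted_list_of_set K)) =
        card (set (filter (\<lambda>k. k < i) (sorted_list_of_set K)))"
      by (intro distinct_card[symmetric]) simp
    then show ?thesis by simp
  qed
  ultimately show ?thesis
    by (simp add: eI_def sorted_list_of_set_insert_remove cprod_insort sg_def)
qed

lemma cl_eI: "cl (axis i 1) (eI K s) = (if i \<in> K then - sg i K else sg i K) *\<^sub>R eI (flip i K) s"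
proof (cases "i \<in> K")
  case True
  then have "eI K s = sg i (K - {i}) *\<^sub>R cl (axis i 1) (eI (K - {i}) s)"
    using eI_insert[of i "K - {i}"] by (simp add: insert_absorb)
  then show ?thesis using True
    by (simp add: cl_simps cl_axis_square flip_def)
next
  case False
  then have "sg i K *\<^sub>R eI (insert i K) s = cl (axis i 1) (eI K s)"
    by (simp add: eI_insert)
  then show ?thesis using False by (simp add: flip_def)
qed

lemma eI_cl_axis: "eI K (cl (axis i 1) s) =
    ((- 1) ^ card K * (if i \<in> K then - 1 else 1)) *\<^sub>R cl (axis i 1) (eI K s)"
proof -
  have "finite K" by simp
  then show ?thesis
  proof (induction K)
    case (insert k K)
    then show ?case
      by (cases "k = i") (auto simp: eI_insert cl_simps cl_axis_anticommute[of k i] cl_axis_square)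
  qed simp
qed

lemma eI_cl: "eI K (cl (axis i 1) s) = ((- 1) ^ card K * sg i K) *\<^sub>R eI (flip i K) s"
  by (auto simp: eI_cl_axis cl_eI)

text \<open>Induction by removing the least element of \<open>I\<close>: it stands in front of the
  others without a sign, and its inversions against \<open>J\<close> account for the change of the
  shuffle sign.\<close>

lemma eI_disjoint_union:
  "I \<inter> J = {} \<Longrightarrow> eI I (eI J s) = shuffle_sign I J *\<^sub>R eI (I \<union> J) s"
proof (induction "card I" arbitrary: I)
  case 0
  then show ?case by (simp add: shuffle_sign_def)
next
  case (Suc n)
  define i where "i = Min I"
  have I: "finite I" "I \<noteq> {}" using Suc.hyps by auto
  then have i: "i \<in> I" "\<And>j. j \<in> I \<Longrightarrow> i \<le> j" by (auto simp: i_def)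
  define I' where "I' = I - {i}"
  have I': "I = insert i I'" "i \<notin> I'" "card I' = n" "I' \<inter> J = {}" "i \<notin> J" "sg i I' = 1"
  proof -
    have "{k \<in> I'. k < i} = {}" using i by (force simp: I'_def)
    then show "sg i I' = 1" unfolding sg_def by (simp only: card.empty) simp
  qed (use i Suc in \<open>auto simp: I'_def\<close>)
  have "eI I (eI J s) = cl (axis i 1) (eI I' (eI J s))"
    using I' by (simp add: eI_insert)
  also have "\<dots> = shuffle_sign I' J *\<^sub>R cl (axis i 1) (eI (I' \<union> J) s)"
    using Suc.hyps(1)[of I'] I' by (simp add: cl_simps)
  also have "\<dots> = (shuffle_sign I' J * sg i (I' \<union> J)) *\<^sub>R eI (I \<union> J) s"
    using I' by (simp add: cl_eI flip_def)
  also have "shuffle_sign I' J * sg i (I' \<union> J) = shuffle_sign I J"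
  proof -
    have "{k \<in> I' \<union> J. k < i} = {k \<in> J. k < i}"
      using i by (force simp: I'_def)
    moreover have "{(a, b). a \<in> I \<and> b \<in> J \<and> b < a} =
        {(a, b). a \<in> I' \<and> b \<in> J \<and> b < a} \<union> Pair i ` {k \<in> J. k < i}"
      using I' by auto
    moreover have "card \<dots> = card {(a, b). a \<in> I' \<and> b \<in> J \<and> b < a} + card {k \<in> J. k < i}"
      using I' by (subst card_Un_disjoint) (auto simp: card_image inj_on_def
          intro: finite_subset[of _ "I' \<times> J"])
    ultimately show ?thesis
      by (simp add: shuffle_sign_def sg_def power_add)
  qed
  finally show ?case .
qed

text \<open>The sign is (-1)^(p(p+1)/2) with p = \<open>card I\<close>, the same as in
  \<open>sigma_form\<close>. This is why \<open>sigma_form\<close> followed by the Hodge star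
  amounts, on bispinors, to multiplication by the volume element.\<close>

lemma eI_eI: "eI I (eI I s) = (if card I mod 4 \<in> {0, 3} then 1 else - 1) *\<^sub>R s"
proof -
  have "finite I" by simp
  then show ?thesis
  proof (induction I)
    case (insert i I)
    have "eI (insert i I) (eI (insert i I) s) = (- ((- 1) ^ card I)) *\<^sub>R eI I (eI I s)"
      using insert by (simp add: eI_insert cl_simps eI_cl_axis linear_cmul[OF linear_eI] cl_axis_square)
    moreover have "- ((- 1) ^ m) * (if m mod 4 \<in> {0, 3} then 1 else - 1 :: real) =
        (if Suc m mod 4 \<in> {0, 3} then 1 else - 1)" for m :: nat
    proof (cases "even m")
      case True
      then have "m mod 4 = 0 \<and> Suc m mod 4 = 1 \<or> m mod 4 = 2 \<and> Suc m mod 4 = 3" by presburger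
      with True show ?thesis by auto
    next
      case False
      then have "m mod 4 = 1 \<and> Suc m mod 4 = 2 \<or> m mod 4 = 3 \<and> Suc m mod 4 = 0" by presburger
      with False show ?thesis by auto
    qed
    ultimately show ?case using insert by (simp only: scaleR_scaleR card_insert_disjoint finite) simp
  qed simp
qed

text \<open>The map L of the bispinor formula, for the standard frame.\<close>

definition Lform :: "'s \<Rightarrow> 's \<Rightarrow> 'n form" where
  "Lform \<phi> \<psi> = (\<chi> K. eI K \<psi> \<bullet> \<phi>)"

lemma bilinear_Lform: "bilinear Lform"
  unfolding bilinear_def Lform_def
  by (intro conjI allI; rule linearI;
      simp add: vec_eq_iff inner_simps linear_add[OF linear_eI] linear_cmul[OF linear_eI])

lemmas Lform_simps = bilinear_simps[OF bilinear_Lform]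

text \<open>Multiplication by an axis permutes the e_K by flips, with exactly the signs of the
  negative vectors on forms, so these act on the first spinor alone. Positive vectors act likewise
  on the second spinor, leaving a \<open>par\<close> behind.\<close>

lemma neg_act_Lform: "neg_act x (Lform \<phi> \<psi>) = Lform (cl x \<phi>) \<psi>"
proof (rule vec_eq_iff[THEN iffD2], rule allI)
  fix K :: "'n set"
  have "Lform (cl x \<phi>) \<psi> $ K = - (cl x (eI K \<psi>) \<bullet> \<phi>)"
    by (simp add: Lform_def cl_skew)
  also have "\<dots> = (\<Sum>i\<in>UNIV. - (x $ i * (cl (axis i 1) (eI K \<psi>) \<bullet> \<phi>)))"
    by (simp add: cl_sum_axis[of x] inner_sum_left sum_negf)
  also have "\<dots> = neg_act x (Lform \<phi> \<psi>) $ K"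
    unfolding clifford_form_nth by (rule sum.cong[OF refl]) (auto simp: Lform_def ccoef_def cl_eI)
  finally show "neg_act x (Lform \<phi> \<psi>) $ K = Lform (cl x \<phi>) \<psi> $ K" by simp
qed

lemma pos_act_Lform: "pos_act x (Lform \<phi> \<psi>) = par (Lform \<phi> (cl x \<psi>))"
proof (rule vec_eq_iff[THEN iffD2], rule allI)
  fix K :: "'n set"
  have "par (Lform \<phi> (cl x \<psi>)) $ K = (\<Sum>i\<in>UNIV. (- 1) ^ card K * x $ i * (eI K (cl (axis i 1) \<psi>) \<bullet> \<phi>))"
    by (simp add: par_def Lform_def cl_sum_axis[of x] linear_sum[OF linear_eI] linear_cmul[OF linear_eI]
        inner_sum_left sum_distrib_left mult.assoc)
  also have "\<dots> = (\<Sum>i\<in>UNIV. ((- 1) ^ card K * (- 1) ^ card K) * (x $ i * sg i K * (eI (flip i K) \<psi> \<bullet> \<phi>)))"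
    by (rule sum.cong[OF refl]) (simp add: eI_cl)
  also have "\<dots> = pos_act x (Lform \<phi> \<psi>) $ K"
    unfolding clifford_form_nth power_add[symmetric]
    by (rule sum.cong[OF refl]) (auto simp: Lform_def ccoef_def)
  finally show "pos_act x (Lform \<phi> \<psi>) $ K = par (Lform \<phi> (cl x \<psi>)) $ K" by simp
qed

end

lemma pairing_minus: "pairing (- x, x) (- y, y) = - (x \<bullet> y)"
  and pairing_plus: "pairing (x, x) (y, y) = x \<bullet> y"
  and pairing_plus_minus: "pairing (x, x) (- y, y) = 0"
  by (simp_all add: pairing_def inner_commute)

text \<open>Forms are themselves a Clifford module; the product \<open>eI UNIV\<close> for it, inserted into the
  Euclidean inner product, yields the \<open>spin_group\<close>-invariant pairing of forms.\<close>

interpretation fm: clifford_module "\<lambda>x. neg_act x :: 'n::{finite,linorder} form \<Rightarrow> 'n form"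
proof
  have "(\<lambda>x. neg_act x \<tau>) = (\<lambda>X. clifford_form X \<tau>) \<circ> (\<lambda>x. (- x, x))" for \<tau> :: "'n form"
    by (simp add: fun_eq_iff)
  moreover have "linear (\<lambda>x :: 'n coords. (- x, x))"
    by (rule linearI) simp_all
  ultimately have "linear (\<lambda>x. neg_act x \<tau>)" for \<tau> :: "'n form"
    using bilinear_clifford_form[where 'n='n] unfolding bilinear_def by (simp only: linear_compose)
  then show "bilinear (\<lambda>x. neg_act x :: 'n form \<Rightarrow> 'n form)"
    unfolding bilinear_def using linear_clifford_form by blast
next
  fix x :: "'n coords" and s t :: "'n form"
  show "neg_act x (neg_act x s) = - (x \<bullet> x) *\<^sub>R s"
    by (simp add: clifford_square pairing_minus)
  have "(x, - x) = - (- x, x)" by simp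
  then show "neg_act x s \<bullet> t = - (s \<bullet> neg_act x t)"
    by (simp only: clifford_form_adjoint[of "(- x, x)"] fst_conv snd_conv clifford_form_simps inner_minus_right)
qed

abbreviation \<Omega> :: "'n::{finite,linorder} form \<Rightarrow> 'n form" where
  "\<Omega> \<equiv> fm.eI UNIV"

lemma (in clifford_module) Omega_Lform: "\<Omega> (Lform \<phi> \<psi>) = Lform (eI UNIV \<phi>) \<psi>"
proof -
  have "cprod (\<lambda>i. neg_act (axis i 1)) is (Lform \<phi> \<psi>) =
      Lform (cprod (\<lambda>i. cl (axis i 1)) is \<phi>) \<psi>" for "is" :: "'n list"
    by (induction "is") (auto simp: neg_act_Lform)
  then show ?thesis by (simp add: fm.eI_def eI_def)
qed

lemma Omega_minus:
  "neg_act x (\<Omega> \<tau>) = (- ((- 1) ^ CARD('n))) *\<^sub>R \<Omega> (neg_act x (\<tau> :: 'n::{finite,linorder} form))"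
proof -
  have "neg_act (axis i 1) (\<Omega> \<tau>) =
      (- ((- 1) ^ CARD('n))) *\<^sub>R \<Omega> (neg_act (axis i 1) \<tau>)" for i
    by (simp add: fm.eI_cl_axis)
  then show ?thesis
    by (simp add: fm.cl_sum_axis[of x] linear_sum[OF fm.linear_eI] linear_cmul[OF fm.linear_eI]
        scaleR_sum_right sum_negf mult.commute)
qed

lemma clifford_plus_minus_anticommute:
  "pos_act x (neg_act y \<tau>) = - neg_act y (pos_act x \<tau>)"
  using clifford_relation[of "(x, x)" "(- y, y)" \<tau>]
  by (simp add: pairing_plus_minus eq_neg_iff_add_eq_0)

lemma Omega_plus:
  "pos_act x (\<Omega> \<tau>) = (- 1) ^ CARD('n) *\<^sub>R \<Omega> (pos_act x (\<tau> :: 'n::{finite,linorder} form))"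
proof -
  have "pos_act x (cprod (\<lambda>i. neg_act (axis i 1)) is \<tau>) =
     (- 1) ^ length is *\<^sub>R cprod (\<lambda>i. neg_act (axis i 1)) is (pos_act x \<tau>)" for "is"
    by (induction "is") (auto simp: clifford_plus_minus_anticommute clifford_form_simps)
  from this[of "sorted_list_of_set UNIV"] show ?thesis
    by (simp add: fm.eI_def)
qed

lemma coords_pair_decompose:
  fixes X :: "'n::finite coords \<times> 'n coords"
  obtains p q where "X = (p, p) + (- q, q)"
proof
  show "X = ((1/2) *\<^sub>R (fst X + snd X), (1/2) *\<^sub>R (fst X + snd X)) +
      (- ((1/2) *\<^sub>R (snd X - fst X)), (1/2) *\<^sub>R (snd X - fst X))"
    by (simp add: prod_eq_iff vec_eq_iff field_simps)
qed

text \<open>One sign serves all vectors: positive ones are symmetric and pass \<Omega> with (-1)^n,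
  negative ones are skew and pass it with -(-1)^n. Neither the inner product alone nor a definite
  subspace alone has this uniformity.\<close>

lemma Omega_adjoint:
  "clifford_form X \<tau> \<bullet> \<Omega> \<tau>' = (- 1) ^ CARD('n) * (\<tau> \<bullet> \<Omega> (clifford_form X (\<tau>' :: 'n::{finite,linorder} form)))"
proof -
  obtain p q where X: "X = (p, p) + (- q, q)" by (rule coords_pair_decompose)
  have "pos_act p \<tau> \<bullet> \<Omega> \<tau>' = \<tau> \<bullet> pos_act p (\<Omega> \<tau>')"
    by (simp add: clifford_form_adjoint[of "(p, p)"])
  then show ?thesis
    unfolding X clifford_form_simps inner_simps fm.cl_skew linear_add[OF fm.linear_eI]
    by (simp add: Omega_plus Omega_minus algebra_simps)
qed

lemma Omega_par: "\<Omega> (par \<tau>) = (- 1) ^ CARD('n) *\<^sub>R par (\<Omega> (\<tau> :: 'n::{finite,linorder} form))"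
proof -
  have "cprod (\<lambda>i. neg_act (axis i 1)) is (par \<tau>) =
     (- 1) ^ length is *\<^sub>R par (cprod (\<lambda>i. neg_act (axis i 1)) is \<tau>)" for "is"
    by (induction "is") (auto simp: clifford_form_par clifford_form_simps)
  from this[of "sorted_list_of_set UNIV"] show ?thesis
    by (simp add: fm.eI_def)
qed

lemma (in clifford_module) eI_inner_eI: "eI K s \<bullet> eI K t = s \<bullet> t"
proof -
  have "cprod (\<lambda>i. cl (axis i 1)) is s \<bullet> cprod (\<lambda>i. cl (axis i 1)) is t = s \<bullet> t" for "is"
    by (induction "is") (auto simp: cl_inner_cl inner_axis_axis)
  then show ?thesis by (simp add: eI_def)
qed

section \<open>The spin group of forms\<close>

definition spin_list :: "('n::finite coords \<times> 'n coords) list \<Rightarrow> bool" where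
  "spin_list Xs \<longleftrightarrow> (\<forall>X\<in>set Xs. pairing X X = 1 \<or> pairing X X = - 1) \<and>
     even (length (filter (\<lambda>X. pairing X X = 1) Xs)) \<and>
     even (length (filter (\<lambda>X. pairing X X = - 1) Xs))"

lemma spin_group_eq: "spin_group = cprod clifford_form ` {Xs. spin_list Xs}"
  by (auto simp: spin_group_def cprod_def spin_list_def image_def)

lemma spin_groupI: "spin_list Xs \<Longrightarrow> cprod clifford_form Xs \<in> spin_group"
  by (simp add: spin_group_eq)

lemma spin_groupE:
  assumes "a \<in> spin_group" obtains Xs where "a = cprod clifford_form Xs" "spin_list Xs"
  using assms by (auto simp: spin_group_eq)

lemma spin_group_comp:
  assumes "a \<in> spin_group" "b \<in> spin_group" shows "a \<circ> b \<in> spin_group"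
proof -
  obtain Xs Ys where ab: "a = cprod clifford_form Xs" "spin_list Xs" "b = cprod clifford_form Ys" "spin_list Ys"
    using assms by (metis spin_groupE)
  then have "a \<circ> b = cprod clifford_form (Xs @ Ys)" by (simp add: fun_eq_iff)
  then show ?thesis using ab by (auto simp: spin_list_def intro!: spin_groupI)
qed

lemma minus_in_spin_group: "(\<lambda>\<tau> :: 'n::{finite,linorder} form. - \<tau>) \<in> spin_group"
proof -
  let ?X = "(- axis undefined 1, axis undefined 1) :: 'n coords \<times> 'n coords"
  have X: "pairing ?X ?X = - 1" by (simp add: pairing_minus inner_axis_axis)
  then have "(\<lambda>\<tau> :: 'n form. - \<tau>) = cprod clifford_form [?X, ?X]"
    by (simp add: fun_eq_iff clifford_square)
  also have "\<dots> \<in> spin_group" by (rule spin_groupI) (use X in \<open>auto simp: spin_list_def\<close>)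
  finally show ?thesis .
qed

lemma cprod_clifford_inverse:
  assumes "\<forall>X\<in>set Xs. pairing X X = 1 \<or> pairing X X = - 1"
  shows "\<exists>e\<in>{1, - 1}. \<forall>\<tau>. cprod clifford_form (rev Xs) (cprod clifford_form Xs \<tau>) = e *\<^sub>R \<tau>"
  using assms
proof (induction Xs)
  case (Cons X Xs)
  have lin: "linear (cprod clifford_form (rev Xs))" by (rule linear_cprod) (rule linear_clifford_form)
  from Cons obtain e where e: "e \<in> {1, - 1 :: real}"
    "\<And>\<tau>. cprod clifford_form (rev Xs) (cprod clifford_form Xs \<tau>) = e *\<^sub>R \<tau>"
    by (metis list.set_intros(2))
  show ?case
    by (rule bexI[of _ "pairing X X * e"])
      (use Cons.prems e in \<open>auto simp: clifford_square linear_cmul[OF lin] linear_neg[OF lin]\<close>)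
qed auto

text \<open>Each factor \<open>X\<close> contributes (-1)^n times its square. Factors of either
  square come in even number, so all signs cancel.\<close>

lemma spin_group_Omega:
  assumes "a \<in> spin_group"
  shows "a \<tau> \<bullet> \<Omega> (a \<tau>') = \<tau> \<bullet> \<Omega> (\<tau>' :: 'n::{finite,linorder} form)"
proof -
  obtain Xs where a: "a = cprod clifford_form Xs" and Xs: "spin_list Xs"
    using assms by (metis spin_groupE)
  have "cprod clifford_form Xs \<tau> \<bullet> \<Omega> (cprod clifford_form Xs \<tau>') =
    ((- 1) ^ CARD('n)) ^ (length (filter (\<lambda>X. pairing X X = 1) Xs) + length (filter (\<lambda>X. pairing X X = - 1) Xs))
     * (- 1) ^ length (filter (\<lambda>X. pairing X X = - 1) Xs) * (\<tau> \<bullet> \<Omega> \<tau>')"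
    if "\<forall>X\<in>set Xs. pairing X X = 1 \<or> pairing X X = - 1"
    using that by (induction Xs) (auto simp: Omega_adjoint clifford_square linear_neg[OF fm.linear_eI])
  moreover have "((- 1 :: real) ^ CARD('n)) ^ m = 1" if "even m" for m
    using that minus_one_power_cases[of "CARD('n)"] by auto
  ultimately show ?thesis using Xs unfolding a spin_list_def by simp
qed

context
  fixes a :: "'n::{finite,linorder} form \<Rightarrow> 'n form" and f
  assumes a: "a \<in> spin_group" and f: "spin_covers a f"
begin

lemma spin_covers_apply: "a (clifford_form X \<tau>) = clifford_form (f X) (a \<tau>)"
  using f unfolding spin_covers_def by (metis comp_apply)

lemma linear_spin_group: "linear a"
  using a by (auto simp: spin_group_eq intro: linear_cprod linear_clifford_form)

lemma surj_spin_group: "\<exists>\<tau>. \<sigma> = a \<tau>"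
proof -
  obtain Xs where Xs: "a = cprod clifford_form Xs" "spin_list Xs" using a by (rule spin_groupE)
  then have "\<forall>X\<in>set (rev Xs). pairing X X = 1 \<or> pairing X X = - 1" by (simp add: spin_list_def)
  from cprod_clifford_inverse[OF this] obtain e where "e \<in> {1, - 1 :: real}"
    "\<And>\<tau>. a (cprod clifford_form (rev Xs) \<tau>) = e *\<^sub>R \<tau>"
    unfolding Xs(1) rev_rev_ident by blast
  then have "\<sigma> = a (e *\<^sub>R cprod clifford_form (rev Xs) \<sigma>)"
    by (auto simp: linear_cmul[OF linear_spin_group] linear_neg[OF linear_spin_group])
  then show ?thesis by blast
qed

text \<open>\<open>spin_covers\<close> admits an arbitrary function \<open>f\<close>. Its linearity
  comes from the Clifford action being linear and faithful on vectors, tested on all forms because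
  \<open>a\<close> is onto.\<close>

lemma spin_covers_linear: "linear f"
proof (rule linearI)
  fix X Y show "f (X + Y) = f X + f Y"
  proof (rule clifford_form_inject)
    fix \<sigma> :: "'n form"
    obtain \<tau> where "\<sigma> = a \<tau>" using surj_spin_group by blast
    then show "clifford_form (f (X + Y)) \<sigma> = clifford_form (f X + f Y) \<sigma>"
      by (simp add: clifford_form_simps flip: spin_covers_apply) (simp add: linear_add[OF linear_spin_group])
  qed
next
  fix c X show "f (c *\<^sub>R X) = c *\<^sub>R f X"
  proof (rule clifford_form_inject)
    fix \<sigma> :: "'n form"
    obtain \<tau> where "\<sigma> = a \<tau>" using surj_spin_group by blast
    then show "clifford_form (f (c *\<^sub>R X)) \<sigma> = clifford_form (c *\<^sub>R f X) \<sigma>"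
      by (simp add: clifford_form_simps flip: spin_covers_apply) (simp add: linear_cmul[OF linear_spin_group])
  qed
qed

lemma spin_covers_isometry: "pairing (f X) (f Y) = pairing X Y"
proof -
  obtain \<tau> where "(unit_form :: 'n form) = a \<tau>" using surj_spin_group by blast
  moreover have "(2 * pairing (f X) (f Y)) *\<^sub>R a \<tau> = (2 * pairing X Y) *\<^sub>R a \<tau>" for \<tau>
  proof -
    have "a (clifford_form X (clifford_form Y \<tau>) + clifford_form Y (clifford_form X \<tau>)) =
        clifford_form (f X) (clifford_form (f Y) (a \<tau>)) + clifford_form (f Y) (clifford_form (f X) (a \<tau>))"
      by (simp only: linear_add[OF linear_spin_group] spin_covers_apply)
    then show ?thesis by (simp only: clifford_relation linear_cmul[OF linear_spin_group])
  qed
  ultimately have "(2 * pairing (f X) (f Y)) *\<^sub>R unit_form = (2 * pairing X Y) *\<^sub>R (unit_form :: 'n form)"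
    by metis
  moreover have "(unit_form :: 'n form) \<noteq> 0" by (simp add: unit_form_def axis_eq_0_iff)
  ultimately show ?thesis by (simp only: scaleR_cancel_right) simp
qed

lemma spin_covers_bij: "bij f"
proof -
  have "X = 0" if "f X = 0" for X
    using spin_covers_isometry[of X] that pairing_nondegenerate[of X]
    by (simp add: bilinear_lzero[OF bilinear_pairing])
  then have "inj f" by (rule linear_injective_0[OF spin_covers_linear, THEN iffD2, rule_format])
  then show ?thesis
    using linear_injective_imp_surjective[OF spin_covers_linear] by (simp add: bij_def)
qed

lemma spin_covers_cprod: "a (cprod clifford_form Xs \<tau>) = cprod clifford_form (map f Xs) (a \<tau>)"
  by (induction Xs) (auto simp: spin_covers_apply)

lemma stabiliser_covariant:
  assumes "a \<rho> = \<rho>"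
  shows "\<rho> \<bullet> \<Omega> (cprod clifford_form (map f Xs) \<rho>) = \<rho> \<bullet> \<Omega> (cprod clifford_form Xs \<rho>)"
  using spin_group_Omega[OF a, of \<rho> "cprod clifford_form Xs \<rho>"] assms
  by (simp add: spin_covers_cprod)

end

section \<open>Transport of stabilisers along isometries\<close>

definition covered_stabiliser where
  "covered_stabiliser \<rho> = {f. \<exists>a\<in>stabiliser \<rho>. spin_covers a f}"

text \<open>\<open>D\<close> itself need not lie in the spin group: conjugation replaces each vector
  of the product by its image under \<open>d\<close>, which has the same square.\<close>

lemma spin_group_conjugate:
  fixes D D' :: "'n::{finite,linorder} form \<Rightarrow> 'n form"
  assumes "a \<in> spin_group" "D \<circ> D' = id" "D' \<circ> D = id"
    and D: "\<And>X \<tau>. D (clifford_form X \<tau>) = clifford_form (d X) (D \<tau>)"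
    and d: "\<And>X. pairing (d X) (d X) = pairing X X"
  shows "D \<circ> a \<circ> D' \<in> spin_group"
proof -
  obtain Xs where a: "a = cprod clifford_form Xs" and Xs: "spin_list Xs"
    using assms by (metis spin_groupE)
  have "D (cprod clifford_form Xs \<tau>) = cprod clifford_form (map d Xs) (D \<tau>)" for \<tau>
    by (induction Xs) (auto simp: D)
  moreover have "D (D' \<tau>) = \<tau>" for \<tau> using assms(2) by (simp add: fun_eq_iff)
  ultimately have "D \<circ> a \<circ> D' = cprod clifford_form (map d Xs)"
    by (simp add: fun_eq_iff a)
  also have "\<dots> \<in> spin_group"
    by (rule spin_groupI) (use Xs d in \<open>auto simp: spin_list_def filter_map comp_def\<close>)
  finally show ?thesis .
qed

lemma covered_stabiliser_conjugate:
  fixes D D' :: "'n::{finite,linorder} form \<Rightarrow> 'n form"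
  assumes D: "D \<circ> D' = id" "D' \<circ> D = id" "d \<circ> d' = id" "d' \<circ> d = id"
    and cov: "\<And>X \<tau>. D (clifford_form X \<tau>) = clifford_form (d X) (D \<tau>)"
    and d: "\<And>X. pairing (d X) (d X) = pairing X X"
    and f: "f \<in> covered_stabiliser \<rho>"
  shows "d \<circ> f \<circ> d' \<in> covered_stabiliser (D \<rho>)"
proof -
  obtain a where a: "a \<in> spin_group" "a \<rho> = \<rho>" "spin_covers a f"
    using f by (auto simp: covered_stabiliser_def stabiliser_def)
  have D': "D (D' \<tau>) = \<tau>" "D' (D \<tau>) = \<tau>" "d (d' X) = X" "d' (d X) = X" for \<tau> X
    using D by (metis comp_apply id_apply)+
  have cov': "D' (clifford_form X \<tau>) = clifford_form (d' X) (D' \<tau>)" for X \<tau>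
    using cov[of "d' X" "D' \<tau>"] by (metis D')
  have "D \<circ> a \<circ> D' \<in> spin_group"
    using spin_group_conjugate[OF a(1) D(1,2) cov d] .
  moreover have "(D \<circ> a \<circ> D') (D \<rho>) = D \<rho>" by (simp add: D' a)
  moreover have "spin_covers (D \<circ> a \<circ> D') (d \<circ> f \<circ> d')"
    by (simp add: spin_covers_def fun_eq_iff cov' spin_covers_apply[OF a(1,3)] cov)
  ultimately show ?thesis by (auto simp: covered_stabiliser_def stabiliser_def)
qed

text \<open>The conjugating map \<open>A\<close> is replaced by \<open>d \<circ> A\<close>.
  Isometries \<open>d\<close> outside the identity component are allowed, as single Clifford vectors
  require.\<close>

lemma stabiliser_conjugate_transport:
  fixes \<rho> :: "'n::{finite,linorder} form" and D D' :: "'n form \<Rightarrow> 'n form"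
  assumes \<rho>: "stabiliser_conjugate_to_square G \<rho>"
    and D: "linear D" "D \<circ> D' = id" "D' \<circ> D = id" and d: "linear d" "d \<circ> d' = id" "d' \<circ> d = id"
    and cov: "\<And>X \<tau>. D (clifford_form X \<tau>) = clifford_form (d X) (D \<tau>)"
    and iso: "\<And>X. pairing (d X) (d X) = pairing X X"
  shows "stabiliser_conjugate_to_square G (D \<rho>)"
proof -
  have D': "D (D' \<tau>) = \<tau>" "D' (D \<tau>) = \<tau>" "d (d' X) = X" "d' (d X) = X" for \<tau> X
    using D d by (metis comp_apply id_apply)+
  have cov': "D' (clifford_form X \<tau>) = clifford_form (d' X) (D' \<tau>)" for X \<tau>
    using cov[of "d' X" "D' \<tau>"] by (metis D')
  have iso': "pairing (d' X) (d' X) = pairing X X" for X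
    using iso[of "d' X"] by (simp add: D')
  obtain A where A: "linear A" "bij A" "\<And>p q. pairing (A (p, q)) (A (p, q)) = p \<bullet> p - q \<bullet> q"
      "covered_stabiliser \<rho> = {A \<circ> map_prod h k \<circ> inv A | h k. h \<in> G \<and> k \<in> G}"
    using \<rho> unfolding stabiliser_conjugate_to_square_def covered_stabiliser_def by auto
  have "bij d" using d by (intro o_bij[of d']) auto
  have "covered_stabiliser (D \<rho>) = (\<lambda>f. d \<circ> f \<circ> d') ` covered_stabiliser \<rho>"
  proof (intro equalityI subsetI)
    fix f assume "f \<in> covered_stabiliser (D \<rho>)"
    from covered_stabiliser_conjugate[OF D(3,2) d(3,2) cov' iso' this]
    have "d' \<circ> f \<circ> d \<in> covered_stabiliser \<rho>" by (simp add: D')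
    moreover have "f = d \<circ> (d' \<circ> f \<circ> d) \<circ> d'" by (simp add: fun_eq_iff D')
    ultimately show "f \<in> (\<lambda>f. d \<circ> f \<circ> d') ` covered_stabiliser \<rho>" by blast
  next
    fix f assume "f \<in> (\<lambda>f. d \<circ> f \<circ> d') ` covered_stabiliser \<rho>"
    then show "f \<in> covered_stabiliser (D \<rho>)"
      using covered_stabiliser_conjugate[OF D(2,3) d(2,3) cov iso] by blast
  qed
  also have "\<dots> = {(d \<circ> A) \<circ> map_prod h k \<circ> inv (d \<circ> A) | h k. h \<in> G \<and> k \<in> G}"
  proof -
    have "inv d = d'" using d by (intro inv_equality) (simp_all add: D')
    then have "inv (d \<circ> A) = inv A \<circ> d'"
      using o_inv_distrib[OF \<open>bij d\<close> A(2)] by simp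
    moreover have "(\<lambda>f. d \<circ> f \<circ> d') ` {A \<circ> map_prod h k \<circ> inv A | h k. h \<in> G \<and> k \<in> G} =
        {d \<circ> (A \<circ> map_prod h k \<circ> inv A) \<circ> d' | h k. h \<in> G \<and> k \<in> G}" by blast
    ultimately show ?thesis unfolding A(4) by (simp only: comp_assoc)
  qed
  finally have "covered_stabiliser (D \<rho>) = \<dots>" .
  moreover have "D \<rho> \<noteq> 0"
  proof
    assume "D \<rho> = 0"
    moreover have "D 0 = 0" using D by (simp add: linear_0)
    ultimately have "\<rho> = 0" by (metis D'(2))
    then show False using \<rho> by (simp add: stabiliser_conjugate_to_square_def)
  qed
  moreover have "linear (d \<circ> A)" "bij (d \<circ> A)"
    using A d \<open>bij d\<close> by (auto intro: linear_compose bij_comp)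
  ultimately show ?thesis
    unfolding stabiliser_conjugate_to_square_def covered_stabiliser_def[symmetric]
    using A(3) iso by (intro conjI exI[of _ "d \<circ> A"]) auto
qed

lemma stabiliser_conjugate_scaleR:
  fixes \<rho> :: "'n::{finite,linorder} form"
  assumes "stabiliser_conjugate_to_square G \<rho>" "c \<noteq> 0"
  shows "stabiliser_conjugate_to_square G (c *\<^sub>R \<rho>)"
proof (rule stabiliser_conjugate_transport[where D = "\<lambda>\<tau>. c *\<^sub>R \<tau>" and D' = "\<lambda>\<tau>. (1 / c) *\<^sub>R \<tau>"
      and d = id and d' = id, OF assms(1)])
  show "linear (\<lambda>\<tau> :: 'n form. c *\<^sub>R \<tau>)" by (rule linearI) (simp_all add: algebra_simps)
  show "linear (id :: 'n coords \<times> 'n coords \<Rightarrow> _)" by (rule linear_id)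
qed (use assms in \<open>simp_all add: fun_eq_iff clifford_form_simps\<close>)

text \<open>Multiplication by \<open>X\<close> covers minus the reflection in the hyperplane
  orthogonal to \<open>X\<close>. It reverses the parity of the form and changes one spinor of a
  bispinor without a new stabiliser computation.\<close>

lemma stabiliser_conjugate_clifford:
  fixes \<rho> :: "'n::{finite,linorder} form"
  assumes \<rho>: "stabiliser_conjugate_to_square G \<rho>" and X: "pairing X X = e" "e = 1 \<or> e = - 1"
  shows "stabiliser_conjugate_to_square G (clifford_form X \<rho>)"
proof -
  let ?d = "\<lambda>Y. (2 * e * pairing X Y) *\<^sub>R X - Y"
  have pl: "linear (pairing X)" using bilinear_pairing unfolding bilinear_def by blast
  note ps = linear_add[OF pl] linear_cmul[OF pl] linear_diff[OF pl] X(1)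
  have e: "e * e = 1" using X by auto
  have d: "linear ?d"
    by (rule linearI) (simp_all add: ps algebra_simps)
  have dd: "?d \<circ> ?d = id"
  proof
    fix Y
    have "pairing X (?d Y) = pairing X Y" using e by (simp add: ps algebra_simps)
    then show "(?d \<circ> ?d) Y = id Y" by simp
  qed
  show ?thesis
  proof (rule stabiliser_conjugate_transport[where D = "clifford_form X" and D' = "\<lambda>\<tau>. e *\<^sub>R clifford_form X \<tau>"
        and d = ?d and d' = ?d, OF \<rho> linear_clifford_form _ _ d dd dd])
    show "clifford_form X \<circ> (\<lambda>\<tau>. e *\<^sub>R clifford_form X \<tau>) = id"
         "(\<lambda>\<tau>. e *\<^sub>R clifford_form X \<tau>) \<circ> clifford_form X = id"
      using e X by (auto simp: fun_eq_iff clifford_form_simps clifford_square)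
  next
    fix Y and \<tau> :: "'n form"
    have "clifford_form X (clifford_form Y \<tau>) = (2 * pairing X Y) *\<^sub>R \<tau> - clifford_form Y (clifford_form X \<tau>)"
      using clifford_relation[of X Y \<tau>] by (simp add: algebra_simps)
    also have "\<dots> = clifford_form (?d Y) (clifford_form X \<tau>)"
      using e X by (auto simp: clifford_form_simps clifford_square)
    finally show "clifford_form X (clifford_form Y \<tau>) = clifford_form (?d Y) (clifford_form X \<tau>)" .
  next
    fix Y
    show "pairing (?d Y) (?d Y) = pairing Y Y"
      using X(2) by (elim disjE) (simp_all add: bilinear_simps[OF bilinear_pairing] X pairing_commute[of Y X])
  qed
qed

definition scale_form :: "('n \<Rightarrow> real) \<Rightarrow> 'n::{finite,linorder} form \<Rightarrow> 'n form" where
  "scale_form r \<tau> = (\<chi> K. (\<Prod>i\<in>K. r i) * \<tau> $ K)"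

text \<open>A diagonal matrix acts on covectors by \<open>r\<close> and on vectors inversely, so
  \<open>pairing\<close> is kept. This carries constant coefficients to the conformal coframe at
  each point.\<close>

lemma stabiliser_conjugate_scale_form:
  fixes \<rho> :: "'n::{finite,linorder} form"
  assumes \<rho>: "stabiliser_conjugate_to_square G \<rho>" and r: "\<And>i. r i \<noteq> 0"
  shows "stabiliser_conjugate_to_square G (scale_form r \<rho>)"
proof -
  let ?s = "\<lambda>r x. (\<chi> i. r i * x $ i) :: 'n coords"
  let ?d = "\<lambda>r (X :: 'n coords \<times> 'n coords). (?s (\<lambda>i. 1 / r i) (fst X), ?s r (snd X))"
  have pr: "(\<Prod>i\<in>K. r i) \<noteq> 0" for K :: "'n set" using r by simp
  show ?thesis
  proof (rule stabiliser_conjugate_transport[where D = "scale_form r" and D' = "scale_form (\<lambda>i. 1 / r i)"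
        and d = "?d r" and d' = "?d (\<lambda>i. 1 / r i)", OF \<rho>])
    show "linear (scale_form r)"
      by (rule linearI) (simp_all add: scale_form_def vec_eq_iff algebra_simps)
    show "scale_form r \<circ> scale_form (\<lambda>i. 1 / r i) = id" "scale_form (\<lambda>i. 1 / r i) \<circ> scale_form r = id"
      using pr by (simp_all add: fun_eq_iff scale_form_def vec_eq_iff prod_dividef r)
    show "linear (?d r)"
      by (rule linearI) (simp_all add: vec_eq_iff algebra_simps add_divide_distrib)
    show "?d r \<circ> ?d (\<lambda>i. 1 / r i) = id" "?d (\<lambda>i. 1 / r i) \<circ> ?d r = id"
      using r by (simp_all add: fun_eq_iff vec_eq_iff)
    show "pairing (?d r X) (?d r X) = pairing X X" for X
      using r by (simp add: pairing_def inner_vec_def)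
  next
    fix X and \<tau> :: "'n form"
    have ccoef_scale: "(\<Prod>k\<in>K. r k) * ccoef X i K = ccoef (?d r X) i K * (\<Prod>k\<in>flip i K. r k)" for i K
    proof (cases "i \<in> K")
      case True
      then have "(\<Prod>k\<in>K. r k) = r i * (\<Prod>k\<in>K - {i}. r k)" by (simp add: prod.remove)
      with True show ?thesis by (simp add: ccoef_def flip_def)
    qed (use r in \<open>simp add: ccoef_def flip_def\<close>)
    have *: "(\<Prod>k\<in>K. r k) * (sg i K * ccoef X i K * t) = sg i K * ccoef (?d r X) i K * ((\<Prod>k\<in>flip i K. r k) * t)"
      for i K t
    proof -
      have "(\<Prod>k\<in>K. r k) * (sg i K * ccoef X i K * t) = sg i K * ((\<Prod>k\<in>K. r k) * ccoef X i K) * t"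
        by (simp only: mult_ac)
      then show ?thesis by (simp only: ccoef_scale mult_ac)
    qed
    show "scale_form r (clifford_form X \<tau>) = clifford_form (?d r X) (scale_form r \<tau>)"
      by (simp only: vec_eq_iff scale_form_def clifford_form_nth vec_lambda_beta sum_distrib_left *) simp
  qed
qed

section \<open>Reflections and the Cartan-Dieudonne theorem\<close>

definition reflect :: "'a::real_inner \<Rightarrow> 'a \<Rightarrow> 'a" where
  "reflect u x = x - (2 * (u \<bullet> x)) *\<^sub>R u"

abbreviation units :: "'a::real_normed_vector list \<Rightarrow> bool" where
  "units us \<equiv> \<forall>u\<in>set us. norm u = 1"

lemma cprod_reflections:
  fixes c :: "'x::real_inner \<Rightarrow> 's::real_vector \<Rightarrow> 's"
  assumes "units us"
    and "\<And>u x s. norm u = 1 \<Longrightarrow> c u (c x s) = - c (reflect u x) (c u s)"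
    and "\<And>u s. c u (- s) = - c u s"
  shows "cprod c us (c x s) = (- 1) ^ length us *\<^sub>R c (cprod reflect us x) (cprod c us s)"
  using assms(1)
proof (induction us)
  case (Cons u us)
  then show ?case using minus_one_power_cases[of "length us"]
    by (auto simp: assms(2,3))
qed simp

lemma cprod_anticommute:
  fixes c :: "'x \<Rightarrow> 's::real_vector \<Rightarrow> 's"
  assumes "\<And>u s. c u (d s) = - d (c u s)" and "\<And>u s. c u (- s) = - c u s"
  shows "cprod c us (d s) = (- 1) ^ length us *\<^sub>R d (cprod c us s)"
proof (induction us)
  case (Cons u us)
  then show ?case using minus_one_power_cases[of "length us"]
    by (auto simp: assms)
qed simp

lemma orthogonal_transformation_reflect: "norm u = 1 \<Longrightarrow> orthogonal_transformation (reflect u)"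
  unfolding orthogonal_transformation_def
  by (auto intro!: linearI simp: reflect_def inner_simps algebra_simps inner_commute norm_eq_1)

lemma reflect_reflect: "norm u = 1 \<Longrightarrow> reflect u (reflect u x) = x"
  by (simp add: reflect_def inner_simps norm_eq_1)

text \<open>Induction on the number of moved basis vectors. Reflecting in \<open>h b - b\<close>
  sends \<open>h b\<close> back to \<open>b\<close>, and a basis vector fixed by \<open>h\<close> is
  orthogonal to \<open>h b - b\<close>, hence stays fixed.\<close>

lemma cartan_dieudonne:
  fixes h :: "'a::euclidean_space \<Rightarrow> 'a"
  assumes "orthogonal_transformation h"
  shows "\<exists>us. units us \<and> h = cprod reflect us"
  using assms
proof (induction "card {b \<in> Basis. h b \<noteq> b}" arbitrary: h rule: less_induct)
  case less
  have lin: "linear h" and inner: "h x \<bullet> h y = x \<bullet> y" for x y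
    using less.prems by (auto simp: orthogonal_transformation_def)
  show ?case
  proof (cases "\<exists>b\<in>Basis. h b \<noteq> b")
    case False
    then have "h x = x" for x
      using linear_eq_stdbasis[OF lin linear_ident] by (metis)
    then have "h = cprod reflect []" by (simp add: fun_eq_iff)
    then show ?thesis by (intro exI[of _ "[]"]) auto
  next
    case True
    then obtain b where b: "b \<in> Basis" "h b \<noteq> b" by blast
    define u where "u = (1 / norm (h b - b)) *\<^sub>R (h b - b)"
    have u: "norm u = 1" using b by (simp add: u_def)
    define h' where "h' = reflect u \<circ> h"
    have fixed: "h' c = c" if "c \<in> Basis" "h c = c" for c
    proof -
      have "(h b - b) \<bullet> c = 0" using inner[of b c] that by (simp add: inner_simps)
      then have "u \<bullet> c = 0" by (simp add: u_def)
      with that show ?thesis by (simp add: h'_def reflect_def)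
    qed
    have "h' b = b"
    proof -
      \<comment> \<open>Since \<open>b\<close> and \<open>h b\<close> have equal length, the
        reflection subtracts exactly \<open>h b - b\<close> from \<open>h b\<close>.\<close>
      have n: "(norm (h b - b))\<^sup>2 = 2 * ((h b - b) \<bullet> h b)"
        using inner[of b b] by (simp add: power2_norm_eq_inner inner_simps inner_commute)
      have "(2 * (u \<bullet> h b)) *\<^sub>R u = (2 * ((h b - b) \<bullet> h b) / (norm (h b - b))\<^sup>2) *\<^sub>R (h b - b)"
        by (simp add: u_def power2_eq_square)
      also have "\<dots> = h b - b" using b unfolding n[symmetric] by simp
      finally show ?thesis by (simp add: h'_def reflect_def)
    qed
    then have "{c \<in> Basis. h' c \<noteq> c} \<subset> {c \<in> Basis. h c \<noteq> c}" using b fixed by blast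
    then have "card {c \<in> Basis. h' c \<noteq> c} < card {c \<in> Basis. h c \<noteq> c}"
      by (intro psubset_card_mono) auto
    moreover have "orthogonal_transformation h'"
      unfolding h'_def by (intro orthogonal_transformation_compose orthogonal_transformation_reflect u less.prems)
    ultimately obtain us where us: "units us" "h' = cprod reflect us"
      using less.hyps by blast
    have "h x = cprod reflect (u # us) x" for x
      using reflect_reflect[OF u, of "h x"] us(2) by (simp add: h'_def fun_eq_iff flip: us(2))
    then have "h = cprod reflect (u # us)" by blast
    with us u show ?thesis by (intro exI[of _ "u # us"]) auto
  qed
qed

section \<open>Lifting isometries to spinors\<close>

text \<open>The pair (p,q) becomes (p,p) + (-q,q): the first entry parametrises the positive, the
  second the negative definite subspace.\<close>

definition split_coords :: "'n::finite coords \<times> 'n coords \<Rightarrow> 'n coords \<times> 'n coords" where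
  "split_coords X = (fst X - snd X, fst X + snd X)"

abbreviation split_conj ::
    "('n::finite coords \<Rightarrow> 'n coords) \<Rightarrow> ('n coords \<Rightarrow> 'n coords) \<Rightarrow> 'n coords \<times> 'n coords \<Rightarrow> 'n coords \<times> 'n coords" where
  "split_conj h k \<equiv> split_coords \<circ> map_prod h k \<circ> inv split_coords"

lemma clifford_form_split:
  "clifford_form (split_coords X) \<tau> = pos_act (fst X) \<tau> + neg_act (snd X) \<tau>"
proof -
  have "split_coords X = (fst X, fst X) + (- snd X, snd X)" by (simp add: split_coords_def)
  then show ?thesis by (simp only: clifford_form_simps)
qed

lemma split_coords:
  "linear split_coords" "bij split_coords"
  "pairing (split_coords X) (split_coords Y) = fst X \<bullet> fst Y - snd X \<bullet> snd Y"
proof -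
  show "linear split_coords" by (rule linearI) (simp_all add: split_coords_def algebra_simps)
  show "bij split_coords"
    by (rule o_bij[of "\<lambda>X. ((1/2) *\<^sub>R (fst X + snd X), (1/2) *\<^sub>R (snd X - fst X))"])
      (simp_all add: fun_eq_iff split_coords_def vec_eq_iff field_simps)
  show "pairing (split_coords X) (split_coords Y) = fst X \<bullet> fst Y - snd X \<bullet> snd Y"
    by (simp add: pairing_def split_coords_def inner_simps inner_commute)
qed

context clifford_module
begin

lemma cl_reflect:
  assumes "norm u = 1" shows "cl u (cl x s) = - cl (reflect u x) (cl u s)"
  using assms cl_anticommute[of u x s]
  by (simp add: reflect_def cl_simps cl_square norm_eq_1)

lemma cprod_cl_vector:
  "units us \<Longrightarrow>
    cprod cl us (cl x s) = (- 1) ^ length us *\<^sub>R cl (cprod reflect us x) (cprod cl us s)"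
  by (rule cprod_reflections) (auto simp: cl_reflect cl_simps)

lemma linear_cprod_cl: "linear (cprod cl us)"
  by (rule linear_cprod) (rule linear_cl)

lemma norm_cprod_cl: "units us \<Longrightarrow> norm (cprod cl us s) = norm s"
  by (induction us) (auto simp: norm_cl)

lemma minus_lift:
  assumes us: "units us" "even (length us)"
  shows "\<exists>a\<in>spin_group.
    (\<forall>x \<tau>. a (neg_act x \<tau>) = neg_act (cprod reflect us x) (a \<tau>)) \<and>
    (\<forall>x \<tau>. a (pos_act x \<tau>) = pos_act x (a \<tau>)) \<and>
    (\<forall>\<phi> \<psi>. a (Lform \<phi> \<psi>) = Lform (cprod cl us \<phi>) \<psi>) \<and> (\<forall>\<tau>. a (par \<tau>) = par (a \<tau>)) \<and> linear a"
proof (intro bexI[of _ "cprod (\<lambda>u. neg_act u) us"] conjI allI)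
  let ?M = "\<lambda>u. neg_act u :: 'n form \<Rightarrow> 'n form"
  let ?a = "cprod ?M us"
  have "?a = cprod clifford_form (map (\<lambda>u. (- u, u)) us)" by (simp add: fun_eq_iff cprod_map)
  also have "\<dots> \<in> spin_group"
    by (rule spin_groupI) (use us in \<open>auto simp: spin_list_def pairing_minus norm_eq_1 filter_map comp_def cong: filter_cong\<close>)
  finally show "?a \<in> spin_group" .
  show "?a (neg_act x \<tau>) = neg_act (cprod reflect us x) (?a \<tau>)" for x \<tau>
    using fm.cprod_cl_vector[OF us(1)] us(2) by simp
  show "?a (pos_act x \<tau>) = pos_act x (?a \<tau>)" for x \<tau>
    using us(2) cprod_anticommute[where d = "pos_act x" and c = ?M and us = us]
    by (simp add: clifford_form_simps clifford_plus_minus_anticommute)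
  show "?a (par \<tau>) = par (?a \<tau>)" for \<tau>
    using us(2) cprod_anticommute[where d = par and c = ?M and us = us]
    by (simp add: clifford_form_simps clifford_form_par)
  show "?a (Lform \<phi> \<psi>) = Lform (cprod cl us \<phi>) \<psi>" for \<phi> \<psi>
    by (induction us) (auto simp: neg_act_Lform)
  show "linear ?a" by (rule fm.linear_cprod_cl)
qed

text \<open>Every positive vector applied to a bispinor leaves a \<open>par\<close>, and moving the
  next vector past it costs a sign. Over an even list the copies of \<open>par\<close> cancel in
  pairs; of the resulting sign \<open>e\<close> only that it is 1 or -1 is recorded.\<close>

lemma plus_lift:
  assumes us: "units us" "even (length us)"
  shows "\<exists>a\<in>spin_group. \<exists>e\<in>{1, - 1 :: real}.
    (\<forall>x \<tau>. a (pos_act x \<tau>) = pos_act (cprod reflect us x) (a \<tau>)) \<and>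
    (\<forall>x \<tau>. a (neg_act x \<tau>) = neg_act x (a \<tau>)) \<and>
    (\<forall>\<phi> \<psi>. a (Lform \<phi> \<psi>) = e *\<^sub>R Lform \<phi> (cprod cl us \<psi>)) \<and> (\<forall>\<tau>. a (par \<tau>) = par (a \<tau>)) \<and> linear a"
proof -
  let ?P = "\<lambda>u. pos_act u :: 'n form \<Rightarrow> 'n form"
  let ?a = "cprod ?P us"
  have refl: "?P u (?P x \<tau>) = - ?P (reflect u x) (?P u \<tau>)" if "norm u = 1" for u x \<tau>
  proof -
    have "?P (reflect u x) = clifford_form ((x, x) - (2 * (u \<bullet> x)) *\<^sub>R (u, u))"
      by (simp add: reflect_def)
    then show ?thesis
      using clifford_relation[of "(u, u)" "(x, x)" \<tau>] that
      by (simp add: clifford_form_simps clifford_square pairing_plus norm_eq_1 algebra_simps del: scaleR_Pair)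
  qed
  have "?a = cprod clifford_form (map (\<lambda>u. (u, u)) us)" by (simp add: fun_eq_iff cprod_map)
  also have "\<dots> \<in> spin_group"
    by (rule spin_groupI) (use us in \<open>auto simp: spin_list_def pairing_plus norm_eq_1 filter_map comp_def cong: filter_cong\<close>)
  finally have 1: "?a \<in> spin_group" .
  have 2: "?a (?P x \<tau>) = ?P (cprod reflect us x) (?a \<tau>)" for x \<tau>
    using us cprod_reflections[of us ?P] by (simp add: refl clifford_form_simps)
  have 3: "?a (neg_act x \<tau>) = neg_act x (?a \<tau>)" for x \<tau>
    using us(2) cprod_anticommute[where d = "neg_act x" and c = ?P and us = us]
    by (simp add: clifford_form_simps clifford_plus_minus_anticommute)
  have 4: "?a (par \<tau>) = par (?a \<tau>)" for \<tau>
    using us(2) cprod_anticommute[where d = par and c = ?P and us = us]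
    by (simp add: clifford_form_simps clifford_form_par)
  have "\<exists>e\<in>{1, - 1 :: real}. \<forall>\<phi> \<psi>. cprod ?P vs (Lform \<phi> \<psi>) =
      e *\<^sub>R (if even (length vs) then Lform \<phi> (cprod cl vs \<psi>) else par (Lform \<phi> (cprod cl vs \<psi>)))" for vs
  proof (induction vs)
    case (Cons v vs)
    then obtain e where e: "e \<in> {1, - 1 :: real}" "\<And>\<phi> \<psi>. cprod ?P vs (Lform \<phi> \<psi>) =
      e *\<^sub>R (if even (length vs) then Lform \<phi> (cprod cl vs \<psi>) else par (Lform \<phi> (cprod cl vs \<psi>)))" by blast
    show ?case
      by (rule bexI[of _ "if even (length vs) then e else - e"])
        (use e(1) in \<open>auto simp: e(2) clifford_form_simps pos_act_Lform clifford_form_par\<close>)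
  qed auto
  then obtain e where "e \<in> {1, - 1 :: real}" "\<And>\<phi> \<psi>. ?a (Lform \<phi> \<psi>) = e *\<^sub>R Lform \<phi> (cprod cl us \<psi>)"
    using us(2) by (smt (verit, best))
  moreover have "linear ?a" by (intro linear_cprod linear_clifford_form)
  ultimately show ?thesis
    using 1 2 3 4 by blast
qed

text \<open>Parity projection up to a factor: s = -1 gives twice the odd part, s = 1 twice the even
  part, s = 0 the whole bispinor. In dimension 8 the chirality already fixes the parity, in
  dimension 7 a part has to be selected.\<close>

definition tensor_form :: "real \<Rightarrow> 's \<Rightarrow> 's \<Rightarrow> 'n form" where
  "tensor_form s \<phi> \<psi> = Lform \<phi> \<psi> + s *\<^sub>R par (Lform \<phi> \<psi>)"

text \<open>The lift may reverse the spinor, because -1 lies in the spin group of forms and can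
  correct the sign.\<close>

definition spinor_lift :: "('n coords \<Rightarrow> 'n coords) \<Rightarrow> 's \<Rightarrow> bool" where
  "spinor_lift h \<phi> \<longleftrightarrow> (\<exists>us. units us \<and> even (length us) \<and> h = cprod reflect us \<and>
     (\<exists>e\<in>{1, - 1}. cprod cl us \<phi> = e *\<^sub>R \<phi>))"

text \<open>The lifts of \<open>h\<close> and \<open>k\<close> act on separate spinors and together
  change the bispinor by a sign \<open>r\<close>. Multiplying by \<open>r\<close> remains in the
  spin group, covers the same map and fixes the form.\<close>

lemma covered_stabiliserI:
  assumes "spinor_lift h \<phi>" "spinor_lift k \<psi>"
  shows "split_conj k h \<in> covered_stabiliser (tensor_form s \<phi> \<psi>)"
proof -
  obtain us e where us: "units us" "even (length us)" "h = cprod reflect us"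
      "cprod cl us \<phi> = e *\<^sub>R \<phi>" "e \<in> {1, - 1}"
    using assms(1) unfolding spinor_lift_def by blast
  obtain vs e' where vs: "units vs" "even (length vs)" "k = cprod reflect vs"
      "cprod cl vs \<psi> = e' *\<^sub>R \<psi>" "e' \<in> {1, - 1}"
    using assms(2) unfolding spinor_lift_def by blast
  obtain a where a: "a \<in> spin_group"
    "\<And>x \<tau>. a (neg_act x \<tau>) = neg_act (h x) (a \<tau>)"
    "\<And>x \<tau>. a (pos_act x \<tau>) = pos_act x (a \<tau>)"
    "\<And>\<phi> \<psi>. a (Lform \<phi> \<psi>) = Lform (cprod cl us \<phi>) \<psi>" "\<And>\<tau>. a (par \<tau>) = par (a \<tau>)" "linear a"
    using minus_lift[OF us(1,2), folded us(3)] by blast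
  obtain b e'' where b: "b \<in> spin_group" "e'' \<in> {1, - 1 :: real}"
    "\<And>x \<tau>. b (pos_act x \<tau>) = pos_act (k x) (b \<tau>)"
    "\<And>x \<tau>. b (neg_act x \<tau>) = neg_act x (b \<tau>)"
    "\<And>\<phi> \<psi>. b (Lform \<phi> \<psi>) = e'' *\<^sub>R Lform \<phi> (cprod cl vs \<psi>)" "\<And>\<tau>. b (par \<tau>) = par (b \<tau>)" "linear b"
    using plus_lift[OF vs(1,2), folded vs(3)] by blast
  define r where "r = e * e' * e''"
  have r: "r = 1 \<or> r = - 1" using us vs b by (auto simp: r_def)
  define c where "c \<tau> = r *\<^sub>R a (b \<tau>)" for \<tau>
  have "c = a \<circ> b \<or> c = uminus \<circ> (a \<circ> b)" using r by (auto simp: c_def fun_eq_iff)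
  then have c: "c \<in> spin_group"
    using spin_group_comp[OF a(1) b(1)] spin_group_comp[OF minus_in_spin_group spin_group_comp[OF a(1) b(1)]]
    by (auto simp: comp_def)
  have "c (Lform \<phi> \<psi>) = (r * r) *\<^sub>R Lform \<phi> \<psi>"
    by (simp add: c_def b(5) a(4) vs(4) us(4) Lform_simps linear_cmul[OF a(6)] linear_cmul[OF b(7)] r_def mult_ac)
  then have cL: "c (Lform \<phi> \<psi>) = Lform \<phi> \<psi>" using r by auto
  have "linear c" unfolding c_def using linear_compose[OF b(7) a(6)]
    by (intro linear_compose_scale_right) (simp add: comp_def)
  moreover have "c (par \<tau>) = par (c \<tau>)" for \<tau>
    by (simp add: c_def a b linear_cmul[OF linear_par])
  ultimately have "c (tensor_form s \<phi> \<psi>) = tensor_form s \<phi> \<psi>"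
    by (simp add: tensor_form_def linear_add linear_cmul cL)
  moreover have "spin_covers c (split_conj k h)"
    unfolding spin_covers_def
  proof (intro allI ext)
    fix X :: "'n coords \<times> 'n coords" and \<tau>
    obtain Y where Y: "X = split_coords Y" using split_coords(2) by (metis bij_pointE)
    have inv: "inv split_coords X = Y"
      unfolding Y by (rule inv_f_f[OF bij_is_inj[OF split_coords(2)]])
    show "(c \<circ> clifford_form X) \<tau> =
        (clifford_form ((split_conj k h) X) \<circ> c) \<tau>"
      by (cases Y) (simp add: inv, simp add: Y clifford_form_split c_def a b clifford_form_simps linear_add[OF a(6)] linear_add[OF b(7)]
          scaleR_add_right)
  qed
  ultimately show ?thesis using c by (auto simp: covered_stabiliser_def stabiliser_def)
qed

end

text \<open>The assumption says that the commutant is the field of real numbers, so the module is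
  irreducible of real type. Invariant bilinear forms and lifts of isometries then become unique up
  to a scalar.\<close>

locale clifford_schur = clifford_module cl
  for cl :: "'n::{finite,linorder} coords \<Rightarrow> 's::euclidean_space \<Rightarrow> 's" +
  assumes schur: "linear T \<Longrightarrow> (\<And>x s. T (cl x s) = cl x (T s)) \<Longrightarrow> \<exists>c :: real. \<forall>s. T s = c *\<^sub>R s"
begin

text \<open>Represent \<open>b\<close> by an operator through the inner product. Vectors are skew
  for both forms, so the operator commutes with them and is a scalar.\<close>

lemma schur_bilinear:
  fixes b :: "'s \<Rightarrow> 's \<Rightarrow> real"
  assumes b: "bilinear b" and skew: "\<And>x s t. b (cl x s) t = - b s (cl x t)"
  shows "\<exists>c. \<forall>s t. b s t = c * (s \<bullet> t)"
proof -
  have lin: "linear (b s)" "linear (\<lambda>s. b s t)" for s t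
    using b by (auto simp: bilinear_def)
  define T where "T s = (\<Sum>u\<in>Basis. b s u *\<^sub>R u)" for s
  have T: "T s \<bullet> t = b s t" for s t
  proof -
    have "T s \<bullet> t = (\<Sum>u\<in>Basis. (t \<bullet> u) * b s u)"
      by (simp add: T_def inner_sum_left inner_commute[of t] mult.commute)
    also have "\<dots> = b s (\<Sum>u\<in>Basis. (t \<bullet> u) *\<^sub>R u)"
      by (simp add: linear_sum[OF lin(1)] linear_cmul[OF lin(1)])
    finally show ?thesis by (simp add: euclidean_representation)
  qed
  have "linear T"
    by (rule linearI; rule euclidean_eqI) (simp_all add: T inner_simps linear_add[OF lin(2)] linear_cmul[OF lin(2)])
  moreover have "T (cl x s) = cl x (T s)" for x s
    by (rule euclidean_eqI) (simp add: T skew cl_skew)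
  ultimately obtain c where "\<And>s. T s = c *\<^sub>R s" using schur by blast
  then have "b s t = c * (s \<bullet> t)" for s t using T[of s t] by simp
  then show ?thesis by blast
qed

text \<open>Vectors are skew in either spinor argument, by the negative action in the first and by
  \<open>par\<close> after the positive action in the second. Schur's lemma for both leaves one
  constant, positive because \<open>Lform u u\<close> has degree-zero part 1 for a unit
  \<open>u\<close>.\<close>

lemma Lform_inner:
  "\<exists>N>0. \<forall>\<phi> \<psi> \<phi>' \<psi>'. Lform \<phi> \<psi> \<bullet> Lform \<phi>' \<psi>' = N * (\<phi> \<bullet> \<phi>') * (\<psi> \<bullet> \<psi>')"
proof -
  have bil: "bilinear (\<lambda>\<phi> \<phi>'. Lform \<phi> \<psi> \<bullet> Lform \<phi>' \<psi>')" "bilinear (\<lambda>\<psi> \<psi>'. Lform \<phi> \<psi> \<bullet> Lform \<phi>' \<psi>')"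
    for \<phi> \<phi>' \<psi> \<psi>'
    unfolding bilinear_def by (intro conjI allI; rule linearI; simp add: Lform_simps inner_simps)+
  have "Lform (cl x \<phi>) \<psi> \<bullet> Lform \<phi>' \<psi>' = - (Lform \<phi> \<psi> \<bullet> Lform (cl x \<phi>') \<psi>')" for x \<phi> \<phi>' \<psi> \<psi>'
    by (simp add: neg_act_Lform[symmetric] fm.cl_skew)
  from schur_bilinear[OF bil(1) this] obtain c where
    c: "\<And>\<phi> \<psi> \<phi>' \<psi>'. Lform \<phi> \<psi> \<bullet> Lform \<phi>' \<psi>' = c \<psi> \<psi>' * (\<phi> \<bullet> \<phi>')"
    by metis
  have "Lform \<phi> (cl x \<psi>) \<bullet> Lform \<phi>' \<psi>' = - (Lform \<phi> \<psi> \<bullet> Lform \<phi>' (cl x \<psi>'))" for x \<phi> \<phi>' \<psi> \<psi>'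
  proof -
    have "Lform \<phi> (cl x \<psi>) = par (pos_act x (Lform \<phi> \<psi>))" for \<phi> \<psi>
      by (simp add: pos_act_Lform)
    then show ?thesis
      by (simp add: par_inner clifford_form_adjoint clifford_form_par)
  qed
  from schur_bilinear[OF bil(2) this] obtain d where
    d: "\<And>\<phi> \<psi> \<phi>' \<psi>'. Lform \<phi> \<psi> \<bullet> Lform \<phi>' \<psi>' = d \<phi> \<phi>' * (\<psi> \<bullet> \<psi>')"
    by metis
  obtain u :: 's where u: "u \<in> Basis" using nonempty_Basis by blast
  have "c \<psi> \<psi>' = d u u * (\<psi> \<bullet> \<psi>')" for \<psi> \<psi>' using c[of u \<psi> u \<psi>'] d[of u \<psi> u \<psi>'] u by simp
  then have "Lform \<phi> \<psi> \<bullet> Lform \<phi>' \<psi>' = d u u * (\<phi> \<bullet> \<phi>') * (\<psi> \<bullet> \<psi>')" for \<phi> \<psi> \<phi>' \<psi>'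
    by (simp add: c)
  moreover have "d u u > 0"
  proof -
    have "Lform u u $ {} = 1" using u by (simp add: Lform_def)
    then have "Lform u u \<noteq> 0" by auto
    then have "Lform u u \<bullet> Lform u u > 0" by simp
    then show ?thesis using d[of u u u u] u by simp
  qed
  ultimately show ?thesis by blast
qed

text \<open>\<open>R\<close> and the Clifford product intertwine the same isometry, so they differ
  by a scalar, and comparing norms makes it 1 or -1.\<close>

lemma schur_lift:
  assumes R: "orthogonal_transformation R"
      "\<And>x s. R (cl x s) = (- 1) ^ length us *\<^sub>R cl (cprod reflect us x) (R s)"
    and us: "units us"
  shows "\<exists>e\<in>{1, - 1}. \<forall>s. cprod cl us s = e *\<^sub>R R s"
proof -
  have lin: "linear R" and bij: "bij R"
    using R(1) by (auto simp: orthogonal_transformation_linear orthogonal_transformation_bij)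
  define T where "T = inv R \<circ> cprod cl us"
  have RT: "R (T s) = cprod cl us s" for s
    using bij by (simp add: T_def bij_is_surj surj_f_inv_f)
  have "linear T"
    unfolding T_def using lin bij
    by (intro linear_compose linear_cprod_cl) (metis bij_is_inj inj_linear_imp_inv_linear)
  moreover have "T (cl x s) = cl x (T s)" for x s
  proof -
    have "R (T (cl x s)) = R (cl x (T s))"
      using us by (simp add: RT R(2) cprod_cl_vector)
    then show ?thesis using bij by (simp add: bij_is_inj inj_eq)
  qed
  ultimately obtain c where c: "\<And>s. T s = c *\<^sub>R s" using schur by blast
  then have *: "cprod cl us s = c *\<^sub>R R s" for s
    using RT[of s] lin by (simp add: linear_cmul)
  obtain u :: 's where u: "u \<in> Basis" using nonempty_Basis by blast
  have "norm (cprod cl us u) = norm (c *\<^sub>R R u)" by (simp only: *)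
  then have "\<bar>c\<bar> = 1"
    using u us orthogonal_transformation_norm[OF R(1), of u] by (simp add: norm_cprod_cl)
  then show ?thesis using * by (intro bexI[of _ c]) auto
qed

end

section \<open>Octonions\<close>

lemma UNIV_7: "(UNIV :: 7 set) = {0, 1, 2, 3, 4, 5, 6}"
proof -
  have "x \<in> {0, 1, 2, 3, 4, 5, 6}" for x :: 7
  proof (cases x)
    case (of_int z)
    then have "z = 0 \<or> z = 1 \<or> z = 2 \<or> z = 3 \<or> z = 4 \<or> z = 5 \<or> z = 6" by simp linarith
    then show ?thesis unfolding of_int by (elim disjE) simp_all
  qed
  then show ?thesis by (rule UNIV_eq_I)
qed

lemma UNIV_8: "(UNIV :: 8 set) = {0, 1, 2, 3, 4, 5, 6, 7}"
proof -
  have "x \<in> {0, 1, 2, 3, 4, 5, 6, 7}" for x :: 8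
  proof (cases x)
    case (of_int z)
    then have "z = 0 \<or> z = 1 \<or> z = 2 \<or> z = 3 \<or> z = 4 \<or> z = 5 \<or> z = 6 \<or> z = 7" by simp linarith
    then show ?thesis unfolding of_int by (elim disjE) simp_all
  qed
  then show ?thesis by (rule UNIV_eq_I)
qed

lemmas less_7_8 = less_bit0_def less_bit1_def bit0.Rep_numeral bit1.Rep_numeral
  bit0.Rep_0 bit1.Rep_0 bit0.Rep_1 bit1.Rep_1

lemma sorted_UNIV_7: "sorted_list_of_set (UNIV :: 7 set) = [0, 1, 2, 3, 4, 5, 6]"
  unfolding UNIV_7
  by (rule sorted_list_of_set.idem_if_sorted_distinct[of "[0, 1, 2, 3, 4, 5, 6]", unfolded list.set])
    (simp_all add: less_eq_bit1_def less_7_8)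

lemma sorted_UNIV_8: "sorted_list_of_set (UNIV :: 8 set) = [0, 1, 2, 3, 4, 5, 6, 7]"
  unfolding UNIV_8
  by (rule sorted_list_of_set.idem_if_sorted_distinct[of "[0, 1, 2, 3, 4, 5, 6, 7]", unfolded list.set])
    (simp_all add: less_eq_bit0_def less_7_8)

lemma sum_7: "(\<Sum>i\<in>(UNIV :: 7 set). f i) = f 0 + f 1 + f 2 + f 3 + f 4 + f 5 + (f 6 :: 'a::comm_monoid_add)"
  unfolding UNIV_7 by (simp add: add.assoc)

lemma sum_8: "(\<Sum>i\<in>(UNIV :: 8 set). f i) =
    f 0 + f 1 + f 2 + f 3 + f 4 + f 5 + f 6 + (f 7 :: 'a::comm_monoid_add)"
  unfolding UNIV_8 by (simp add: add.assoc)

lemma all_7: "(\<forall>i :: 7. P i) \<longleftrightarrow> P 0 \<and> P 1 \<and> P 2 \<and> P 3 \<and> P 4 \<and> P 5 \<and> P 6"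
proof -
  have "(\<forall>i :: 7. P i) \<longleftrightarrow> (\<forall>i\<in>UNIV. P i)" by simp
  then show ?thesis unfolding UNIV_7 by simp
qed

lemma vec_eq_7: "x = (y :: 'a ^ 7) \<longleftrightarrow> x $ 0 = y $ 0 \<and> x $ 1 = y $ 1 \<and> x $ 2 = y $ 2 \<and> x $ 3 = y $ 3 \<and>
    x $ 4 = y $ 4 \<and> x $ 5 = y $ 5 \<and> x $ 6 = y $ 6"
  unfolding vec_eq_iff all_7 ..

lemma inner_7: "x \<bullet> (y :: real ^ 7) = x $ 0 * y $ 0 + x $ 1 * y $ 1 + x $ 2 * y $ 2 + x $ 3 * y $ 3 +
    x $ 4 * y $ 4 + x $ 5 * y $ 5 + x $ 6 * y $ 6"
  by (simp add: inner_vec_def sum_7)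

lemma numerals_mod_7: "(7 :: 7) = 0" "(8 :: 7) = 1" "(9 :: 7) = 2" "(10 :: 7) = 3" "(11 :: 7) = 4" "(12 :: 7) = 5"
  by simp_all

lemma cross7_components:
  "cross7 x y $ 0 = x $ 1 * y $ 3 - x $ 3 * y $ 1 + x $ 2 * y $ 6 - x $ 6 * y $ 2 + x $ 4 * y $ 5 - x $ 5 * y $ 4"
  "cross7 x y $ 1 = x $ 2 * y $ 4 - x $ 4 * y $ 2 + x $ 3 * y $ 0 - x $ 0 * y $ 3 + x $ 5 * y $ 6 - x $ 6 * y $ 5"
  "cross7 x y $ 2 = x $ 3 * y $ 5 - x $ 5 * y $ 3 + x $ 4 * y $ 1 - x $ 1 * y $ 4 + x $ 6 * y $ 0 - x $ 0 * y $ 6"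
  "cross7 x y $ 3 = x $ 4 * y $ 6 - x $ 6 * y $ 4 + x $ 5 * y $ 2 - x $ 2 * y $ 5 + x $ 0 * y $ 1 - x $ 1 * y $ 0"
  "cross7 x y $ 4 = x $ 5 * y $ 0 - x $ 0 * y $ 5 + x $ 6 * y $ 3 - x $ 3 * y $ 6 + x $ 1 * y $ 2 - x $ 2 * y $ 1"
  "cross7 x y $ 5 = x $ 6 * y $ 1 - x $ 1 * y $ 6 + x $ 0 * y $ 4 - x $ 4 * y $ 0 + x $ 2 * y $ 3 - x $ 3 * y $ 2"
  "cross7 x y $ 6 = x $ 0 * y $ 2 - x $ 2 * y $ 0 + x $ 1 * y $ 5 - x $ 5 * y $ 1 + x $ 3 * y $ 4 - x $ 4 * y $ 3"
  by (simp_all add: cross7_def phi0_def sum_7 axis_def numerals_mod_7)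

lemma phi0_cross7: "phi0 x y z = cross7 x y \<bullet> z"
  unfolding inner_7 cross7_components phi0_def sum_7 by (simp add: numerals_mod_7 algebra_simps)

lemma bilinear_cross7: "bilinear cross7"
  unfolding bilinear_def
  by (intro conjI allI; rule linearI; simp add: vec_eq_7 cross7_components algebra_simps)

lemma cross7_self [simp]: "cross7 x x = 0"
  by (simp add: vec_eq_7 cross7_components)

lemma cross7_commute: "cross7 y x = - cross7 x y"
  by (simp add: vec_eq_7 cross7_components)

lemma cross7_skew: "cross7 x y \<bullet> z = - (y \<bullet> cross7 x z)"
  by (simp add: inner_7 cross7_components algebra_simps)

lemma cross7_cross7: "cross7 x (cross7 x y) = (x \<bullet> y) *\<^sub>R x - (x \<bullet> x) *\<^sub>R y"
  by (simp add: vec_eq_7 inner_7 cross7_components algebra_simps)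

lemmas cross7_simps = bilinear_simps[OF bilinear_cross7]

interpretation c7: clifford_module clifford7
proof
  show "bilinear clifford7"
    unfolding bilinear_def
    by (intro conjI allI; rule linearI;
        simp add: clifford7_def cross7_simps inner_simps algebra_simps)
next
  fix x and s t :: spinor7
  have "x \<bullet> cross7 x v = 0" for v
    using cross7_skew[of x x v] by simp
  then show "clifford7 x (clifford7 x s) = - (x \<bullet> x) *\<^sub>R s"
    by (cases s) (simp add: clifford7_def cross7_simps inner_simps cross7_cross7 algebra_simps)
  show "clifford7 x s \<bullet> t = - (s \<bullet> clifford7 x t)"
    using cross7_skew[of x "snd s" "snd t"]
    by (simp add: clifford7_def inner_prod_def inner_simps inner_commute algebra_simps)
qed

lemma fst_clifford7 [simp]: "fst (clifford7 x s) = - (x \<bullet> snd s)"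
  and snd_clifford7 [simp]: "snd (clifford7 x s) = fst s *\<^sub>R x - cross7 x (snd s)"
  by (simp_all add: clifford7_def)

lemma spinor7_eq_iff: "s = (t :: spinor7) \<longleftrightarrow> fst s = fst t \<and> snd s $ 0 = snd t $ 0 \<and> snd s $ 1 = snd t $ 1 \<and>
    snd s $ 2 = snd t $ 2 \<and> snd s $ 3 = snd t $ 3 \<and> snd s $ 4 = snd t $ 4 \<and> snd s $ 5 = snd t $ 5 \<and>
    snd s $ 6 = snd t $ 6"
  by (simp add: prod_eq_iff vec_eq_7)

abbreviation one7 :: spinor7 where "one7 \<equiv> (1, 0)"

text \<open>Vectors applied to the octonion unit give all imaginary octonions, so operators
  commuting with Clifford multiplication are known from their value on \<open>one7\<close>.\<close>

lemma spinor7_decompose: "s = fst s *\<^sub>R one7 + clifford7 (snd s) one7"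
  by (simp add: prod_eq_iff bilinear_rzero[OF bilinear_cross7])

text \<open>In odd dimension the volume element commutes with vectors; hence evaluating it on
  \<open>one7\<close> suffices.\<close>

lemma clifford7_volume: "c7.eI UNIV s = s"
proof -
  have one: "c7.eI UNIV one7 = one7"
  proof -
    have axes: "clifford7 (axis 5 1) (0, axis 6 1) = (0, - axis 1 1)"
      "clifford7 (axis 4 1) (0, - axis 1 1) = (0, axis 2 1)" "clifford7 (axis 3 1) (0, axis 2 1) = (0, axis 5 1)"
      "clifford7 (axis 2 1) (0, axis 5 1) = (0, axis 3 1)" "clifford7 (axis 1 1) (0, axis 3 1) = (0, - axis 0 1)"
      "clifford7 (axis 0 1) (0, - axis 0 1) = one7"
      by (simp_all add: clifford7_def inner_7 vec_eq_7 cross7_components axis_def)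
    have "clifford7 (axis 6 1) one7 = (0, axis 6 1)"
      by (simp add: clifford7_def bilinear_rzero[OF bilinear_cross7])
    then show ?thesis
      by (simp add: c7.eI_def sorted_UNIV_7 axes)
  qed
  have "c7.eI UNIV (clifford7 x s) = clifford7 x (c7.eI UNIV s)" for x s
    by (simp add: c7.cl_sum_axis[of x] linear_sum[OF c7.linear_eI] linear_cmul[OF c7.linear_eI] c7.eI_cl_axis)
  then have "c7.eI UNIV (fst s *\<^sub>R one7 + clifford7 (snd s) one7) = fst s *\<^sub>R one7 + clifford7 (snd s) one7"
    by (simp add: linear_add[OF c7.linear_eI] linear_cmul[OF c7.linear_eI] one del: scaleR_Pair)
  then show ?thesis unfolding spinor7_decompose[symmetric] .
qed

text \<open>Write (c,v) for the image of the unit under \<open>T\<close>. Each relation below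
  between three units passes to (c,v) and confines v to the span of these units, since it holds on
  the quaternion subalgebra they generate and fails with the opposite sign off it. The triples
  {0,1,3}, {1,2,4}, {4,5,0} have no common index, so v = 0.\<close>

interpretation c7: clifford_schur clifford7
proof
  fix T :: "spinor7 \<Rightarrow> spinor7"
  assume lin: "linear T" and T: "\<And>x s. T (clifford7 x s) = clifford7 x (T s)"
  obtain c v where cv: "T one7 = (c, v)" by force
  have "clifford7 (axis 0 1) (clifford7 (axis 1 1) one7) = - clifford7 (axis 3 1) one7"
    "clifford7 (axis 1 1) (clifford7 (axis 2 1) one7) = - clifford7 (axis 4 1) one7"
    "clifford7 (axis 4 1) (clifford7 (axis 5 1) one7) = - clifford7 (axis 0 1) one7"
    by (simp_all add: spinor7_eq_iff cross7_components axis_def inner_7)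
  from this[THEN arg_cong[where f = T], unfolded linear_neg[OF lin] T cv]
  have "v = 0"
    by (simp add: spinor7_eq_iff cross7_components axis_def inner_7 vec_eq_7)
  have "T (fst s *\<^sub>R one7 + clifford7 (snd s) one7) = c *\<^sub>R (fst s *\<^sub>R one7 + clifford7 (snd s) one7)" for s
  proof -
    have "(c, v) = c *\<^sub>R one7" using \<open>v = 0\<close> by simp
    then show ?thesis
      by (simp only: linear_add[OF lin] linear_cmul[OF lin] T cv c7.cl_simps)
        (simp only: scaleR_add_right scaleR_left_commute)
  qed
  then show "\<exists>c. \<forall>s. T s = c *\<^sub>R s"
    unfolding spinor7_decompose[symmetric] by blast
qed

lemma (in clifford_module) eI_UNIV_cl:
  "eI UNIV (cl x s) = - ((- 1) ^ CARD('n)) *\<^sub>R cl x (eI UNIV s)"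
  by (simp add: cl_sum_axis[of x] linear_sum[OF linear_eI] linear_cmul[OF linear_eI] eI_cl_axis
      scaleR_sum_right sum_negf mult.commute)

text \<open>In even dimension the volume element passes e_K with sign (-1)^(card K) and is an
  isometry, so inserting it into both arguments produces the degree sign.\<close>

lemma (in clifford_module) par_Lform:
  assumes "even CARD('n)"
  shows "par (Lform \<phi> \<psi>) = Lform (eI UNIV \<phi>) (eI UNIV \<psi>)"
proof -
  have "eI K (eI UNIV \<psi>) = (- 1) ^ card K *\<^sub>R eI UNIV (eI K \<psi>)" for K
  proof -
    have "cprod (\<lambda>i. cl (axis i 1)) is (eI UNIV \<psi>) =
        (- 1) ^ length is *\<^sub>R eI UNIV (cprod (\<lambda>i. cl (axis i 1)) is \<psi>)" for "is"
      using assms cprod_anticommute[where c = "\<lambda>i. cl (axis i 1)" and d = "eI UNIV" and us = "is" and s = \<psi>]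
      by (simp add: eI_UNIV_cl cl_simps)
    from this[of "sorted_list_of_set K"] show ?thesis by (simp add: eI_def[of K])
  qed
  then show ?thesis
    by (simp only: par_def Lform_def vec_eq_iff vec_lambda_beta inner_scaleR_left eI_inner_eI) simp
qed

section \<open>Vectors and spinors in dimension 8\<close>

lemma card_less_7:
  "card {j. j < (0 :: 7)} = 0" "card {j. j < (1 :: 7)} = 1" "card {j. j < (2 :: 7)} = 2"
  "card {j. j < (3 :: 7)} = 3" "card {j. j < (4 :: 7)} = 4" "card {j. j < (5 :: 7)} = 5"
  "card {j. j < (6 :: 7)} = 6"
proof -
  let ?xs = "[0, 1, 2, 3, 4, 5, 6 :: 7]"
  have "set ?xs = UNIV" by (simp add: UNIV_7)
  then have "{j. j < k} = set (filter (\<lambda>j. j < k) ?xs)" for k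
    unfolding set_filter by simp
  moreover have "distinct ?xs" by simp
  ultimately have card: "card {j. j < k} = length (filter (\<lambda>j. j < k) ?xs)" for k
    by (metis distinct_card distinct_filter)
  show "card {j. j < (0 :: 7)} = 0" "card {j. j < (1 :: 7)} = 1" "card {j. j < (2 :: 7)} = 2"
    "card {j. j < (3 :: 7)} = 3" "card {j. j < (4 :: 7)} = 4" "card {j. j < (5 :: 7)} = 5"
    "card {j. j < (6 :: 7)} = 6"
    unfolding card by (simp_all add: less_7_8)
qed

lemma first7_nth: "first7 x $ 0 = x $ 0" "first7 x $ 1 = x $ 1" "first7 x $ 2 = x $ 2" "first7 x $ 3 = x $ 3"
  "first7 x $ 4 = x $ 4" "first7 x $ 5 = x $ 5" "first7 x $ 6 = x $ 6"
  by (simp_all add: first7_def card_less_7)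

lemma linear_first7: "linear first7"
  by (rule linearI) (simp_all add: vec_eq_7 first7_nth)

lemma all_8: "(\<forall>i :: 8. P i) \<longleftrightarrow> P 0 \<and> P 1 \<and> P 2 \<and> P 3 \<and> P 4 \<and> P 5 \<and> P 6 \<and> P 7"
proof -
  have "(\<forall>i :: 8. P i) \<longleftrightarrow> (\<forall>i\<in>UNIV. P i)" by simp
  then show ?thesis unfolding UNIV_8 by simp
qed

lemma vec_eq_8: "x = (y :: real ^ 8) \<longleftrightarrow> first7 x = first7 y \<and> x $ 7 = y $ 7"
  unfolding vec_eq_iff[of x y] all_8 vec_eq_7 first7_nth by simp

lemma inner_8: "x \<bullet> (y :: real ^ 8) = first7 x \<bullet> first7 y + x $ 7 * y $ 7"
  by (simp add: inner_vec_def sum_8 sum_7 first7_nth)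

text \<open>Makes the vectors of R^8 octonions too, with the scalar part as last coordinate; vectors
  and both kinds of half-spinors are then copies of one space.\<close>

definition join8 :: "spinor7 \<Rightarrow> real ^ 8" where
  "join8 s = snd s $ 0 *\<^sub>R axis 0 1 + snd s $ 1 *\<^sub>R axis 1 1 + snd s $ 2 *\<^sub>R axis 2 1 + snd s $ 3 *\<^sub>R axis 3 1 +
    snd s $ 4 *\<^sub>R axis 4 1 + snd s $ 5 *\<^sub>R axis 5 1 + snd s $ 6 *\<^sub>R axis 6 1 + fst s *\<^sub>R axis 7 1"

lemma first7_join8 [simp]: "first7 (join8 s) = snd s"
  and join8_7 [simp]: "join8 s $ 7 = fst s"
  by (simp_all add: vec_eq_7 first7_nth join8_def axis_def)

lemma join8_first7 [simp]: "join8 (x $ 7, first7 x) = x"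
  by (simp add: vec_eq_8)

lemma linear_join8: "linear join8"
  by (rule linearI) (simp_all add: vec_eq_8 linear_add[OF linear_first7] linear_cmul[OF linear_first7])

lemma join8_inner: "join8 s \<bullet> join8 t = s \<bullet> t"
  by (simp add: inner_8 inner_prod_def)

lemma fst_clifford8 [simp]: "fst (clifford8 x s) = clifford7 (first7 x) (snd s) - x $ 7 *\<^sub>R snd s"
  and snd_clifford8 [simp]: "snd (clifford8 x s) = clifford7 (first7 x) (fst s) + x $ 7 *\<^sub>R fst s"
  by (simp_all add: clifford8_def)

interpretation c8: clifford_module clifford8
proof
  show "bilinear clifford8"
    unfolding bilinear_def
    by (intro conjI allI; rule linearI;
        simp add: clifford8_def c7.cl_simps linear_add[OF linear_first7] linear_cmul[OF linear_first7] algebra_simps)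
next
  fix x and s t :: spinor8
  show "clifford8 x (clifford8 x s) = - (x \<bullet> x) *\<^sub>R s"
    by (rule prod_eqI) (simp_all add: c7.cl_simps c7.cl_square inner_8 algebra_simps)
  show "clifford8 x s \<bullet> t = - (s \<bullet> clifford8 x t)"
    by (simp add: clifford8_def inner_prod_def[of "(_, _)"] inner_prod_def[of s] inner_simps c7.cl_skew)
qed

lemma first7_axis: "first7 (axis 0 1) = axis 0 1" "first7 (axis 1 1) = axis 1 1" "first7 (axis 2 1) = axis 2 1"
  "first7 (axis 3 1) = axis 3 1" "first7 (axis 4 1) = axis 4 1" "first7 (axis 5 1) = axis 5 1"
  "first7 (axis 6 1) = axis 6 1" "first7 (axis 7 1) = 0"
  by (simp_all add: vec_eq_7 first7_nth axis_def)

lemma clifford8_axis: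
  "clifford8 (axis 7 1) s = (- snd s, fst s)"
  "i \<noteq> 7 \<Longrightarrow> clifford8 (axis i 1) s =
    (clifford7 (first7 (axis i 1)) (snd s), clifford7 (first7 (axis i 1)) (fst s))"
  by (simp_all add: clifford8_def first7_axis c7.cl_simps) (simp_all add: axis_def)

lemma clifford8_volume: "c8.eI UNIV s = (fst s, - snd s)"
proof -
  have "clifford7 (axis 0 1) (clifford7 (axis 1 1) (clifford7 (axis 2 1) (clifford7 (axis 3 1)
      (clifford7 (axis 4 1) (clifford7 (axis 5 1) (clifford7 (axis 6 1) s)))))) = s" for s
    using clifford7_volume[of s] by (simp add: c7.eI_def sorted_UNIV_7)
  then show ?thesis
    by (simp add: c8.eI_def sorted_UNIV_8 clifford8_axis first7_axis c7.cl_simps)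
qed

text \<open>Commuting with the volume element forces \<open>T\<close> to preserve the half-spinors,
  commuting with the last axis identifies the two diagonal blocks, and the block commutes with
  \<open>clifford7\<close>.\<close>

interpretation c8: clifford_schur clifford8
proof
  fix T :: "spinor8 \<Rightarrow> spinor8"
  assume lin: "linear T" and T: "\<And>x s. T (clifford8 x s) = clifford8 x (T s)"
  have "T (cprod (\<lambda>i. clifford8 (axis i 1)) is s) = cprod (\<lambda>i. clifford8 (axis i 1)) is (T s)" for "is" s
    by (induction "is") (auto simp: T)
  then have vol: "T (c8.eI UNIV s) = c8.eI UNIV (T s)" for s by (simp add: c8.eI_def)
  define T1 where "T1 p = fst (T (p, 0))" for p
  have plus: "T (p, 0) = (T1 p, 0)" for p
  proof -
    have "T (p, 0) = (fst (T (p, 0)), - snd (T (p, 0)))"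
      using vol[of "(p, 0)"] by (simp add: clifford8_volume)
    then have "snd (T (p, 0)) = - snd (T (p, 0))" by (metis snd_conv)
    then have "2 *\<^sub>R snd (T (p, 0)) = 0" unfolding scaleR_2 by (metis add.right_inverse)
    then show ?thesis by (simp add: T1_def prod_eq_iff)
  qed
  have minus: "T (0, p) = (0, T1 p)" for p
    using T[of "axis 7 1" "(p, 0)"] plus[of p] by (simp add: clifford8_axis)
  have "linear T1" unfolding T1_def
    using linear_compose[OF linear_compose[OF _ lin] linear_fst, of "\<lambda>p. (p, 0)"]
    by (simp add: comp_def linearI)
  moreover have "T1 (clifford7 x p) = clifford7 x (T1 p)" for x p
    using T[of "join8 (0, x)" "(p, 0)"] by (simp add: plus clifford8_def minus c7.cl_simps)
  ultimately obtain c where c: "\<And>p. T1 p = c *\<^sub>R p" using c7.schur by blast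
  have "T s = c *\<^sub>R s" for s
    using linear_add[OF lin, of "(fst s, 0)" "(0, snd s)"] by (simp add: plus minus c prod_eq_iff)
  then show "\<exists>c. \<forall>s. T s = c *\<^sub>R s" by blast
qed

section \<open>Isometries of V + V with the split form\<close>

definition split_form :: "'a::real_inner \<times> 'a \<Rightarrow> 'a \<times> 'a \<Rightarrow> real" where
  "split_form X Y = fst X \<bullet> fst Y - snd X \<bullet> snd Y"

lemma split_form_nondegenerate:
  assumes "\<And>Z. split_form X Z = split_form Y Z" shows "X = Y"
proof -
  have "fst X \<bullet> z = fst Y \<bullet> z" "snd X \<bullet> z = snd Y \<bullet> z" for z
    using assms[of "(z, 0)"] assms[of "(0, z)"] by (simp_all add: split_form_def)
  then have "fst X = fst Y" "snd X = snd Y" by (metis vector_eq_rdot)+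
  then show ?thesis by (simp add: prod_eq_iff)
qed

lemma split_isometry:
  fixes g :: "'a::euclidean_space \<times> 'a \<Rightarrow> 'a \<times> 'a"
  assumes lin: "linear g" and form: "\<And>X Y. split_form (g X) (g Y) = split_form X Y"
    and unit: "\<And>p. p \<bullet> p = 1 \<Longrightarrow> snd (g (p, 0)) = 0 \<and> fst (g (0, p)) = 0"
  obtains h k where "orthogonal_transformation h" "orthogonal_transformation k" "g = map_prod h k"
proof -
  have all: "snd (g (p, 0)) = 0 \<and> fst (g (0, p)) = 0" for p
  proof (cases "p = 0")
    case False
    have u: "((1 / norm p) *\<^sub>R p) \<bullet> ((1 / norm p) *\<^sub>R p) = 1"
      using False by (simp add: power2_norm_eq_inner[symmetric] power2_eq_square)
    have "(p, 0) = norm p *\<^sub>R ((1 / norm p) *\<^sub>R p, 0 :: 'a)" "(0, p) = norm p *\<^sub>R (0 :: 'a, (1 / norm p) *\<^sub>R p)"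
      using False by simp_all
    then have "g (p, 0) = norm p *\<^sub>R g ((1 / norm p) *\<^sub>R p, 0)" "g (0, p) = norm p *\<^sub>R g (0, (1 / norm p) *\<^sub>R p)"
      by (metis linear_cmul[OF lin])+
    then show ?thesis using unit[OF u] by simp
  qed (use linear_0[OF lin] in \<open>simp add: zero_prod_def\<close>)
  define h where "h p = fst (g (p, 0))" for p
  define k where "k q = snd (g (0, q))" for q
  have hk: "g (p, 0) = (h p, 0)" "g (0, p) = (0, k p)" for p
    using all[of p] by (simp_all add: h_def k_def prod_eq_iff)
  have "linear h" unfolding h_def
    by (rule linearI) (simp_all flip: linear_add[OF lin] linear_cmul[OF lin] fst_add fst_scaleR)
  moreover have "linear k" unfolding k_def
    by (rule linearI) (simp_all flip: linear_add[OF lin] linear_cmul[OF lin] snd_add snd_scaleR)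
  moreover have "h p \<bullet> h q = p \<bullet> q" "k p \<bullet> k q = p \<bullet> q" for p q
    using form[of "(p, 0)" "(q, 0)"] form[of "(0, p)" "(0, q)"] by (simp_all add: hk split_form_def)
  moreover have "g = map_prod h k"
  proof
    fix X
    have "g X = g (fst X, 0) + g (0, snd X)" by (simp flip: linear_add[OF lin])
    then show "g X = map_prod h k X" by (simp add: hk map_prod_def case_prod_beta)
  qed
  ultimately show thesis by (intro that[of h k]) (auto simp: orthogonal_transformation_def)
qed

lemma cross7_eq_0:
  assumes "\<And>y. cross7 a y = 0" shows "a = 0"
  using assms[of "axis 0 1"] assms[of "axis 1 1"]
  by (simp add: vec_eq_7 cross7_components axis_def)

lemma cross7_cube: "cross7 x (cross7 x (cross7 x y)) = - (x \<bullet> x) *\<^sub>R cross7 x y"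
  unfolding cross7_cross7[of x y] by (simp add: cross7_simps)

text \<open>The operator of cross multiplication by \<open>X\<close> satisfies $C_X^3=-C_X$ for a unit vector of either
  summand; for \<open>X\<close> with components in both summands the two components would have to be unit vectors.\<close>

lemma G2_square:
  fixes g :: "(real ^ 7) \<times> (real ^ 7) \<Rightarrow> (real ^ 7) \<times> (real ^ 7)"
  assumes lin: "linear g" and surj: "surj g"
    and form: "\<And>X Y. split_form (g X) (g Y) = split_form X Y"
    and phi: "\<And>X Y Z. phi0 (fst (g X)) (fst (g Y)) (fst (g Z)) - phi0 (snd (g X)) (snd (g Y)) (snd (g Z)) =
        phi0 (fst X) (fst Y) (fst Z) - phi0 (snd X) (snd Y) (snd Z)"
  obtains h k where "h \<in> G2" "k \<in> G2" "g = map_prod h k"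
proof -
  define C where "C X Y = (cross7 (fst X) (fst Y), cross7 (snd X) (snd Y))" for X Y
  \<comment> \<open>As the split form is nondegenerate and \<open>g\<close> is onto, invariance of
    the trilinear form becomes equivariance of the componentwise cross product. The minus sign in
    the covariant is that of the split form.\<close>
  have C: "C (g X) (g Y) = g (C X Y)" for X Y
  proof (rule split_form_nondegenerate)
    fix Z
    obtain W where "Z = g W" using surjD[OF surj, of Z] by blast
    then show "split_form (C (g X) (g Y)) Z = split_form (g (C X Y)) Z"
      using phi[of X Y W] by (simp add: form) (simp add: split_form_def C_def phi0_cross7)
  qed
  have unit: "fst (g X) = 0 \<or> snd (g X) = 0"
    if X: "\<And>Y. C X (C X (C X Y)) = - C X Y" "split_form X X = 1 \<or> split_form X X = - 1" for X
  proof -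
    let ?a = "fst (g X)" and ?b = "snd (g X)"
    have "C (g X) (C (g X) (C (g X) Z)) = - C (g X) Z" for Z
    proof -
      obtain Y where "Z = g Y" using surjD[OF surj, of Z] by blast
      then show ?thesis by (simp add: C X linear_neg[OF lin])
    qed
    from this[of "(y, y)" for y] have "- (?a \<bullet> ?a) *\<^sub>R cross7 ?a y = - cross7 ?a y"
      "- (?b \<bullet> ?b) *\<^sub>R cross7 ?b y = - cross7 ?b y" for y
      by (simp_all only: C_def fst_conv snd_conv cross7_cube prod_eq_iff fst_uminus snd_uminus)
    then have "(1 - ?a \<bullet> ?a) *\<^sub>R cross7 ?a y = 0" "(1 - ?b \<bullet> ?b) *\<^sub>R cross7 ?b y = 0" for y
      by (simp_all add: algebra_simps)
    then have "?a \<bullet> ?a = 1 \<or> ?a = 0" "?b \<bullet> ?b = 1 \<or> ?b = 0"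
      using cross7_eq_0 by (metis eq_iff_diff_eq_0 scaleR_eq_0_iff)+
    moreover have "?a \<bullet> ?a - ?b \<bullet> ?b = 1 \<or> ?a \<bullet> ?a - ?b \<bullet> ?b = - 1"
      using form[of X X] X(2) by (simp add: split_form_def)
    ultimately show ?thesis by auto
  qed
  have "snd (g (p, 0)) = 0 \<and> fst (g (0, p)) = 0" if p: "p \<bullet> p = 1" for p
  proof -
    have f: "split_form (p, 0) (p, 0) = 1" "split_form (0, p) (0, p) = - 1"
      using p by (simp_all add: split_form_def)
    have "fst (g (p, 0)) = 0 \<or> snd (g (p, 0)) = 0" "fst (g (0, p)) = 0 \<or> snd (g (0, p)) = 0"
      by (rule unit; use f p in \<open>simp add: C_def cross7_cube cross7_simps\<close>)+
    moreover have "fst (g (p, 0)) \<noteq> 0"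
      using form[of "(p, 0)" "(p, 0)"] f(1) inner_ge_zero[of "snd (g (p, 0))"] unfolding split_form_def
      by (smt (verit) inner_zero_left)
    moreover have "snd (g (0, p)) \<noteq> 0"
      using form[of "(0, p)" "(0, p)"] f(2) inner_ge_zero[of "fst (g (0, p))"] unfolding split_form_def
      by (smt (verit) inner_zero_left)
    ultimately show ?thesis by blast
  qed
  from split_isometry[OF lin form this] obtain h k where
    hk: "orthogonal_transformation h" "orthogonal_transformation k" "g = map_prod h k" by blast
  then have "bij h" "bij k" "linear h" "linear k"
    by (auto intro: orthogonal_transformation_bij orthogonal_transformation_linear)
  moreover have "phi0 (h x) (h y) (h z) = phi0 x y z" "phi0 (k x) (k y) (k z) = phi0 x y z" for x y z
    using phi[of "(x, 0)" "(y, 0)" "(z, 0)"] phi[of "(0, x)" "(0, y)" "(0, z)"] \<open>linear h\<close> \<open>linear k\<close>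
    by (simp_all add: hk(3) phi0_cross7 cross7_simps linear_0)
  ultimately show thesis using hk(3) by (intro that[of h k]) (auto simp: G2_def)
qed

section \<open>The group $G_2$\<close>

lemma det_matrix_comp:
  fixes f g :: "real ^ 'n \<Rightarrow> real ^ 'n"
  assumes "linear f" "linear g"
  shows "det (matrix (\<lambda>v. f (g v))) = det (matrix f) * det (matrix g)"
  using matrix_compose[OF assms(2,1)] by (simp add: comp_def det_mul)

lemma det_matrix_adjoint:
  fixes f :: "real ^ 'n \<Rightarrow> real ^ 'n"
  assumes "linear f" shows "det (matrix (adjoint f)) = det (matrix f)"
  using matrix_adjoint[OF assms] by simp

lemma det_matrix_scale: "det (matrix (\<lambda>v :: real ^ 'n. c *\<^sub>R v)) = c ^ CARD('n)"
  by (subst det_diagonal) (simp_all add: matrix_def axis_def)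

text \<open>After rotating \<open>y\<close> onto an axis, the identity is altered in a single row.
  Its off-diagonal entries are a combination of the other rows, so the determinant is the remaining
  diagonal entry.\<close>

lemma det_rank_one_update:
  fixes y z :: "real ^ 'n"
  shows "det (matrix (\<lambda>v. v + (z \<bullet> v) *\<^sub>R y)) = 1 + z \<bullet> y"
proof (cases "y = 0")
  case True
  then show ?thesis using det_matrix_scale[of 1, where 'n='n] by simp
next
  case False
  define u where "u = (1 / norm y) *\<^sub>R y"
  have u: "y = norm y *\<^sub>R u" "norm u = 1" using False by (simp_all add: u_def)
  obtain k :: 'n where True by blast
  obtain R where R: "orthogonal_transformation R" "R (axis k (1 :: real)) = u"
    by (rule orthogonal_transformation_exists_1[of "axis k 1" u]) (use u in auto)
  have lin: "linear R" using R by (simp add: orthogonal_transformation_linear)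
  let ?f = "\<lambda>v. v + (z \<bullet> v) *\<^sub>R y"
  let ?d = "\<lambda>v. v + (norm y * (z \<bullet> R v)) *\<^sub>R axis k 1"
  define c where "c j = norm y * (z \<bullet> R (axis j 1))" for j
  define A where "A = ((\<chi> i j. if i = j then if i = k then 1 + c k else 1 else 0) :: real ^ 'n ^ 'n)"
  define x where "x = ((\<Sum>j\<in>- {k}. c j *\<^sub>R axis j 1) :: real ^ 'n)"
  have lins: "linear ?f" "linear ?d"
    by (auto intro!: linearI simp: linear_add[OF lin] linear_cmul[OF lin] inner_simps algebra_simps)
  have eq: "(\<lambda>v. ?f (R v)) = (\<lambda>v. R (?d v))"
    by (subst u(1)) (simp add: linear_add[OF lin] linear_cmul[OF lin] R(2) mult.commute)
  have "det (matrix ?f) * det (matrix R) = det (matrix R) * det (matrix ?d)"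
    unfolding det_matrix_comp[OF lins(1) lin, symmetric] det_matrix_comp[OF lin lins(2), symmetric] eq ..
  moreover have "det (matrix R) \<noteq> 0"
    using det_orthogonal_matrix[of "matrix R"] R(1) by (auto simp: orthogonal_transformation_matrix)
  moreover have "det (matrix ?d) = 1 + c k"
  proof -
    have row: "row j A = axis j 1" if "j \<noteq> k" for j
      using that by (auto simp: row_def A_def axis_def vec_eq_iff)
    have "axis j 1 \<in> {row j A |j. j \<noteq> k}" if "j \<noteq> k" for j
      using row[OF that] that by (metis (mono_tags, lifting) mem_Collect_eq)
    then have "x \<in> vec.span {row j A |j. j \<noteq> k}"
      unfolding x_def scalar_mult_eq_scaleR[symmetric]
      by (intro vec.span_sum vec.span_scale vec.span_base) auto
    from det_row_span[OF this] have "det (\<chi> i. if i = k then row k A + x else row i A) = det A" .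
    moreover have "(\<chi> i. if i = k then row k A + x else row i A) = matrix ?d"
    proof -
      have x: "x $ j = (if j = k then 0 else c j)" for j
      proof -
        have "x $ j = (\<Sum>i\<in>- {k}. if i = j then c j else 0)"
          unfolding x_def sum_component by (rule sum.cong) (auto simp: axis_def)
        then show ?thesis by simp
      qed
      show ?thesis by (auto simp: vec_eq_iff matrix_def row_def A_def x c_def axis_def)
    qed
    moreover have "det A = 1 + c k" unfolding A_def by (subst det_diagonal) simp_all
    ultimately show ?thesis by simp
  qed
  ultimately have "det (matrix ?f) = 1 + c k" by simp
  also have "c k = z \<bullet> y" by (simp add: c_def R(2) u(1)[symmetric] flip: inner_scaleR_right)
  finally show ?thesis .
qed

lemma cross7_orthogonal: "y \<bullet> cross7 y v = 0"
  using cross7_skew[of y y v] by simp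

text \<open>The adjoint differs in the sign of the cross product, and by
  \<open>cross7_cross7\<close> its composite with the map is |y|^2 times a rank-one update of the
  identity. This determines the square of the determinant.\<close>

lemma det_cross7_update:
  "(det (matrix (\<lambda>v. cross7 y v + (c * (y \<bullet> v)) *\<^sub>R y)))\<^sup>2 = c\<^sup>2 * (y \<bullet> y) ^ 8"
proof (cases "y = 0")
  case True
  have "det (matrix (\<lambda>v :: real ^ 7. 0 *\<^sub>R v)) = 0" by (subst det_matrix_scale) simp
  with True show ?thesis by (simp add: cross7_simps)
next
  case False
  let ?D = "\<lambda>v. cross7 y v + (c * (y \<bullet> v)) *\<^sub>R y" and ?E = "\<lambda>v. - cross7 y v + (c * (y \<bullet> v)) *\<^sub>R y"
  let ?m = "c\<^sup>2 - 1 / (y \<bullet> y)"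
  let ?F = "\<lambda>v. v + ((?m *\<^sub>R y) \<bullet> v) *\<^sub>R y"
  have lin: "linear ?D" "linear ?E" "linear ?F"
    by (auto intro!: linearI simp: cross7_simps inner_simps add_divide_distrib algebra_simps)
  have "?E = adjoint ?D"
    by (rule adjoint_unique[symmetric]) (simp add: inner_simps cross7_skew inner_commute[of _ y])
  then have "det (matrix ?E) = det (matrix ?D)" using det_matrix_adjoint[OF lin(1)] by simp
  moreover have "(\<lambda>v. ?E (?D v)) = (\<lambda>v. (y \<bullet> y) *\<^sub>R ?F v)"
    using False by (simp add: fun_eq_iff cross7_simps cross7_cross7 inner_simps cross7_orthogonal
        algebra_simps power2_eq_square)
  then have "det (matrix ?E) * det (matrix ?D) = (y \<bullet> y) ^ 7 * (1 + ?m * (y \<bullet> y))"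
    using det_matrix_comp[OF lin(2,1)] det_matrix_comp[OF linear_scaleR lin(3), of "y \<bullet> y"]
    unfolding det_matrix_scale det_rank_one_update by simp
  ultimately show ?thesis using False
    by (simp add: power2_eq_square algebra_simps) (simp add: power_numeral_reduce)
qed

text \<open>The shear \<open>?Q\<close> adds multiples of \<open>y\<close>, invisible to the cross
  product with \<open>y\<close>, and brings the functional \<xi> to a multiple of that of
  \<open>y\<close>. Its determinant is 1 since \<open>z\<close> is orthogonal to \<open>y\<close>,
  so \<open>det_cross7_update\<close> applies with c^2 for c.\<close>

lemma det_cross7_rank_one:
  assumes "\<xi> \<bullet> y \<noteq> 0"
  shows "(det (matrix (\<lambda>v. cross7 y v + (\<xi> \<bullet> v) *\<^sub>R \<xi>)))\<^sup>2 = (\<xi> \<bullet> y) ^ 4 * (y \<bullet> y) ^ 4"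
proof -
  have y: "y \<bullet> y \<noteq> 0" using assms by auto
  define c where "c = (\<xi> \<bullet> y) / (y \<bullet> y)"
  define z where "z = (1 / (\<xi> \<bullet> y)) *\<^sub>R (\<xi> - c *\<^sub>R y)"
  have z: "z \<bullet> y = 0" using y by (simp add: z_def c_def inner_simps)
  let ?N = "\<lambda>v. cross7 y v + (\<xi> \<bullet> v) *\<^sub>R \<xi>" and ?Q = "\<lambda>v. v + (z \<bullet> v) *\<^sub>R y"
  let ?D = "\<lambda>v. cross7 y v + (c\<^sup>2 * (y \<bullet> v)) *\<^sub>R y"
  have lin: "linear ?N" "linear ?Q" "linear ?D"
    by (auto intro!: linearI simp: cross7_simps inner_simps add_divide_distrib algebra_simps)
  have cy: "c * (y \<bullet> ?Q v) = \<xi> \<bullet> v" for v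
    using y assms by (simp add: c_def z_def inner_simps field_simps)
  have "?N v = adjoint ?Q (?D (?Q v))" for v
  proof (rule vector_eq_rdot[THEN iffD1, rule_format])
    fix w
    have "adjoint ?Q (?D (?Q v)) \<bullet> w = ?D (?Q v) \<bullet> ?Q w" by (rule adjoint_clauses(2)[OF lin(2)])
    also have "\<dots> = cross7 y v \<bullet> w + (c * (y \<bullet> ?Q v)) * (c * (y \<bullet> ?Q w))"
      by (simp add: cross7_simps inner_simps cross7_orthogonal inner_commute[of "cross7 y v" y]
          power2_eq_square algebra_simps)
    also have "\<dots> = ?N v \<bullet> w" unfolding cy by (simp add: inner_simps)
    finally show "?N v \<bullet> w = adjoint ?Q (?D (?Q v)) \<bullet> w" by simp
  qed
  then have "det (matrix ?N) = det (matrix ?Q) * (det (matrix ?D) * det (matrix ?Q))"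
    using det_matrix_comp[OF adjoint_linear[OF lin(2)] linear_compose[OF lin(2,3), unfolded comp_def]]
      det_matrix_comp[OF lin(3,2)] det_matrix_adjoint[OF lin(2)] by simp
  then have "(det (matrix ?N))\<^sup>2 = ((det (matrix ?Q))\<^sup>2)\<^sup>2 * (det (matrix ?D))\<^sup>2"
    by (simp add: power2_eq_square)
  also have "\<dots> = (c\<^sup>2)\<^sup>2 * (y \<bullet> y) ^ 8" by (simp add: det_rank_one_update z det_cross7_update)
  also have "\<dots> = (\<xi> \<bullet> y) ^ 4 * (y \<bullet> y) ^ 4"
    using y by (simp add: c_def power_divide field_simps flip: power_add)
  finally show ?thesis .
qed

text \<open>The quartic $|x|^4(\xi(x))^2$ is, up to sign, the determinant of the bilinear form
  $\varphi(x,\cdot,\cdot)+\xi\otimes\xi$; hence a map preserving $\varphi$ is conformal.\<close>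

lemma G2_orthogonal:
  assumes "h \<in> G2" shows "orthogonal_transformation h"
proof -
  have lin: "linear h" and bij: "bij h" and phi: "phi0 (h x) (h y) (h z) = phi0 x y z" for x y z
    using assms by (auto simp: G2_def)
  let ?N = "\<lambda>y \<xi> v. cross7 y v + (\<xi> \<bullet> v) *\<^sub>R \<xi>"
  define d where "d = det (matrix h)"
  have linN: "linear (?N y \<xi>)" for y \<xi>
    by (auto intro!: linearI simp: cross7_simps inner_simps add_divide_distrib algebra_simps)
  have h0: "h x \<noteq> 0" if "x \<noteq> 0" for x
    using bij linear_injective_0[OF lin] that by (auto simp: bij_def)
  \<comment> \<open>\<open>h\<close> pulls the bilinear form for \<open>h x\<close> and \<xi> back
    to the one for \<open>x\<close> and \<open>adjoint h \<xi>\<close>, which multiplies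
    determinants by \<open>d\<close> squared.\<close>
  have "?N x (adjoint h \<xi>) = (\<lambda>v. adjoint h (?N (h x) \<xi> (h v)))" for x \<xi>
  proof
    fix v show "?N x (adjoint h \<xi>) v = adjoint h (?N (h x) \<xi> (h v))"
    proof (rule vector_eq_rdot[THEN iffD1, rule_format])
      fix w show "?N x (adjoint h \<xi>) v \<bullet> w = adjoint h (?N (h x) \<xi> (h v)) \<bullet> w"
        using phi[of x v w] by (simp add: adjoint_clauses(2)[OF lin] inner_simps phi0_cross7)
    qed
  qed
  then have det: "det (matrix (?N x (adjoint h \<xi>))) = d * (det (matrix (?N (h x) \<xi>)) * d)" for x \<xi>
    using det_matrix_comp[OF adjoint_linear[OF lin] linear_compose[OF lin linN, unfolded comp_def]]
      det_matrix_comp[OF linN lin] det_matrix_adjoint[OF lin] by (simp add: d_def)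
  have conf: "d ^ 4 * (h x \<bullet> h x) ^ 4 = (x \<bullet> x) ^ 4" if "x \<noteq> 0" for x
  proof -
    \<comment> \<open>With \<xi> = \<open>h x\<close> both evaluations of the functional equal |h
      x|^2, which is nonzero, so both determinants are known and can be compared.\<close>
    have "adjoint h (h x) \<bullet> x = h x \<bullet> h x" by (rule adjoint_clauses(2)[OF lin])
    moreover have "h x \<bullet> h x \<noteq> 0" using h0[OF that] by simp
    moreover define D where "D = det (matrix (?N (h x) (h x)))"
    ultimately have "(d * (D * d))\<^sup>2 = (h x \<bullet> h x) ^ 4 * (x \<bullet> x) ^ 4" "D\<^sup>2 = (h x \<bullet> h x) ^ 4 * (h x \<bullet> h x) ^ 4"
      using det_cross7_rank_one[of "adjoint h (h x)" x] det_cross7_rank_one[of "h x" "h x"]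
      unfolding det by simp_all
    moreover have "(d * (D * d))\<^sup>2 = d ^ 4 * D\<^sup>2" by (simp add: power2_eq_square power4_eq_xxxx)
    ultimately have "(h x \<bullet> h x) ^ 4 * (x \<bullet> x) ^ 4 = (h x \<bullet> h x) ^ 4 * (d ^ 4 * (h x \<bullet> h x) ^ 4)"
      by (metis mult.left_commute)
    moreover have "(h x \<bullet> h x) ^ 4 \<noteq> 0" using \<open>h x \<bullet> h x \<noteq> 0\<close> by simp
    ultimately show ?thesis by (metis mult_cancel_left)
  qed
  define \<mu> where "\<mu> = h (axis 0 1) \<bullet> h (axis 0 1)"
  have "d ^ 4 * \<mu> ^ 4 = 1" using conf[of "axis 0 1"] by (simp add: \<mu>_def inner_axis_axis axis_eq_0_iff)
  have \<mu>: "\<mu> \<ge> 0" by (simp add: \<mu>_def)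
  have d4: "(\<bar>d\<bar> * \<mu>) ^ 4 = 1" using \<open>d ^ 4 * \<mu> ^ 4 = 1\<close> by (simp add: power_mult_distrib)
  then have d\<mu>: "\<bar>d\<bar> * \<mu> = 1" using \<mu> power_eq_imp_eq_base[of "\<bar>d\<bar> * \<mu>" 4 1] by simp
  have norm: "h x \<bullet> h x = \<mu> * (x \<bullet> x)" for x
  proof (cases "x = 0")
    case False
    have "(\<bar>d\<bar> * (h x \<bullet> h x)) ^ 4 = (x \<bullet> x) ^ 4" using conf[OF False] by (simp add: power_mult_distrib)
    then have "\<bar>d\<bar> * (h x \<bullet> h x) = x \<bullet> x" by (rule power_eq_imp_eq_base) auto
    then have "(\<bar>d\<bar> * \<mu>) * (h x \<bullet> h x) = \<mu> * (x \<bullet> x)" by (simp add: mult_ac)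
    then show ?thesis by (simp add: d\<mu>)
  qed (simp add: linear_0[OF lin])
  have inner: "h x \<bullet> h y = \<mu> * (x \<bullet> y)" for x y
  proof -
    have "h (x + y) \<bullet> h (x + y) = h x \<bullet> h x + 2 * (h x \<bullet> h y) + h y \<bullet> h y"
      by (simp add: linear_add[OF lin] inner_add_left inner_add_right inner_commute[of "h y" "h x"])
    moreover have "(x + y) \<bullet> (x + y) = x \<bullet> x + 2 * (x \<bullet> y) + y \<bullet> y"
      by (simp add: inner_add_left inner_add_right inner_commute[of y x])
    ultimately show ?thesis unfolding norm by (simp add: algebra_simps)
  qed
  have "adjoint h (h v) = \<mu> *\<^sub>R v" for v
    by (rule vector_eq_rdot[THEN iffD1, rule_format]) (simp add: adjoint_clauses(2)[OF lin] inner)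
  \<comment> \<open>A conformal map of factor \<mu> has squared determinant \<mu>^7 in dimension 7;
    with |d| \<mu> = 1 this leaves \<mu>^9 = 1.\<close>
  then have "d * d = \<mu> ^ 7"
    using det_matrix_comp[OF adjoint_linear[OF lin] lin] det_matrix_adjoint[OF lin] det_matrix_scale[of \<mu>, where 'n=7]
    by (simp add: d_def)
  then have "(\<bar>d\<bar> * \<mu>)\<^sup>2 = \<mu> ^ 9" by (simp add: power_mult_distrib power2_eq_square power_numeral_reduce)
  then have "\<mu> ^ 9 = 1" by (simp add: d\<mu>)
  then have "\<mu> = 1" using \<mu> power_eq_imp_eq_base[of \<mu> 9 1] by simp
  then show ?thesis using lin inner by (simp add: orthogonal_transformation_def)
qed

lemma G2_cross7:
  assumes "h \<in> G2" shows "h (cross7 x y) = cross7 (h x) (h y)"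
proof (rule vector_eq_rdot[THEN iffD1, rule_format])
  fix z
  have orth: "orthogonal_transformation h" by (rule G2_orthogonal[OF assms])
  obtain w where w: "z = h w" using orthogonal_transformation_surj[OF orth] by (metis surjD)
  show "h (cross7 x y) \<bullet> z = cross7 (h x) (h y) \<bullet> z"
    using assms orth unfolding w orthogonal_transformation_def by (simp add: G2_def phi0_cross7)
qed

text \<open>Extending \<open>h\<close> by the identity on the unit gives an octonion automorphism,
  which intertwines Clifford multiplication; Schur's lemma identifies it with the product of the
  reflecting vectors up to sign. The product is even: the volume element is the identity, and an odd
  product would carry it to its negative.\<close>

lemma G2_lift:
  assumes "h \<in> G2"
  shows "\<exists>us. units us \<and> even (length us) \<and> h = cprod reflect us \<and>
    (\<exists>e\<in>{1, - 1}. \<forall>s. cprod clifford7 us s = e *\<^sub>R (fst s, h (snd s)))"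
proof -
  have orth: "orthogonal_transformation h" by (rule G2_orthogonal[OF assms])
  then have lin: "linear h" and inner: "h x \<bullet> h y = x \<bullet> y" for x y
    by (auto simp: orthogonal_transformation_def)
  obtain us where us: "units us" "h = cprod reflect us"
    using cartan_dieudonne[OF orth] by blast
  define R where "R s = (fst s, h (snd s))" for s :: spinor7
  have R: "R (clifford7 x s) = clifford7 (h x) (R s)" for x s
    by (simp add: R_def prod_eq_iff inner G2_cross7[OF assms, symmetric] linear_diff[OF lin] linear_cmul[OF lin])
  have "orthogonal_transformation R"
    unfolding orthogonal_transformation_def
    by (auto intro!: linearI simp: R_def linear_add[OF lin] linear_cmul[OF lin] inner_prod_def inner)
  moreover have "even (length us)"
  proof (rule ccontr)
    assume odd: "odd (length us)"
    let ?a = "cprod clifford7 us"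
    let ?c = "\<lambda>i. clifford7 (axis i 1)" and ?c' = "\<lambda>i. clifford7 (h (axis i 1))"
    have "?a (cprod ?c is s) = (- 1) ^ length is *\<^sub>R cprod ?c' is (?a s)" for "is" s
      by (induction "is") (auto simp: c7.cprod_cl_vector[OF us(1)] odd us(2)[symmetric] c7.cl_simps)
    moreover have "R (cprod ?c is s) = cprod ?c' is (R s)" for "is" s
      by (induction "is") (auto simp: R)
    moreover have odd_len: "(- 1 :: real) ^ length (sorted_list_of_set (UNIV :: 7 set)) = - 1" by simp
    moreover have "cprod ?c (sorted_list_of_set UNIV) s = s" for s
      using clifford7_volume by (simp add: c7.eI_def)
    ultimately have "?a s = - cprod ?c' (sorted_list_of_set UNIV) (?a s)"
      "R s = cprod ?c' (sorted_list_of_set UNIV) (R s)" for s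
      by (metis (no_types) odd_len scaleR_minus1_left, metis)
    moreover have "\<exists>t. s = R t" for s
      using orthogonal_transformation_surj[OF \<open>orthogonal_transformation R\<close>] by (metis surjD)
    ultimately have "?a one7 = - ?a one7" by metis
    then have "2 *\<^sub>R ?a one7 = 0" unfolding scaleR_2 by (metis add.right_inverse)
    then have "norm (?a one7) = 0" by simp
    then show False using c7.norm_cprod_cl[OF us(1), of one7] by (simp add: norm_Pair)
  qed
  ultimately have "\<exists>e\<in>{1, - 1}. \<forall>s. cprod clifford7 us s = e *\<^sub>R R s"
    by (intro c7.schur_lift) (simp_all add: R us(1) flip: us(2))
  with us \<open>even (length us)\<close> show ?thesis
    unfolding R_def by (intro exI[of _ us] conjI)
qed

section \<open>The stabiliser in dimension 7\<close>

definition covariant :: "'n::{finite,linorder} form \<Rightarrow> ('n coords \<times> 'n coords) list \<Rightarrow> real" where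
  "covariant \<rho> Xs = \<rho> \<bullet> \<Omega> (cprod (\<lambda>X. clifford_form (split_coords X)) Xs \<rho>)"

lemma covered_stabiliserE:
  fixes \<rho> :: "'n::{finite,linorder} form"
  assumes "f \<in> covered_stabiliser \<rho>"
  obtains g where "f = split_coords \<circ> g \<circ> inv split_coords" "linear g" "surj g"
    "\<And>X Y. split_form (g X) (g Y) = split_form X Y"
    "\<And>Xs. covariant \<rho> (map g Xs) = covariant \<rho> Xs"
proof -
  obtain a where a: "a \<in> spin_group" "spin_covers a f" "a \<rho> = \<rho>"
    using assms by (auto simp: covered_stabiliser_def stabiliser_def)
  note f = spin_covers_linear[OF a(1,2)] spin_covers_bij[OF a(1,2)] spin_covers_isometry[OF a(1,2)]
  let ?s = "split_coords :: 'n coords \<times> 'n coords \<Rightarrow> _"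
  have s: "linear ?s" "bij ?s" by (rule split_coords)+
  define g where "g = inv ?s \<circ> f \<circ> ?s"
  have sg: "?s (g X) = f (?s X)" for X
    using s(2) by (simp add: g_def bij_is_surj surj_f_inv_f)
  show thesis
  proof (rule that)
    show "f = ?s \<circ> g \<circ> inv ?s"
      using s(2) by (simp add: fun_eq_iff sg bij_is_surj surj_f_inv_f)
    show "linear g" unfolding g_def
      using s f(1) by (intro linear_compose) (metis bij_is_inj inj_linear_imp_inv_linear)+
    show "surj g" unfolding g_def
      using s(2) f(2) by (intro comp_surj) (simp_all add: bij_is_surj surj_imp_inj_inv bij_imp_bij_inv)
    show "split_form (g X) (g Y) = split_form X Y" for X Y
      using f(3)[of "?s X" "?s Y"] unfolding sg[symmetric] split_coords(3) split_form_def .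
    show "covariant \<rho> (map g Xs) = covariant \<rho> Xs" for Xs
      using stabiliser_covariant[OF a, of "map ?s Xs"] by (simp add: covariant_def cprod_map sg)
  qed
qed

text \<open>\<open>j\<close> identifies the representation space of \<open>G\<close> with the
  coordinate vectors: the identity in dimension 7, and in dimension 8 the passage from octonions to
  R^8.\<close>

lemma stabiliser_conjugateI:
  fixes \<rho> :: "'n::{finite,linorder} form" and j :: "'v::euclidean_space \<Rightarrow> 'n coords"
  assumes "\<rho> \<noteq> 0" and j: "linear j" "bij j" "\<And>x y. j x \<bullet> j y = x \<bullet> y"
    and sub: "\<And>f. f \<in> covered_stabiliser \<rho> \<Longrightarrow>
      \<exists>h\<in>G. \<exists>k\<in>G. f = split_conj (j \<circ> h \<circ> inv j) (j \<circ> k \<circ> inv j)"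
    and sup: "\<And>h k. h \<in> G \<Longrightarrow> k \<in> G \<Longrightarrow>
      split_conj (j \<circ> h \<circ> inv j) (j \<circ> k \<circ> inv j) \<in> covered_stabiliser \<rho>"
  shows "stabiliser_conjugate_to_square G \<rho>"
proof -
  let ?s = "split_coords :: 'n coords \<times> 'n coords \<Rightarrow> _"
  let ?A = "?s \<circ> map_prod j j"
  have jj: "map_prod (inv j) (inv j) (map_prod j j X) = X" "map_prod j j (map_prod (inv j) (inv j) Y) = Y" for X Y
    using j(2) by (cases X; cases Y; simp add: bij_is_inj bij_is_surj surj_f_inv_f)+
  then have bm: "bij (map_prod j j)" by (intro o_bij[of "map_prod (inv j) (inv j)"]) (simp_all add: fun_eq_iff)
  have inv: "inv (map_prod j j) = map_prod (inv j) (inv j)"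
    using jj by (rule inv_equality)
  have A: "bij ?A" "inv ?A = map_prod (inv j) (inv j) \<circ> inv ?s"
    using bij_comp[OF bm split_coords(2)] o_inv_distrib[OF split_coords(2) bm] by (simp_all only: inv)
  have conj: "?A \<circ> map_prod h k \<circ> inv ?A =
      ?s \<circ> map_prod (j \<circ> h \<circ> inv j) (j \<circ> k \<circ> inv j) \<circ> inv ?s" for h k
    unfolding A(2) by (simp add: fun_eq_iff map_prod_def case_prod_beta)
  have "linear (map_prod j j)"
    by (rule linearI) (simp_all add: map_prod_def case_prod_beta linear_add[OF j(1)] linear_cmul[OF j(1)])
  then have "linear ?A" using split_coords(1) by (rule linear_compose)
  moreover have "pairing (?A (p, q)) (?A (p, q)) = p \<bullet> p - q \<bullet> q" for p q
    by (simp add: split_coords(3) j(3))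
  moreover have "covered_stabiliser \<rho> = {?A \<circ> map_prod h k \<circ> inv ?A | h k. h \<in> G \<and> k \<in> G}"
    unfolding conj using sub sup by blast
  ultimately show ?thesis
    unfolding stabiliser_conjugate_to_square_def covered_stabiliser_def[symmetric]
    using assms(1) A(1) by blast
qed

lemma clifford7_one7: "clifford7 x one7 = (0, x)"
  by (simp add: clifford7_def cross7_simps)

text \<open>As (0,z) is z applied to the unit, this exhibits the associative 3-form as the
  expectation of three Clifford vectors in the unit spinor.\<close>

lemma clifford7_triple: "clifford7 x (clifford7 y (0, z)) \<bullet> one7 = phi0 x y z"
  using cross7_skew[of y x z] unfolding phi0_cross7 cross7_commute[of y x] by (simp add: inner_prod_def)

text \<open>Twice the odd part of the bispinor; a single negative vector will later make it
  even.\<close>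

definition rho7 :: "7 form" where "rho7 = c7.tensor_form (- 1) one7 one7"

text \<open>\<Omega> is 1 on bispinors and -1 on their images under \<open>par\<close>. Being an
  isometry, it makes these families orthogonal, and the coefficient -1 in \<open>rho7\<close>
  offsets the sign on the second.\<close>

lemma rho7_functional:
  "\<exists>N>0. \<forall>\<phi> \<psi>. rho7 \<bullet> \<Omega> (c7.Lform \<phi> \<psi>) = N * (\<phi> \<bullet> one7) * (\<psi> \<bullet> one7) \<and>
    rho7 \<bullet> \<Omega> (par (c7.Lform \<phi> \<psi>)) = N * (\<phi> \<bullet> one7) * (\<psi> \<bullet> one7)"
proof -
  obtain N where N: "N > 0"
    "\<And>\<phi> \<psi> \<phi>' \<psi>'. c7.Lform \<phi> \<psi> \<bullet> c7.Lform \<phi>' \<psi>' = N * (\<phi> \<bullet> \<phi>') * (\<psi> \<bullet> \<psi>')"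
    using c7.Lform_inner by blast
  have \<Omega>: "\<Omega> (c7.Lform \<phi> \<psi>) = c7.Lform \<phi> \<psi>" "\<Omega> (par (c7.Lform \<phi> \<psi>)) = - par (c7.Lform \<phi> \<psi>)" for \<phi> \<psi>
    by (simp_all add: Omega_par c7.Omega_Lform clifford7_volume)
  have "par (c7.Lform \<phi> \<psi>) \<bullet> c7.Lform \<phi>' \<psi>' = - (par (c7.Lform \<phi> \<psi>) \<bullet> c7.Lform \<phi>' \<psi>')" for \<phi> \<psi> \<phi>' \<psi>'
    using fm.eI_inner_eI[of UNIV "par (c7.Lform \<phi> \<psi>)" "c7.Lform \<phi>' \<psi>'"] by (simp add: \<Omega>)
  then have 0: "par (c7.Lform \<phi> \<psi>) \<bullet> c7.Lform \<phi>' \<psi>' = 0" "c7.Lform \<phi>' \<psi>' \<bullet> par (c7.Lform \<phi> \<psi>) = 0" for \<phi> \<psi> \<phi>' \<psi>'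
    by (simp_all add: inner_commute)
  show ?thesis
    by (intro exI[of _ N] conjI allI N(1))
      (simp_all add: rho7_def c7.tensor_form_def inner_simps \<Omega> 0 N par_inner[of _ "par _"] inner_commute)
qed

lemma rho7_nonzero: "rho7 \<noteq> 0"
proof -
  obtain N where "N > 0" "rho7 \<bullet> \<Omega> (c7.Lform one7 one7) = N * (one7 \<bullet> one7) * (one7 \<bullet> one7)"
    using rho7_functional by blast
  then show ?thesis by auto
qed

text \<open>A term with vectors on both spinors has exactly one vector on one of them, and a vector
  applied to the unit is orthogonal to the unit. Only the two pure triples survive.\<close>

lemma rho7_triple:
  "\<exists>C. C \<noteq> 0 \<and> (\<forall>X Y Z. covariant rho7 [X, Y, Z] =
    C * (phi0 (fst X) (fst Y) (fst Z) - phi0 (snd X) (snd Y) (snd Z)))"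
proof -
  obtain N where N: "N > 0" "\<And>\<phi> \<psi>. rho7 \<bullet> \<Omega> (c7.Lform \<phi> \<psi>) = N * (\<phi> \<bullet> one7) * (\<psi> \<bullet> one7)"
    "\<And>\<phi> \<psi>. rho7 \<bullet> \<Omega> (par (c7.Lform \<phi> \<psi>)) = N * (\<phi> \<bullet> one7) * (\<psi> \<bullet> one7)"
    using rho7_functional by auto
  note lin = linear_add[OF fm.linear_eI] linear_diff[OF fm.linear_eI] linear_neg[OF fm.linear_eI]
    linear_add[OF linear_par] linear_diff[OF linear_par] linear_neg[OF linear_par]
  define \<rho> where "\<rho> = rho7"
  have \<rho>: "rho7 = c7.Lform one7 one7 - par (c7.Lform one7 one7)"
    by (simp add: rho7_def c7.tensor_form_def)
  have one: "(0, x) \<bullet> one7 = 0" "one7 \<bullet> one7 = 1" for x by (simp_all add: inner_prod_def)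
  have "\<rho> \<bullet> \<Omega> (clifford_form (split_coords X) (clifford_form (split_coords Y)
      (clifford_form (split_coords Z) rho7))) =
    - 2 * N * (phi0 (fst X) (fst Y) (fst Z) - phi0 (snd X) (snd Y) (snd Z))" for X Y Z
    unfolding \<rho> clifford_form_split clifford_form_simps clifford_form_par c7.pos_act_Lform
      c7.neg_act_Lform lin par_par inner_simps
    by (simp add: clifford_form_simps clifford_form_par c7.pos_act_Lform
      c7.neg_act_Lform lin inner_simps \<rho>_def N clifford7_one7 one clifford7_triple algebra_simps)
  then show ?thesis using N(1) unfolding \<rho>_def covariant_def by (intro exI[of _ "- 2 * N"]) auto
qed

lemma stabiliser_rho7: "stabiliser_conjugate_to_square G2 rho7"
proof (rule stabiliser_conjugateI[where j = id])
  fix f assume "f \<in> covered_stabiliser rho7"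
  then obtain g where g: "f = split_coords \<circ> g \<circ> inv split_coords" "linear g" "surj g"
    "\<And>X Y. split_form (g X) (g Y) = split_form X Y" "\<And>Xs. covariant rho7 (map g Xs) = covariant rho7 Xs"
    by (rule covered_stabiliserE) (rule that)
  obtain C where C: "C \<noteq> 0" "\<And>X Y Z. covariant rho7 [X, Y, Z] =
    C * (phi0 (fst X) (fst Y) (fst Z) - phi0 (snd X) (snd Y) (snd Z))" using rho7_triple by blast
  have "phi0 (fst (g X)) (fst (g Y)) (fst (g Z)) - phi0 (snd (g X)) (snd (g Y)) (snd (g Z)) =
        phi0 (fst X) (fst Y) (fst Z) - phi0 (snd X) (snd Y) (snd Z)" for X Y Z
    using g(5)[of "[X, Y, Z]"] unfolding list.map C(2) using C(1) by (simp only: mult_cancel_left) simp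
  from G2_square[OF g(2,3,4) this] obtain h k where "h \<in> G2" "k \<in> G2" "g = map_prod h k" by blast
  then show "\<exists>h\<in>G2. \<exists>k\<in>G2. f = split_conj (id \<circ> h \<circ> inv id) (id \<circ> k \<circ> inv id)"
    using g(1) by (auto simp: inv_id)
next
  have lift: "c7.spinor_lift h one7" if "h \<in> G2" for h
  proof -
    have "h 0 = 0" using that by (auto simp: G2_def linear_0)
    then show ?thesis using G2_lift[OF that] unfolding c7.spinor_lift_def by fastforce
  qed
  fix h k assume "h \<in> G2" "k \<in> G2"
  then show "split_conj (id \<circ> h \<circ> inv id) (id \<circ> k \<circ> inv id)
      \<in> covered_stabiliser rho7" by (simp add: inv_id rho7_def c7.covered_stabiliserI lift)
qed (simp_all add: rho7_nonzero linear_id)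

section \<open>The Cayley form\<close>

definition one8 :: spinor8 where "one8 = (one7, 0)"

definition quad8 :: "real ^ 8 \<Rightarrow> real ^ 8 \<Rightarrow> real ^ 8 \<Rightarrow> real ^ 8 \<Rightarrow> real" where
  "quad8 x y z w = clifford8 x (clifford8 y (clifford8 z (clifford8 w one8))) \<bullet> one8"

text \<open>The Cayley form: the alternating part of \<open>quad8\<close>.\<close>

definition cayley :: "real ^ 8 \<Rightarrow> real ^ 8 \<Rightarrow> real ^ 8 \<Rightarrow> real ^ 8 \<Rightarrow> real" where
  "cayley x y z w = quad8 x y z w - (x \<bullet> y) * (z \<bullet> w) + (x \<bullet> z) * (y \<bullet> w) - (x \<bullet> w) * (y \<bullet> z)"

lemma one8_inner:
  "clifford8 x one8 \<bullet> one8 = 0" "clifford8 x (clifford8 y one8) \<bullet> one8 = - (x \<bullet> y)"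
  "clifford8 x (clifford8 y (clifford8 z one8)) \<bullet> one8 = 0" "one8 \<bullet> one8 = 1"
proof -
  show "clifford8 x one8 \<bullet> one8 = 0" "clifford8 x (clifford8 y (clifford8 z one8)) \<bullet> one8 = 0" "one8 \<bullet> one8 = 1"
    by (simp_all add: one8_def inner_prod_def c7.cl_simps)
  have "clifford8 x (clifford8 y one8) \<bullet> one8 = - (clifford8 y one8 \<bullet> clifford8 x one8)"
    by (rule c8.cl_skew)
  also have "\<dots> = - (x \<bullet> y)"
    by (simp add: one8_def inner_prod_def c7.cl_simps inner_8 inner_commute cross7_simps)
  finally show "clifford8 x (clifford8 y one8) \<bullet> one8 = - (x \<bullet> y)" .
qed

text \<open>Applying vectors to \<open>one8\<close> identifies them with the negative half-spinors,
  so three vectors applied to \<open>one8\<close> again amount to one vector. Up to sign and lower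
  terms this is the triple cross product of R^8.\<close>

definition cayley_triple :: "real ^ 8 \<Rightarrow> real ^ 8 \<Rightarrow> real ^ 8 \<Rightarrow> real ^ 8" where
  "cayley_triple a b z = join8 (snd (clifford8 a (clifford8 b (clifford8 z one8))))"

lemma clifford8_one8: "clifford8 x one8 = (0, (x $ 7, first7 x))"
  by (simp add: prod_eq_iff one8_def c7.cl_simps cross7_simps)

lemma clifford8_one8_inject: "clifford8 x one8 = clifford8 y one8 \<Longrightarrow> x = y"
  by (simp add: clifford8_one8 vec_eq_8)

lemma clifford8_cayley_triple:
  "clifford8 (cayley_triple a b z) one8 = clifford8 a (clifford8 b (clifford8 z one8))"
proof -
  let ?s = "clifford8 a (clifford8 b (clifford8 z one8))"
  have "fst ?s = 0" by (simp add: one8_def c7.cl_simps)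
  then have "?s = (0, snd ?s)" by (simp only: prod_eq_iff fst_conv snd_conv)
  moreover have "clifford8 (join8 q) one8 = (0, q)" for q
    unfolding clifford8_one8 by simp
  ultimately show ?thesis by (simp only: cayley_triple_def)
qed

lemma quad8_cayley_triple: "quad8 w a b z = - (w \<bullet> cayley_triple a b z)"
  unfolding quad8_def clifford8_cayley_triple[symmetric] by (rule one8_inner)

lemma linear_cayley_triple: "linear (cayley_triple a b)" "linear (\<lambda>b. cayley_triple a b z)"
  unfolding cayley_triple_def
  by (rule linearI; simp add: c8.cl_simps linear_add[OF linear_join8] linear_cmul[OF linear_join8]
      del: fst_clifford8 snd_clifford8)+

definition cayley_op :: "real ^ 8 \<Rightarrow> real ^ 8 \<Rightarrow> real ^ 8 \<Rightarrow> real ^ 8" where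
  "cayley_op a b z = - cayley_triple a b z - (b \<bullet> z) *\<^sub>R a + (a \<bullet> z) *\<^sub>R b - (a \<bullet> b) *\<^sub>R z"

lemma cayley_op: "cayley w a b z = w \<bullet> cayley_op a b z"
  by (simp add: cayley_def cayley_op_def quad8_cayley_triple inner_simps algebra_simps)

lemma linear_cayley_op: "linear (cayley_op a b)" "linear (\<lambda>b. cayley_op a b z)"
  unfolding cayley_op_def
  by (rule linearI; simp add: linear_add[OF linear_cayley_triple(1)] linear_cmul[OF linear_cayley_triple(1)]
      linear_add[OF linear_cayley_triple(2)] linear_cmul[OF linear_cayley_triple(2)] inner_simps algebra_simps)+

lemma cayley_op_self: "cayley_op a a z = 0"
proof -
  have "cayley_triple a a z = - (a \<bullet> a) *\<^sub>R z"
    by (rule clifford8_one8_inject) (simp add: clifford8_cayley_triple c8.cl_square c8.cl_simps)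
  then show ?thesis by (simp add: cayley_op_def)
qed

lemma cayley_triple_orthogonal:
  assumes "a \<bullet> b = 0"
  shows "cayley_triple a b a = (a \<bullet> a) *\<^sub>R b" "cayley_triple a b b = - (b \<bullet> b) *\<^sub>R a"
    "cayley_triple a b (cayley_triple a b z) = - ((a \<bullet> a) * (b \<bullet> b)) *\<^sub>R z"
proof -
  have anti: "clifford8 b (clifford8 a s) = - clifford8 a (clifford8 b s)" for s
    using assms c8.cl_anticommute[of b a s] by (simp add: inner_commute)
  show "cayley_triple a b a = (a \<bullet> a) *\<^sub>R b" "cayley_triple a b b = - (b \<bullet> b) *\<^sub>R a"
    "cayley_triple a b (cayley_triple a b z) = - ((a \<bullet> a) * (b \<bullet> b)) *\<^sub>R z"
    by (rule clifford8_one8_inject; simp add: clifford8_cayley_triple c8.cl_square c8.cl_simps anti)+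
qed

text \<open>\<open>cayley_op a b\<close> kills \<open>a\<close> and \<open>b\<close> and is minus
  \<open>cayley_triple a b\<close> modulo their span; the latter squares to -|a|^2 |b|^2.\<close>

lemma cayley_op_orthogonal:
  assumes "a \<bullet> b = 0"
  shows "cayley_op a b (cayley_op a b (cayley_op a b z)) = - ((a \<bullet> a) * (b \<bullet> b)) *\<^sub>R cayley_op a b z"
proof -
  note lin = linear_cayley_op(1)
  have 0: "cayley_op a b a = 0" "cayley_op a b b = 0"
    using assms by (simp_all add: cayley_op_def cayley_triple_orthogonal inner_commute)
  have "cayley_op a b (cayley_op a b z) = - cayley_op a b (cayley_triple a b z)" for z
    using assms 0 by (simp add: cayley_op_def[of a b z] linear_add[OF lin] linear_diff[OF lin] linear_neg[OF lin]
        linear_cmul[OF lin])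
  moreover have "cayley_op a b (cayley_op a b (cayley_triple a b z)) = ((a \<bullet> a) * (b \<bullet> b)) *\<^sub>R cayley_op a b z"
    unfolding calculation cayley_triple_orthogonal(3)[OF assms] by (simp add: linear_neg[OF lin] linear_cmul[OF lin])
  ultimately show ?thesis by (simp add: linear_neg[OF lin])
qed

definition gram :: "real ^ 8 \<Rightarrow> real ^ 8 \<Rightarrow> real" where
  "gram a b = (a \<bullet> a) * (b \<bullet> b) - (a \<bullet> b)\<^sup>2"

lemma gram_nonneg: "gram a b \<ge> 0"
  using Cauchy_Schwarz_ineq[of a b] by (simp add: gram_def)

text \<open>Gram-Schmidt: \<open>cayley_op\<close> is linear in \<open>b\<close> and vanishes for
  equal first arguments, so only the part of \<open>b\<close> orthogonal to \<open>a\<close>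
  counts.\<close>

lemma orthogonalise:
  obtains b' where "a \<bullet> b' = 0" "cayley_op a b = cayley_op a b'" "gram a b = (a \<bullet> a) * (b' \<bullet> b')"
proof (cases "a = 0")
  case True
  have "cayley_op a b = cayley_op a 0"
    using True linear_0[OF linear_cayley_op(2)]
    by (auto simp: fun_eq_iff cayley_op_def cayley_triple_def c8.cl_simps linear_0[OF linear_join8])
  with True show thesis by (intro that[of 0]) (auto simp: gram_def)
next
  case False
  let ?b = "b - ((a \<bullet> b) / (a \<bullet> a)) *\<^sub>R a"
  show thesis
  proof (rule that[of ?b])
    show "a \<bullet> ?b = 0" using False by (simp add: inner_simps)
    show "cayley_op a b = cayley_op a ?b"
      by (simp add: fun_eq_iff linear_diff[OF linear_cayley_op(2)] linear_cmul[OF linear_cayley_op(2)] cayley_op_self)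
    show "gram a b = (a \<bullet> a) * (?b \<bullet> ?b)"
      using False by (simp add: gram_def inner_simps inner_commute[of b a] power2_eq_square field_simps)
  qed
qed

lemma cayley_op_cube:
  "cayley_op a b (cayley_op a b (cayley_op a b z)) = - gram a b *\<^sub>R cayley_op a b z"
proof -
  obtain b' where b': "a \<bullet> b' = 0" "cayley_op a b = cayley_op a b'" "gram a b = (a \<bullet> a) * (b' \<bullet> b')"
    by (rule orthogonalise)
  show ?thesis unfolding b'(2,3) by (rule cayley_op_orthogonal[OF b'(1)])
qed

text \<open>On a vector orthogonal to \<open>a\<close> and \<open>b'\<close> the operator reduces to
  minus \<open>cayley_triple\<close>, whose square is the scalar -\<open>gram a b\<close>. Such a
  nonzero vector exists for reasons of dimension.\<close>

lemma cayley_op_eq_0: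
  assumes "\<And>z. cayley_op a b z = 0" shows "gram a b = 0"
proof -
  obtain b' where b': "a \<bullet> b' = 0" "cayley_op a b = cayley_op a b'" "gram a b = (a \<bullet> a) * (b' \<bullet> b')"
    by (rule orthogonalise)
  have "dim {a, b'} < DIM(real ^ 8)"
    using dim_le_card'[of "{a, b'}"] card_insert_le_m1[of 2 "{b'}" a] by simp
  then obtain z where z: "z \<noteq> 0" "\<And>y. y \<in> span {a, b'} \<Longrightarrow> orthogonal z y"
    by (rule orthogonal_to_subspace_exists) blast
  have "z \<bullet> a = 0" "z \<bullet> b' = 0" using z(2) by (auto simp: orthogonal_def span_base)
  then have "cayley_triple a b' z = 0"
    using assms[of z] b' unfolding b'(2) by (simp add: cayley_op_def inner_commute)
  then have "((a \<bullet> a) * (b' \<bullet> b')) *\<^sub>R z = 0"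
    using cayley_triple_orthogonal(3)[OF b'(1), of z] linear_0[OF linear_cayley_triple(1)] by simp
  with z(1) show ?thesis by (simp add: b'(3))
qed

text \<open>For orthonormal \<open>X\<close>, \<open>Y\<close> in one summand, $C=C_{X,Y}$ satisfies $C^3=-C$. After applying an isometry
  the Gram determinant of one pair of components exceeds that of the other by at least 1, while both
  are 0 or 1; so the other pair vanishes.\<close>

lemma cayley_square:
  fixes g :: "(real ^ 8) \<times> (real ^ 8) \<Rightarrow> (real ^ 8) \<times> (real ^ 8)"
  assumes lin: "linear g" and surj: "surj g"
    and form: "\<And>X Y. split_form (g X) (g Y) = split_form X Y"
    and cay: "\<And>W X Y Z.
        cayley (fst (g W)) (fst (g X)) (fst (g Y)) (fst (g Z)) +
        cayley (snd (g W)) (snd (g X)) (snd (g Y)) (snd (g Z)) =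
        cayley (fst W) (fst X) (fst Y) (fst Z) + cayley (snd W) (snd X) (snd Y) (snd Z)"
  obtains h k where "orthogonal_transformation h" "orthogonal_transformation k" "g = map_prod h k"
    "\<And>x y z w. cayley (h x) (h y) (h z) (h w) = cayley x y z w"
    "\<And>x y z w. cayley (k x) (k y) (k z) (k w) = cayley x y z w"
proof -
  \<comment> \<open>The metric dual of the sum of the Cayley forms for the split form; the negative
    definite summand is responsible for the minus sign.\<close>
  define C where "C X Y Z = (cayley_op (fst X) (fst Y) (fst Z), - cayley_op (snd X) (snd Y) (snd Z))" for X Y Z
  have C: "C (g X) (g Y) (g Z) = g (C X Y Z)" for X Y Z
  proof (rule split_form_nondegenerate)
    fix V
    obtain W where V: "V = g W" using surjD[OF surj, of V] by blast
    have "split_form V (C (g X) (g Y) (g Z)) = split_form V (g (C X Y Z))"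
      using cay[of W X Y Z] unfolding V form by (simp add: split_form_def C_def cayley_op)
    then show "split_form (C (g X) (g Y) (g Z)) V = split_form (g (C X Y Z)) V"
      by (simp add: split_form_def inner_commute)
  qed
  have gram01: "gram (fst (g X)) (fst (g Y)) \<in> {0, 1} \<and> gram (snd (g X)) (snd (g Y)) \<in> {0, 1}"
    if "\<And>Z. C X Y (C X Y (C X Y Z)) = - C X Y Z" for X Y
  proof -
    let ?a = "fst (g X)" and ?b = "fst (g Y)" and ?c = "snd (g X)" and ?d = "snd (g Y)"
    have "C (g X) (g Y) (C (g X) (g Y) (C (g X) (g Y) V)) = - C (g X) (g Y) V" for V
    proof -
      obtain Z where "V = g Z" using surjD[OF surj, of V] by blast
      then show ?thesis by (simp add: C that linear_neg[OF lin])
    qed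
    from this[of "(z, z)" for z] have "- gram ?a ?b *\<^sub>R cayley_op ?a ?b z = - cayley_op ?a ?b z"
      "gram ?c ?d *\<^sub>R cayley_op ?c ?d z = cayley_op ?c ?d z" for z
      by (simp_all add: C_def cayley_op_cube linear_neg[OF linear_cayley_op(1)] prod_eq_iff)
    then have "(1 - gram ?a ?b) *\<^sub>R cayley_op ?a ?b z = 0" "(1 - gram ?c ?d) *\<^sub>R cayley_op ?c ?d z = 0" for z
      by (simp_all add: algebra_simps)
    then have "gram ?a ?b = 1 \<or> (\<forall>z. cayley_op ?a ?b z = 0)" "gram ?c ?d = 1 \<or> (\<forall>z. cayley_op ?c ?d z = 0)"
      by auto
    then show ?thesis using cayley_op_eq_0 by blast
  qed
  have gram_split: "gram a b = 1 + c \<bullet> c + d \<bullet> d + gram c d"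
    if "a \<bullet> a - c \<bullet> c = 1" "b \<bullet> b - d \<bullet> d = 1" "a \<bullet> b - c \<bullet> d = 0" for a b c d :: "real ^ 8"
  proof -
    have "a \<bullet> a = 1 + c \<bullet> c" "b \<bullet> b = 1 + d \<bullet> d" "a \<bullet> b = c \<bullet> d" using that by simp_all
    then show ?thesis by (simp add: gram_def algebra_simps)
  qed
  have zero: "c = 0"
    if "a \<bullet> a - c \<bullet> c = 1" "b \<bullet> b - d \<bullet> d = 1" "a \<bullet> b - c \<bullet> d = 0" "gram a b \<in> {0, 1}" for a b c d :: "real ^ 8"
  proof -
    have "d \<bullet> d \<ge> 0" "gram c d \<ge> 0" by (simp_all add: gram_nonneg)
    moreover have "gram a b \<le> 1" using that(4) by auto
    ultimately have "c \<bullet> c \<le> 0" using gram_split[OF that(1,2,3)] by linarith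
    then show ?thesis by (metis inner_ge_zero inner_eq_zero_iff order_antisym)
  qed
  have orthonormal: "\<exists>q. q \<bullet> q = 1 \<and> p \<bullet> q = 0" for p :: "real ^ 8"
  proof -
    obtain q where q: "q \<noteq> 0" "orthogonal p q" using orthogonal_to_vector_exists[of p] by auto
    then show ?thesis
      by (intro exI[of _ "(1 / norm q) *\<^sub>R q"])
        (simp add: orthogonal_def power2_norm_eq_inner[symmetric] power2_eq_square)
  qed
  have unit: "snd (g (p, 0)) = 0" "fst (g (0, p)) = 0" if p: "p \<bullet> p = 1" for p
  proof -
    obtain q where q: "q \<bullet> q = 1" "p \<bullet> q = 0" using orthonormal by blast
    have gr: "gram p q = 1" "gram 0 0 = 0" using p q by (simp_all add: gram_def)
    have op0: "cayley_op 0 0 z = 0" for z by (rule cayley_op_self)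
    have "C (p, 0) (q, 0) (C (p, 0) (q, 0) (C (p, 0) (q, 0) Z)) = - C (p, 0) (q, 0) Z"
      "C (0, p) (0, q) (C (0, p) (0, q) (C (0, p) (0, q) Z)) = - C (0, p) (0, q) Z" for Z
      by (simp_all add: C_def cayley_op_cube gr op0 linear_neg[OF linear_cayley_op(1)])
    from this[THEN gram01] have gr: "gram (fst (g (p, 0))) (fst (g (q, 0))) \<in> {0, 1}"
      "gram (snd (g (0, p))) (snd (g (0, q))) \<in> {0, 1}" by blast+
    show "snd (g (p, 0)) = 0"
      by (rule zero[where d = "snd (g (q, 0))", OF _ _ _ gr(1)])
        (use form[of "(p, 0)" "(p, 0)"] form[of "(q, 0)" "(q, 0)"] form[of "(p, 0)" "(q, 0)"] p q in
          \<open>simp_all add: split_form_def\<close>)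
    show "fst (g (0, p)) = 0"
      by (rule zero[where d = "fst (g (0, q))", OF _ _ _ gr(2)])
        (use form[of "(0, p)" "(0, p)"] form[of "(0, q)" "(0, q)"] form[of "(0, p)" "(0, q)"] p q in
          \<open>simp_all add: split_form_def\<close>)
  qed
  from split_isometry[OF lin form conjI[OF unit]] obtain h k where
    hk: "orthogonal_transformation h" "orthogonal_transformation k" "g = map_prod h k" by blast
  have "h 0 = 0" "k 0 = 0" using hk(1,2) by (simp_all add: linear_0 orthogonal_transformation_linear)
  moreover have "cayley 0 0 0 0 = 0" by (simp add: cayley_op)
  ultimately have "cayley (h x) (h y) (h z) (h w) = cayley x y z w" "cayley (k x) (k y) (k z) (k w) = cayley x y z w"
    for x y z w
    using cay[of "(x, 0)" "(y, 0)" "(z, 0)" "(w, 0)"] cay[of "(0, x)" "(0, y)" "(0, z)" "(0, w)"]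
    by (simp_all add: hk(3))
  with hk show thesis by (intro that[of h k])
qed

definition rho8 :: "8 form" where "rho8 = c8.Lform one8 one8"

text \<open>The volume element fixes \<open>one8\<close>, so neither \<Omega> nor \<open>par\<close>
  affects the pairing of a bispinor with \<open>rho8\<close>.\<close>

lemma rho8_functional:
  "\<exists>N>0. \<forall>\<phi> \<psi>. rho8 \<bullet> \<Omega> (c8.Lform \<phi> \<psi>) = N * (\<phi> \<bullet> one8) * (\<psi> \<bullet> one8) \<and>
    rho8 \<bullet> \<Omega> (par (c8.Lform \<phi> \<psi>)) = N * (\<phi> \<bullet> one8) * (\<psi> \<bullet> one8)"
proof -
  obtain N where N: "N > 0"
    "\<And>\<phi> \<psi> \<phi>' \<psi>'. c8.Lform \<phi> \<psi> \<bullet> c8.Lform \<phi>' \<psi>' = N * (\<phi> \<bullet> \<phi>') * (\<psi> \<bullet> \<psi>')"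
    using c8.Lform_inner by blast
  have "one8 \<bullet> c8.eI UNIV \<phi> = one8 \<bullet> \<phi>" for \<phi>
    by (simp add: clifford8_volume one8_def inner_prod_def)
  then show ?thesis
    by (intro exI[of _ N] conjI allI N(1))
      (simp_all add: rho8_def c8.Omega_Lform c8.par_Lform N inner_commute)
qed

lemma rho8_nonzero: "rho8 \<noteq> 0"
proof -
  have "rho8 $ {} = 1" by (simp add: rho8_def c8.Lform_def one8_inner)
  then show ?thesis by auto
qed

text \<open>Terms with one or three vectors on a spinor vanish. Two on each give products of inner
  products, which combine with the corrections that make \<open>quad8\<close> alternating into
  products of \<open>split_form\<close>. Isometries preserve these, so the sum of Cayley forms is
  invariant too.\<close>

lemma rho8_quadruple:
  "\<exists>N. N \<noteq> 0 \<and> (\<forall>W X Y Z. covariant rho8 [W, X, Y, Z] =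
    N * (cayley (fst W) (fst X) (fst Y) (fst Z) + cayley (snd W) (snd X) (snd Y) (snd Z) +
      split_form W X * split_form Y Z - split_form W Y * split_form X Z + split_form W Z * split_form X Y))"
proof -
  obtain N where N: "N > 0" "\<And>\<phi> \<psi>. rho8 \<bullet> \<Omega> (c8.Lform \<phi> \<psi>) = N * (\<phi> \<bullet> one8) * (\<psi> \<bullet> one8)"
    "\<And>\<phi> \<psi>. rho8 \<bullet> \<Omega> (par (c8.Lform \<phi> \<psi>)) = N * (\<phi> \<bullet> one8) * (\<psi> \<bullet> one8)"
    using rho8_functional by auto
  note lin = linear_add[OF fm.linear_eI] linear_diff[OF fm.linear_eI] linear_neg[OF fm.linear_eI]
    linear_add[OF linear_par] linear_diff[OF linear_par] linear_neg[OF linear_par]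
  define \<rho> where "\<rho> = rho8"
  have "\<rho> \<bullet> \<Omega> (clifford_form (split_coords W) (clifford_form (split_coords X)
      (clifford_form (split_coords Y) (clifford_form (split_coords Z) rho8)))) =
    N * (cayley (fst W) (fst X) (fst Y) (fst Z) + cayley (snd W) (snd X) (snd Y) (snd Z) +
      split_form W X * split_form Y Z - split_form W Y * split_form X Z + split_form W Z * split_form X Y)" for W X Y Z
    unfolding rho8_def clifford_form_split clifford_form_simps clifford_form_par c8.pos_act_Lform
      c8.neg_act_Lform lin par_par inner_simps
    by (simp add: clifford_form_simps clifford_form_par c8.pos_act_Lform
      c8.neg_act_Lform lin inner_simps \<rho>_def N one8_inner cayley_def quad8_def split_form_def algebra_simps)
  then show ?thesis using N(1) unfolding \<rho>_def covariant_def by (intro exI[of _ N]) auto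
qed

section \<open>The stabiliser in dimension 8\<close>

declare split_paired_All [simp del] split_paired_Ex [simp del]

definition conj7 :: "spinor7 \<Rightarrow> spinor7" where
  "conj7 s = (fst s, - snd s)"

text \<open>The spin representation on \<open>spinor7\<close>, transported to the vector space $\mathbb{R}^8$ by \<open>iota8\<close>,
  lifts to the stabiliser of \<open>one8\<close>.  Octonionic conjugation is inserted because \<open>clifford8\<close> multiplies
  by the vector on the left, whereas the spin representation should multiply the vector from the left.\<close>

definition iota8 :: "spinor7 \<Rightarrow> real ^ 8" where
  "iota8 s = join8 (conj7 s)"

lemma conj7_conj7 [simp]: "conj7 (conj7 s) = s"
  by (simp add: conj7_def)

lemma linear_conj7: "linear conj7"
  by (rule linearI) (simp_all add: conj7_def)

lemma conj7_inner: "conj7 s \<bullet> conj7 t = s \<bullet> t"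
  by (simp add: conj7_def inner_prod_def)

lemma iota8: "linear iota8" "bij iota8" "iota8 s \<bullet> iota8 t = s \<bullet> t" "inv iota8 (iota8 s) = s"
  "iota8 (inv iota8 x) = x"
proof -
  have eq: "iota8 = (\<lambda>s. join8 (conj7 s))" by (simp add: fun_eq_iff iota8_def)
  show "linear iota8"
    using linear_compose[OF linear_conj7 linear_join8] by (simp add: eq comp_def)
  show bij: "bij iota8"
    by (rule o_bij[of "\<lambda>x. conj7 (x $ 7, first7 x)"]) (simp_all add: fun_eq_iff iota8_def)
  show "iota8 s \<bullet> iota8 t = s \<bullet> t" by (simp add: iota8_def join8_inner conj7_inner)
  show "inv iota8 (iota8 s) = s" "iota8 (inv iota8 x) = x"
    using bij by (simp_all add: bij_is_inj bij_is_surj surj_f_inv_f)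
qed

text \<open>Octonion multiplication in the sign convention of \<open>clifford7\<close>. Through
  \<open>iota8\<close>, vectors of R^8 act on the half-spinors by such products, up to sign and
  conjugation.\<close>

definition omult :: "spinor7 \<Rightarrow> spinor7 \<Rightarrow> spinor7" where
  "omult s t = fst s *\<^sub>R t + clifford7 (snd s) t"

lemma conj7_omult: "conj7 (omult s t) = omult (conj7 t) (conj7 s)"
  by (simp add: omult_def conj7_def prod_eq_iff cross7_simps inner_commute
      cross7_commute[of "snd t" "snd s"] algebra_simps)

lemma clifford8_iota8:
  "clifford8 (iota8 v) s = (- omult v (snd s), omult (conj7 v) (fst s))"
  by (simp add: clifford8_def iota8_def omult_def conj7_def c7.cl_simps)

lemma linear_inv_iota8: "linear (inv iota8)"
proof (rule linearI)
  fix x y show "inv iota8 (x + y) = inv iota8 x + inv iota8 y"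
    using iota8(4)[of "inv iota8 x + inv iota8 y"] by (simp add: linear_add[OF iota8(1)] iota8(5))
next
  fix r x show "inv iota8 (r *\<^sub>R x) = r *\<^sub>R inv iota8 x"
    using iota8(4)[of "r *\<^sub>R inv iota8 x"] by (simp add: linear_cmul[OF iota8(1)] iota8(5))
qed

lemma omult_inner: "omult s t \<bullet> t' = t \<bullet> omult (conj7 s) t'"
  by (simp add: omult_def conj7_def inner_simps c7.cl_skew c7.cl_simps)

text \<open>\<open>R\<close> may be any isometric lift, not a Clifford product by definition; this
  keeps explicit octonionic lifts admissible, and Schur's lemma turns them into products
  afterwards.\<close>

definition lifts8 :: "(spinor7 \<Rightarrow> spinor7) \<Rightarrow> (spinor8 \<Rightarrow> spinor8) \<Rightarrow> bool" where
  "lifts8 m R \<longleftrightarrow> orthogonal_transformation m \<and> orthogonal_transformation R \<and> R one8 = one8 \<and>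
     (\<forall>v s. R (clifford8 (iota8 v) s) = clifford8 (iota8 (m v)) (R s))"

lemma lifts8_comp: "lifts8 m R \<Longrightarrow> lifts8 m' R' \<Longrightarrow> lifts8 (m \<circ> m') (R \<circ> R')"
  by (auto simp: lifts8_def orthogonal_transformation_compose)

lemma orthogonal_transformation_clifford7:
  "norm u = 1 \<Longrightarrow> orthogonal_transformation (clifford7 u)"
  by (simp add: orthogonal_transformation_def c7.linear_cl c7.cl_inner_cl norm_eq_1)

text \<open>A case of triality: left multiplication by \<open>u\<close> on vectors goes with minus
  the reflection, and 1 on the unit, on one half-spinor space, and with left multiplication
  conjugated by \<open>conj7\<close> on the other. After conjugation one half of the relation is
  \<open>c7.cl_reflect\<close>; the other half is its transpose.\<close>

lemma lifts8_clifford7: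
  assumes u: "norm u = 1"
  shows "\<exists>R. lifts8 (clifford7 u) R"
proof -
  define r where "r p = (fst p, - reflect u (snd p))" for p :: spinor7
  define r' where "r' q = conj7 (clifford7 u (conj7 q))" for q
  define R where "R s = (r (fst s), r' (snd s))" for s
  have orth_refl: "orthogonal_transformation (reflect u)" by (rule orthogonal_transformation_reflect[OF u])
  then have reflect: "linear (reflect u)" "reflect u x \<bullet> reflect u y = x \<bullet> y" for x y
    by (auto simp: orthogonal_transformation_def)
  have lin: "linear r" "linear r'"
    unfolding r_def r'_def
    by (rule linearI; simp add: linear_add[OF reflect(1)] linear_cmul[OF reflect(1)]
        linear_add[OF linear_conj7] linear_cmul[OF linear_conj7] c7.cl_simps)+
  have inner: "r p \<bullet> r q = p \<bullet> q" "r' p \<bullet> r' q = p \<bullet> q" for p q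
    using u by (simp_all add: r_def r'_def inner_prod_def[of "(_, _)"] inner_prod_def[of p] reflect conj7_inner
        c7.cl_inner_cl norm_eq_1)
  have surj: "\<exists>p. q = r p" for q
    by (rule exI[of _ "(fst q, - reflect u (snd q))"])
      (simp add: r_def linear_neg[OF reflect(1)] reflect_reflect[OF u])
  have conj_r: "conj7 (r p) = (fst p, reflect u (snd p))" for p by (simp add: r_def conj7_def)
  have plus: "r' (omult (conj7 v) p) = omult (conj7 (clifford7 u v)) (r p)" for v p
  proof -
    have "conj7 (r' (omult (conj7 v) p)) = clifford7 u (omult (conj7 p) v)"
      by (simp add: r'_def conj7_omult)
    also have "\<dots> = omult (conj7 (r p)) (clifford7 u v)"
      by (simp add: omult_def conj7_def[of p] conj_r c7.cl_simps c7.cl_reflect[OF u])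
    also have "\<dots> = conj7 (omult (conj7 (clifford7 u v)) (r p))" by (simp add: conj7_omult)
    finally show ?thesis by (metis conj7_conj7)
  qed
  have minus: "r (omult v q) = omult (clifford7 u v) (r' q)" for v q
  proof (rule vector_eq_rdot[THEN iffD1, rule_format])
    fix z
    obtain p where z: "z = r p" using surj by blast
    have "r (omult v q) \<bullet> r p = q \<bullet> omult (conj7 v) p" by (simp add: inner omult_inner)
    also have "\<dots> = r' q \<bullet> omult (conj7 (clifford7 u v)) (r p)" by (simp add: inner flip: plus)
    also have "\<dots> = omult (clifford7 u v) (r' q) \<bullet> r p" by (simp add: omult_inner)
    finally show "r (omult v q) \<bullet> z = omult (clifford7 u v) (r' q) \<bullet> z" by (simp add: z)
  qed
  have "linear R"
    by (rule linearI) (simp_all add: R_def linear_add[OF lin(1)] linear_add[OF lin(2)] linear_cmul[OF lin(1)]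
        linear_cmul[OF lin(2)])
  moreover have "R s \<bullet> R t = s \<bullet> t" for s t
    by (simp add: R_def inner inner_prod_def[of s t])
  ultimately have "orthogonal_transformation R" by (simp add: orthogonal_transformation_def)
  moreover have "R one8 = one8" by (simp add: R_def one8_def r_def linear_0[OF lin(2)] linear_0[OF reflect(1)])
  moreover have "R (clifford8 (iota8 v) s) = clifford8 (iota8 (clifford7 u v)) (R s)" for v s
    by (simp add: clifford8_iota8 R_def plus minus linear_neg[OF lin(1)])
  ultimately show ?thesis
    using orthogonal_transformation_clifford7[OF u] unfolding lifts8_def by blast
qed

lemma lifts8_Spin7: "m \<in> Spin7 \<Longrightarrow> \<exists>R. lifts8 m R"
proof -
  have "\<exists>R. lifts8 (cprod clifford7 xs) R" if "units xs" for xs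
    using that
  proof (induction xs)
    case Nil
    have "cprod clifford7 [] = id" by (simp add: fun_eq_iff)
    then have "lifts8 (cprod clifford7 []) id"
      using orthogonal_transformation_id by (simp add: lifts8_def id_def)
    then show ?case by blast
  next
    case (Cons x xs)
    have "cprod clifford7 (x # xs) = clifford7 x \<circ> cprod clifford7 xs" by (simp add: fun_eq_iff)
    then show ?case using Cons lifts8_clifford7[of x] lifts8_comp by (metis list.set_intros)
  qed
  moreover assume "m \<in> Spin7"
  ultimately show ?thesis by (auto simp: Spin7_def cprod_def)
qed

lemma lifts8_cayley:
  assumes "lifts8 m R"
  shows "cayley (iota8 (m x)) (iota8 (m y)) (iota8 (m z)) (iota8 (m w)) =
    cayley (iota8 x) (iota8 y) (iota8 z) (iota8 w)"
proof -
  have m: "m x \<bullet> m y = x \<bullet> y" and R: "R s \<bullet> R t = s \<bullet> t" "R one8 = one8"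
    "R (clifford8 (iota8 v) s) = clifford8 (iota8 (m v)) (R s)" for x y s t v
    using assms by (auto simp: lifts8_def orthogonal_transformation_def)
  have "quad8 (iota8 (m x)) (iota8 (m y)) (iota8 (m z)) (iota8 (m w)) =
      R (clifford8 (iota8 x) (clifford8 (iota8 y) (clifford8 (iota8 z) (clifford8 (iota8 w) one8)))) \<bullet> R one8"
    by (simp only: R(2,3) quad8_def)
  also have "\<dots> = quad8 (iota8 x) (iota8 y) (iota8 z) (iota8 w)" by (simp only: R(1) quad8_def)
  finally show ?thesis by (simp add: cayley_def iota8(3) m)
qed

text \<open>For an odd number of reflections, composing \<open>R\<close> with the volume element
  would absorb the sign, and by Schur's lemma an odd Clifford product would fix \<open>one8\<close>
  up to sign, although it exchanges the half-spinors.\<close>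

lemma lifts8_reflections:
  assumes "lifts8 m R"
  shows "c8.spinor_lift (iota8 \<circ> m \<circ> inv iota8) one8"
proof -
  let ?h = "iota8 \<circ> m \<circ> inv iota8"
  have R: "orthogonal_transformation R" "R one8 = one8"
    "R (clifford8 x s) = clifford8 (?h x) (R s)" for x s
    using assms spec[of _ "inv iota8 x"] unfolding lifts8_def by (auto simp: iota8(5)) (metis iota8(5))
  have linR: "linear R" and innerR: "R s \<bullet> R t = s \<bullet> t" for s t
    using R(1) by (auto simp: orthogonal_transformation_def)
  note linear_inv_iota8
  moreover have "inv iota8 x \<bullet> inv iota8 y = x \<bullet> y" for x y using iota8(3)[of "inv iota8 x" "inv iota8 y"]
    by (simp add: iota8(5))
  ultimately have "orthogonal_transformation ?h"
    using assms iota8(1,3)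
    by (auto simp: orthogonal_transformation_def lifts8_def intro!: linear_compose)
  then obtain us where us: "units us" "?h = cprod reflect us"
    using cartan_dieudonne by blast
  have par: "(if even (length xs) then snd (cprod clifford8 xs one8) = 0 else fst (cprod clifford8 xs one8) = 0)" for xs
    by (induction xs) (auto simp: one8_def c7.cl_simps split: if_splits)
  have "even (length us)"
  proof (rule ccontr)
    assume odd: "odd (length us)"
    let ?R = "\<lambda>s. R (c8.eI UNIV s)"
    have "orthogonal_transformation (c8.eI UNIV)"
      by (simp add: orthogonal_transformation_def c8.linear_eI c8.eI_inner_eI)
    from orthogonal_transformation_compose[OF R(1) this] have "orthogonal_transformation ?R" by (simp add: comp_def)
    moreover have "?R (clifford8 x s) = (- 1) ^ length us *\<^sub>R clifford8 (cprod reflect us x) (?R s)" for x s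
      using odd by (simp add: c8.eI_UNIV_cl linear_neg[OF linR] R(3) flip: us(2))
    ultimately obtain e where e: "e \<in> {1, - 1 :: real}" "cprod clifford8 us one8 = e *\<^sub>R ?R one8"
      using c8.schur_lift[OF _ _ us(1)] by blast
    have "c8.eI UNIV one8 = one8" by (simp add: clifford8_volume one8_def)
    then have "cprod clifford8 us one8 = e *\<^sub>R one8" using e(2) by (simp only: R(2))
    moreover have "fst (e *\<^sub>R one8) \<noteq> 0" using e(1) by (auto simp: one8_def zero_prod_def)
    ultimately have "fst (cprod clifford8 us one8) \<noteq> 0" by simp
    then show False using par[of us] odd by simp
  qed
  moreover from this have "\<exists>e\<in>{1, - 1}. \<forall>s. cprod clifford8 us s = e *\<^sub>R R s"
    by (intro c8.schur_lift R(1) us(1)) (simp add: R(3) flip: us(2))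
  then have "\<exists>e\<in>{1, - 1}. cprod clifford8 us one8 = e *\<^sub>R one8" using R(2) by metis
  ultimately show ?thesis using us unfolding c8.spinor_lift_def by blast
qed

section \<open>Spin(7) as the stabiliser of the Cayley form\<close>

lemma Spin7_comp: "a \<in> Spin7 \<Longrightarrow> b \<in> Spin7 \<Longrightarrow> a \<circ> b \<in> Spin7"
proof -
  assume "a \<in> Spin7" "b \<in> Spin7"
  then obtain xs ys where xs: "a = cprod clifford7 xs" "even (length xs)" "units xs"
    and ys: "b = cprod clifford7 ys" "even (length ys)" "units ys"
    by (auto simp: Spin7_def cprod_def)
  then have "a \<circ> b = cprod clifford7 (xs @ ys)" by (simp add: fun_eq_iff)
  with xs ys show ?thesis unfolding Spin7_def cprod_def[symmetric]
    by (intro CollectI exI[of _ "xs @ ys"]) auto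
qed

lemma cprod_in_Spin7: "even (length xs) \<Longrightarrow> units xs \<Longrightarrow> cprod clifford7 xs \<in> Spin7"
  by (auto simp: Spin7_def cprod_def)

lemma minus_in_Spin7: "uminus \<in> Spin7"
proof -
  have "uminus = cprod clifford7 [axis 0 1, axis 0 1]" by (simp add: fun_eq_iff c7.cl_axis_square)
  also have "\<dots> \<in> Spin7" by (rule cprod_in_Spin7) auto
  finally show ?thesis .
qed

lemma Spin7_inverse:
  assumes "a \<in> Spin7" obtains b where "b \<in> Spin7" "b \<circ> a = id" "a \<circ> b = id"
proof -
  obtain xs where xs: "a = cprod clifford7 xs" "even (length xs)" "units xs"
    using assms by (auto simp: Spin7_def cprod_def)
  have inv: "cprod clifford7 (rev xs) (cprod clifford7 xs s) = (- 1) ^ length xs *\<^sub>R s" if "units xs" for xs s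
    using that
    by (induction xs) (auto simp: c7.cl_square norm_eq_1 linear_neg[OF c7.linear_cprod_cl])
  show thesis
  proof (rule that)
    show "cprod clifford7 (rev xs) \<in> Spin7" using xs by (intro cprod_in_Spin7) auto
    show "cprod clifford7 (rev xs) \<circ> a = id" "a \<circ> cprod clifford7 (rev xs) = id"
      using xs inv[of xs] inv[of "rev xs"] by (simp_all add: fun_eq_iff)
  qed
qed

lemma Spin7_transitive:
  assumes "norm w = 1" obtains a where "a \<in> Spin7" "a one7 = w"
proof -
  obtain s v where w: "w = (s, v)" by force
  obtain y0 where y0: "y0 \<noteq> 0" "orthogonal v y0" using orthogonal_to_vector_exists[of v] by auto
  define y where "y = (1 / norm y0) *\<^sub>R y0"
  have y: "y \<bullet> y = 1" "v \<bullet> y = 0" "y \<bullet> v = 0" using y0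
    by (simp_all add: y_def orthogonal_def inner_commute[of _ v] power2_norm_eq_inner[symmetric] power2_eq_square)
  \<comment> \<open>Solves x(y 1) = w for x: the inner product of x and y must be -s and their cross
    product -v. Choosing \<open>y\<close> orthogonal to \<open>v\<close> makes this possible with a
    unit vector.\<close>
  define x where "x = - s *\<^sub>R y - cross7 y v"
  have cross: "y \<bullet> cross7 y v = 0" "cross7 y v \<bullet> y = 0" by (simp_all add: cross7_orthogonal inner_commute)
  have "cross7 y v \<bullet> cross7 y v = v \<bullet> v"
    using y by (simp add: cross7_skew cross7_cross7 inner_simps)
  moreover have "s * s + v \<bullet> v = 1" using assms by (simp add: w norm_eq_1 inner_prod_def)
  ultimately have "x \<bullet> x = 1" using y cross by (simp add: x_def inner_simps)
  have "cross7 x y = - v"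
    using y by (simp add: x_def cross7_simps cross7_commute[of "cross7 y v" y] cross7_cross7)
  then have "cprod clifford7 [x, y] one7 = w"
    using y cross by (simp add: clifford7_one7) (simp add: clifford7_def w x_def inner_simps)
  moreover have "cprod clifford7 [x, y] \<in> Spin7"
    using y \<open>x \<bullet> x = 1\<close> by (intro cprod_in_Spin7) (auto simp: norm_eq_1)
  ultimately show thesis by (rule that[rotated])
qed

lemma Spin7_lift: "a \<in> Spin7 \<Longrightarrow> orthogonal_transformation a"
  using lifts8_Spin7 by (auto simp: lifts8_def)

text \<open>Transitivity on unit octonions reduces to a map fixing the unit. With the unit in one
  slot the Cayley form becomes \<open>phi0\<close>, so the map is given by an element of
  \<open>G2\<close>, whose lift is an even Clifford product up to sign.\<close>

lemma cayley_stabiliser_Spin7: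
  assumes h: "orthogonal_transformation h"
    and cay: "\<And>x y z w. cayley (h x) (h y) (h z) (h w) = cayley x y z w"
  shows "inv iota8 \<circ> h \<circ> iota8 \<in> Spin7"
proof -
  define m where "m = inv iota8 \<circ> h \<circ> iota8"
  have im: "iota8 (m s) = h (iota8 s)" for s by (simp add: m_def iota8(5))
  have m_inner: "m s \<bullet> m t = s \<bullet> t" for s t
    using h iota8(3)[of "m s" "m t"] by (simp add: im iota8(3) orthogonal_transformation_def)
  have linm: "linear m" unfolding m_def
    using h iota8(1) linear_inv_iota8 by (auto simp: orthogonal_transformation_def intro!: linear_compose)
  have "norm (m one7) = 1" using m_inner[of one7 one7] by (simp add: norm_eq_1 inner_prod_def)
  then obtain a where a: "a \<in> Spin7" "a one7 = m one7" by (rule Spin7_transitive)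
  obtain b where b: "b \<in> Spin7" "b \<circ> a = id" "a \<circ> b = id" by (rule Spin7_inverse[OF a(1)])
  obtain R where R: "lifts8 b R" using lifts8_Spin7[OF b(1)] by blast
  define m' where "m' = b \<circ> m"
  have b_orth: "linear b" "b s \<bullet> b t = s \<bullet> t" for s t
    using Spin7_lift[OF b(1)] by (auto simp: orthogonal_transformation_def)
  have m': "linear m'" "m' s \<bullet> m' t = s \<bullet> t" "m' one7 = one7" for s t
    using linm b_orth m_inner b(2) a(2)
    by (auto simp: m'_def fun_eq_iff intro!: linear_compose) (metis comp_apply id_apply)
  have cay': "cayley (iota8 (m' x)) (iota8 (m' y)) (iota8 (m' z)) (iota8 (m' w)) =
      cayley (iota8 x) (iota8 y) (iota8 z) (iota8 w)" for x y z w
    by (simp add: m'_def lifts8_cayley[OF R] im cay)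
  define k where "k y = snd (m' (0, y))" for y
  have "fst (m' (0, y)) = 0" for y
    using m'(2)[of "(0, y)" one7] by (simp add: m'(3) inner_prod_def)
  then have mk: "m' (0, y) = (0, k y)" for y by (simp add: k_def prod_eq_iff)
  have "k \<in> G2"
  proof -
    have link: "linear k" unfolding k_def
      by (rule linearI) (simp_all flip: linear_add[OF m'(1)] linear_cmul[OF m'(1)] snd_add snd_scaleR)
    have inner: "k x \<bullet> k y = x \<bullet> y" for x y
      using m'(2)[of "(0, x)" "(0, y)"] by (simp add: mk inner_prod_def)
    have quad: "quad8 (iota8 (0, x)) (iota8 (0, y)) (iota8 one7) (iota8 (0, w)) = phi0 y w x" for x y w
      by (simp add: quad8_def clifford8_iota8 one8_def omult_def conj7_def c7.cl_simps clifford7_one7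
          inner_prod_def phi0_cross7 inner_commute)
    have "phi0 (k y) (k w) (k x) = phi0 y w x" for x y w
      using cay'[of "(0, x)" "(0, y)" one7 "(0, w)"]
      by (simp add: cayley_def mk m'(3) quad iota8(3) inner)
    moreover have "bij k" using link inner
      by (auto simp: orthogonal_transformation_def intro!: orthogonal_transformation_bij)
    ultimately show ?thesis using link by (simp add: G2_def)
  qed
  then obtain us e where us: "units us" "even (length us)" "e \<in> {1, - 1 :: real}"
    "\<And>s. cprod clifford7 us s = e *\<^sub>R (fst s, k (snd s))"
    using G2_lift by blast
  have "m' s = (fst s, k (snd s))" for s
  proof -
    have "s = fst s *\<^sub>R one7 + (0, snd s)" by (simp add: prod_eq_iff)
    then have "m' s = fst s *\<^sub>R m' one7 + m' (0, snd s)"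
      by (metis linear_add[OF m'(1)] linear_cmul[OF m'(1)])
    then show ?thesis by (simp add: m'(3) mk)
  qed
  then have "m' = cprod clifford7 us \<or> m' = uminus \<circ> cprod clifford7 us"
    using us(3,4) by (auto simp: fun_eq_iff)
  moreover have "cprod clifford7 us \<in> Spin7" using us by (intro cprod_in_Spin7)
  ultimately have "m' \<in> Spin7" using Spin7_comp[OF minus_in_Spin7] by auto
  moreover have "m = a \<circ> m'" by (simp add: m'_def comp_assoc[symmetric] b(3))
  ultimately show ?thesis using Spin7_comp[OF a(1)] by (simp add: m_def)
qed

lemma stabiliser_rho8: "stabiliser_conjugate_to_square Spin7 rho8"
proof (rule stabiliser_conjugateI[where j = iota8, OF rho8_nonzero iota8(1-3)])
  fix f assume "f \<in> covered_stabiliser rho8"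
  then obtain g where g: "f = split_coords \<circ> g \<circ> inv split_coords" "linear g" "surj g"
    "\<And>X Y. split_form (g X) (g Y) = split_form X Y" "\<And>Xs. covariant rho8 (map g Xs) = covariant rho8 Xs"
    by (rule covered_stabiliserE) (rule that)
  obtain N where N: "N \<noteq> 0" "\<And>W X Y Z. covariant rho8 [W, X, Y, Z] =
    N * (cayley (fst W) (fst X) (fst Y) (fst Z) + cayley (snd W) (snd X) (snd Y) (snd Z) +
      split_form W X * split_form Y Z - split_form W Y * split_form X Z + split_form W Z * split_form X Y)"
    using rho8_quadruple by blast
  have "cayley (fst (g W)) (fst (g X)) (fst (g Y)) (fst (g Z)) + cayley (snd (g W)) (snd (g X)) (snd (g Y)) (snd (g Z)) =
        cayley (fst W) (fst X) (fst Y) (fst Z) + cayley (snd W) (snd X) (snd Y) (snd Z)" for W X Y Z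
    using g(5)[of "[W, X, Y, Z]"] unfolding list.map N(2) g(4) using N(1) by (simp only: mult_cancel_left) simp
  from cayley_square[OF g(2,3,4) this] obtain h k where hk: "orthogonal_transformation h" "orthogonal_transformation k"
    "g = map_prod h k" "\<And>x y z w. cayley (h x) (h y) (h z) (h w) = cayley x y z w"
    "\<And>x y z w. cayley (k x) (k y) (k z) (k w) = cayley x y z w" by blast
  let ?h = "inv iota8 \<circ> h \<circ> iota8" and ?k = "inv iota8 \<circ> k \<circ> iota8"
  have "?h \<in> Spin7" "?k \<in> Spin7" using cayley_stabiliser_Spin7 hk by blast+
  moreover have "iota8 \<circ> ?h \<circ> inv iota8 = h" "iota8 \<circ> ?k \<circ> inv iota8 = k"
    by (simp_all add: fun_eq_iff iota8(5))
  ultimately show "\<exists>h\<in>Spin7. \<exists>k\<in>Spin7. f = split_conj (iota8 \<circ> h \<circ> inv iota8) (iota8 \<circ> k \<circ> inv iota8)"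
    using g(1) hk(3) by metis
next
  fix h k assume hk: "h \<in> Spin7" "k \<in> Spin7"
  then have lift: "c8.spinor_lift (iota8 \<circ> h \<circ> inv iota8) one8" "c8.spinor_lift (iota8 \<circ> k \<circ> inv iota8) one8"
    using lifts8_Spin7 lifts8_reflections by blast+
  have "rho8 = c8.tensor_form 0 one8 one8" by (simp add: rho8_def c8.tensor_form_def)
  then show "split_conj (iota8 \<circ> h \<circ> inv iota8) (iota8 \<circ> k \<circ> inv iota8) \<in> covered_stabiliser rho8"
    using c8.covered_stabiliserI[OF lift(2,1), of 0] by (simp only:)
qed

section \<open>Smooth forms and scaled frames\<close>

lemma frechet_derivative_exp:
  fixes x :: "'n::finite coords" and v :: "'b::real_normed_vector"
  shows "((\<lambda>x. exp (r * x $ k) *\<^sub>R v) has_derivative (\<lambda>w. (exp (r * x $ k) * (r * w $ k)) *\<^sub>R v)) (at x)"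
  by (auto intro!: derivative_eq_intros bounded_linear.has_derivative[OF bounded_linear_vec_nth] simp: mult.commute)

text \<open>\<open>v\<close> is generalised in the induction because a directional derivative merely
  rescales it.\<close>

lemma smooth_on_exp: "smooth_on UNIV (\<lambda>x :: 'n::finite coords. exp (r * x $ k) *\<^sub>R (v :: 'b::real_normed_vector))"
  unfolding smooth_on_def
proof
  fix m show "C_k_on m UNIV (\<lambda>x :: 'n coords. exp (r * x $ k) *\<^sub>R v)"
  proof (induction m arbitrary: v)
    case 0
    show ?case by (auto intro!: continuous_intros)
  next
    case (Suc m)
    have eq: "frechet_derivative (\<lambda>x :: 'n coords. exp (r * x $ k) *\<^sub>R v) (at x) w =
        exp (r * x $ k) *\<^sub>R ((r * w $ k) *\<^sub>R v)" for x w
      by (simp add: frechet_derivative_at[OF frechet_derivative_exp, symmetric])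
    show ?case
      unfolding C_k_on.simps eq differentiable_def using Suc frechet_derivative_exp by blast
  qed
qed

lemma smooth_on_const: "smooth_on UNIV (\<lambda>x :: 'n::finite coords. v :: 'b::real_normed_vector)"
  using smooth_on_exp[of 0] by simp

lemma smooth_on_sum:
  fixes f :: "'i \<Rightarrow> 'a::real_normed_vector \<Rightarrow> 'b::real_normed_vector"
  assumes "finite A" "\<And>i. i \<in> A \<Longrightarrow> smooth_on UNIV (f i)"
  shows "smooth_on UNIV (\<lambda>x. \<Sum>i\<in>A. f i x)"
  unfolding smooth_on_def
proof
  have "C_k_on m UNIV (\<lambda>x. \<Sum>i\<in>A. f i x)" if "\<forall>i\<in>A. C_k_on m UNIV (f i)" for m f
    using that
  proof (induction m arbitrary: f)
    case 0
    then show ?case by (auto intro!: continuous_intros)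
  next
    case (Suc m)
    have d: "(f i has_derivative frechet_derivative (f i) (at x)) (at x)" if "i \<in> A" for i x
      using Suc.prems that by (auto simp: frechet_derivative_works)
    have D: "((\<lambda>x. \<Sum>i\<in>A. f i x) has_derivative (\<lambda>w. \<Sum>i\<in>A. frechet_derivative (f i) (at x) w)) (at x)" for x
      by (intro has_derivative_sum d)
    then have "frechet_derivative (\<lambda>x. \<Sum>i\<in>A. f i x) (at x) = (\<lambda>w. \<Sum>i\<in>A. frechet_derivative (f i) (at x) w)" for x
      by (simp add: frechet_derivative_at[symmetric])
    moreover have "C_k_on m UNIV (\<lambda>x. \<Sum>i\<in>A. frechet_derivative (f i) (at x) v)" for v
      using Suc.prems by (intro Suc.IH[of "\<lambda>i x. frechet_derivative (f i) (at x) v"]) auto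
    ultimately show ?case using D by (auto simp: differentiable_def)
  qed
  then show "C_k_on m UNIV (\<lambda>x. \<Sum>i\<in>A. f i x)" for m
    using assms(2) unfolding smooth_on_def by blast
qed

lemma smooth_on_coordinate: "smooth_on UNIV (\<lambda>x :: 'n::finite coords. x $ k)"
  unfolding smooth_on_def
proof
  fix m
  have D: "((\<lambda>x :: 'n coords. x $ k) has_derivative (\<lambda>w. w $ k)) (at x)" for x
    by (rule bounded_linear_imp_has_derivative[OF bounded_linear_vec_nth])
  then have "frechet_derivative (\<lambda>x :: 'n coords. x $ k) (at x) = (\<lambda>w. w $ k)" for x
    by (simp add: frechet_derivative_at[symmetric])
  then show "C_k_on m UNIV (\<lambda>x :: 'n coords. x $ k)"
    using D smooth_on_const[of "v $ k" for v] by (cases m) (auto simp: smooth_on_def differentiable_def intro!: continuous_intros)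
qed

lemma wedge_unit_form: "wedge unit_form \<tau> = \<tau>"
proof -
  have "(\<Sum>I\<in>Pow K. shuffle_sign I (K - I) * unit_form $ I * \<tau> $ (K - I)) = \<tau> $ K" for K
  proof -
    have "(\<Sum>I\<in>Pow K. shuffle_sign I (K - I) * unit_form $ I * \<tau> $ (K - I)) =
        (\<Sum>I\<in>Pow K. if I = {} then \<tau> $ K else 0)"
      by (rule sum.cong) (auto simp: unit_form_def axis_def shuffle_sign_def)
    then show ?thesis by simp
  qed
  then show ?thesis by (simp add: wedge_def vec_eq_iff)
qed

lemma exp_form_0: "exp_form (0 :: 'n::{finite,linorder} form) = unit_form"
proof -
  have "(wedge (0 :: 'n form) ^^ j) unit_form = (if j = 0 then unit_form else 0)" for j
    by (cases j) (auto simp: wedge_def vec_eq_iff)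
  then have "exp_form 0 = (\<Sum>j\<le>CARD('n). if j = 0 then unit_form else 0 :: 'n form)"
    unfolding exp_form_def by (intro sum.cong) auto
  then show ?thesis by simp
qed

lemma sorted_list_of_set_Cons:
  assumes "sorted_list_of_set I = i # is" "finite I"
  shows "I = insert i (I - {i})" "sorted_list_of_set (I - {i}) = is" "\<forall>j\<in>I - {i}. i < j"
proof -
  have s: "sorted (i # is)" "distinct (i # is)" "set (i # is) = I"
    using assms by (metis sorted_list_of_set.sorted_sorted_key_list_of_set, metis sorted_list_of_set.distinct_sorted_key_list_of_set, metis set_sorted_list_of_set)
  then show "I = insert i (I - {i})" by auto
  have I': "I - {i} = set is" using s by auto
  show "sorted_list_of_set (I - {i}) = is"
    unfolding I' using s by (intro sorted_list_of_set.idem_if_sorted_distinct) auto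
  show "\<forall>j\<in>I - {i}. i < j" unfolding I' using s by (auto simp: less_le)
qed

lemma sg_below: "\<forall>j\<in>K. i < j \<Longrightarrow> sg i K = 1"
proof -
  assume "\<forall>j\<in>K. i < j"
  then have "{k \<in> K. k < i} = {}" by force
  then show ?thesis unfolding sg_def by (simp only: card.empty) simp
qed

lemma frame_form_scaled_axis:
  assumes "\<And>i. g *v E i = r i *\<^sub>R axis i 1"
  shows "frame_form g E I = (\<Prod>i\<in>I. r i) *\<^sub>R axis (I :: 'n::{finite,linorder} set) 1"
proof -
  have "foldr (\<lambda>i. covector_wedge (g *v E i)) is unit_form = (\<Prod>i\<in>I. r i) *\<^sub>R axis I 1"
    if "is = sorted_list_of_set I" for "is" and I :: "'n set"
    using that
  proof (induction "is" arbitrary: I)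
    case Nil
    then have "I = {}" by (metis finite sorted_list_of_set.sorted_key_list_of_set_eq_Nil_iff)
    then show ?case by (simp add: unit_form_def)
  next
    case (Cons i "is")
    note I = sorted_list_of_set_Cons[OF Cons.prems[symmetric], simplified]
    define J where "J = I - {i}"
    have IJ: "I = insert i J" "i \<notin> J" using I by (auto simp: J_def)
    have sgJ: "sg i J = 1" using I(3) unfolding J_def by (rule sg_below)
    have *: "covector_wedge (r i *\<^sub>R axis i 1) (c *\<^sub>R axis J 1) = (r i * c) *\<^sub>R axis I 1" for c
    proof (rule vec_eq_iff[THEN iffD2], rule allI)
      fix K
      have "(\<Sum>j\<in>K. sg j K * (r i *\<^sub>R axis i 1) $ j * (c *\<^sub>R axis J 1) $ (K - {j})) =
          (\<Sum>j\<in>K. if j = i then sg i K * r i * (if K - {i} = J then c else 0) else 0)"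
        by (rule sum.cong) (auto simp: axis_def)
      also have "\<dots> = (if i \<in> K then sg i K * r i * (if K - {i} = J then c else 0) else 0)" by simp
      also have "\<dots> = ((r i * c) *\<^sub>R axis I 1) $ K"
        using IJ sgJ sg_minus_self[of i K] by (auto simp: axis_def insert_absorb)
      finally show "covector_wedge (r i *\<^sub>R axis i 1) (c *\<^sub>R axis J 1) $ K = ((r i * c) *\<^sub>R axis I 1) $ K"
        by (simp add: covector_wedge_def shuffle_sign_singleton)
    qed
    show ?case using Cons.IH[of J] I(2) IJ by (simp add: J_def[symmetric] assms *)
  qed
  then show ?thesis by (simp add: frame_form_def)
qed

lemma frame_eval_scaled_axis:
  assumes "\<And>i. E i = r i *\<^sub>R axis i 1"
  shows "frame_eval E \<tau> I = (\<Prod>i\<in>I. r i) * \<tau> $ (I :: 'n::{finite,linorder} set)"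
proof -
  have "fold (\<lambda>i. interior_mult (E i)) is \<tau> $ {} = (\<Prod>i\<in>I. r i) * \<tau> $ I"
    if "is = sorted_list_of_set I" for "is" and I :: "'n set" and \<tau>
    using that
  proof (induction "is" arbitrary: I \<tau>)
    case Nil
    then have "I = {}" by (metis finite sorted_list_of_set.sorted_key_list_of_set_eq_Nil_iff)
    then show ?case by simp
  next
    case (Cons i "is")
    note I = sorted_list_of_set_Cons[OF Cons.prems[symmetric], simplified]
    define J where "J = I - {i}"
    have IJ: "I = insert i J" "i \<notin> J" using I by (auto simp: J_def)
    have sgJ: "sg i J = 1" using I(3) unfolding J_def by (rule sg_below)
    have "interior_mult (r i *\<^sub>R axis i 1) \<tau> $ J = (\<Sum>j\<in>- J. if j = i then r i * \<tau> $ I else 0)"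
      unfolding interior_mult_def vec_lambda_beta shuffle_sign_singleton
      using IJ sgJ by (intro sum.cong) (auto simp: axis_def)
    also have "\<dots> = r i * \<tau> $ I" using IJ by simp
    finally show ?case using Cons.IH[of J] I(2) IJ by (simp add: J_def[symmetric] assms)
  qed
  then show ?thesis by (simp add: frame_eval_def)
qed

lemma (in clifford_module) eI_commute:
  "eI J (eI I s) = (- 1) ^ (card J * card I + card (J \<inter> I)) *\<^sub>R eI I (eI J s)"
proof -
  have "eI J (cprod (\<lambda>i. cl (axis i 1)) is s) =
      (- 1) ^ (card J * length is + card (J \<inter> set is)) *\<^sub>R cprod (\<lambda>i. cl (axis i 1)) is (eI J s)"
    if "distinct is" for "is"
    using that
    by (induction "is") (auto simp: eI_cl_axis cl_simps power_add mult.commute)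
  from this[of "sorted_list_of_set I"] show ?thesis by (simp add: eI_def[of I])
qed

lemma (in clifford_module) eI_symmetric:
  "card I mod 4 \<in> {0, 3} \<Longrightarrow> eI I s \<bullet> t = s \<bullet> eI I t"
  using eI_inner_eI[of I "eI I s" t] by (simp add: eI_eI)

lemma shuffle_sign_square [simp]: "shuffle_sign I J * shuffle_sign I J = 1"
  by (simp add: shuffle_sign_def flip: power_add)

section \<open>The example\<close>

text \<open>In the coordinate \<open>t = x $ k\<close> with $dy=e^{2t}dt$, so that $h=2y=e^{2t}$, all coefficients are
  exponentials of \<open>t\<close>; \<open>wt i\<close> is the exponent of the conformal coframe.\<close>

locale five_brane = clifford_module cl
  for cl :: "'n::{finite,linorder} coords \<Rightarrow> 's::euclidean_space \<Rightarrow> 's" +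
  fixes k :: 'n and S :: "'n set" and \<phi> \<psi> :: 's and \<epsilon> :: real
  assumes card_S: "card S = 3" and k_less: "\<And>i. i \<in> S \<Longrightarrow> k < i"
    and \<epsilon>: "\<epsilon> = 1 \<or> \<epsilon> = - 1"
    and chirality: "eI (insert k S) \<psi> = \<epsilon> *\<^sub>R \<psi>" "eI (insert k S) \<phi> = - \<epsilon> *\<^sub>R \<phi>"
    and unit: "norm \<phi> = 1" "norm \<psi> = 1"
begin

lemma k_notin_S [simp]: "k \<notin> S"
  using k_less by blast

text \<open>The 3 is 1 + 2, from the conformal factor e^t and dy = e^(2t) dt.\<close>

definition wt :: "'n \<Rightarrow> real" where
  "wt i = (if i = k then 3 else if i \<in> S then 1 else 0)"

definition frame :: "'n coords \<Rightarrow> 'n \<Rightarrow> 'n coords" where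
  "frame x i = exp (- wt i * x $ k) *\<^sub>R axis i 1"

text \<open>A sum over the diagonal entries, so that smoothness follows term by term.\<close>

definition metric :: "'n coords \<Rightarrow> 'n matrix" where
  "metric x = (\<Sum>i\<in>UNIV. exp (2 * wt i * x $ k) *\<^sub>R (\<chi> a b. if a = i \<and> b = i then 1 else 0))"

text \<open>The predicate \<open>P\<close> selects the even or the odd part, or both.\<close>

definition coef :: "(bool \<Rightarrow> bool) \<Rightarrow> 'n set \<Rightarrow> real" where
  "coef P I = (if P (even (card I)) then Lform \<phi> \<psi> $ I else 0)"

text \<open>The -1 in the exponent is the factor e^(-F), with F the coordinate t.\<close>

definition field :: "(bool \<Rightarrow> bool) \<Rightarrow> 'n coords \<Rightarrow> 'n form" where
  "field P x = (\<Sum>I\<in>UNIV. exp ((sum wt I - 1) * x $ k) *\<^sub>R (coef P I *\<^sub>R axis I 1))"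

text \<open>The 2 is the exponent 3 - 1 brought down by differentiating the components with legs
  along all of \<open>S\<close>.\<close>

definition flux :: "'n coords \<Rightarrow> 'n form" where
  "flux x = (- 2 * \<epsilon>) *\<^sub>R axis S 1"

lemma metric_nth: "metric x $ a $ b = (if a = b then exp (2 * wt a * x $ k) else 0)"
proof -
  have "metric x $ a $ b = (\<Sum>i\<in>UNIV. exp (2 * wt i * x $ k) * (if a = i \<and> b = i then 1 else 0))"
    by (simp add: metric_def)
  also have "\<dots> = (\<Sum>i\<in>UNIV. if i = a then (if a = b then exp (2 * wt a * x $ k) else 0) else 0)"
    by (rule sum.cong) auto
  finally show ?thesis by simp
qed

lemma field_nth: "field P x $ I = exp ((sum wt I - 1) * x $ k) * coef P I"
proof -
  have "field P x $ I = (\<Sum>J\<in>UNIV. if J = I then exp ((sum wt I - 1) * x $ k) * coef P I else 0)"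
    unfolding field_def sum_component by (rule sum.cong) (auto simp: axis_def)
  then show ?thesis by simp
qed

lemma metric_mult: "metric x *v v = (\<chi> i. exp (2 * wt i * x $ k) * v $ i)"
proof -
  have "(\<Sum>j\<in>UNIV. metric x $ i $ j * v $ j) = (\<Sum>j\<in>UNIV. if j = i then exp (2 * wt i * x $ k) * v $ i else 0)" for i
    by (rule sum.cong) (auto simp: metric_nth)
  then show ?thesis by (simp add: vec_eq_iff matrix_vector_mult_def)
qed

lemma metric_frame: "metric x *v frame x i = exp (wt i * x $ k) *\<^sub>R axis i 1"
  by (auto simp: metric_mult frame_def vec_eq_iff axis_def simp flip: exp_add)

lemma frame_form_frame: "frame_form (metric x) (frame x) I = exp (sum wt I * x $ k) *\<^sub>R axis I 1"
  by (subst frame_form_scaled_axis[OF metric_frame]) (simp add: exp_sum sum_distrib_right)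

lemma frame_eval_frame: "frame_eval (frame x) \<tau> I = exp (- sum wt I * x $ k) * \<tau> $ I"
  by (subst frame_eval_scaled_axis[OF frame_def]) (simp add: exp_sum sum_distrib_right flip: sum_negf)

lemma smooth_field: "smooth_on UNIV (field P)"
  unfolding field_def by (intro smooth_on_sum smooth_on_exp) simp

lemma metric_on_metric: "metric_on UNIV metric"
  unfolding metric_on_def
proof (intro conjI ballI allI impI)
  show "smooth_on UNIV metric"
    unfolding metric_def by (intro smooth_on_sum smooth_on_exp) simp
  show "transpose (metric x) = metric x" for x
    by (simp add: transpose_def vec_eq_iff metric_nth)
  fix x v :: "'n coords" assume "v \<noteq> 0"
  then obtain i where "v $ i \<noteq> 0" by (auto simp: vec_eq_iff)
  then have "(\<Sum>i\<in>UNIV. exp (2 * wt i * x $ k) * (v $ i * v $ i)) > 0"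
    by (intro sum_pos2[of _ i]) (auto simp: zero_less_mult_iff linorder_neq_iff)
  then show "(metric x *v v) \<bullet> v > 0"
    by (simp add: metric_mult inner_vec_def mult.assoc)
qed

lemma orthonormal_frame: "oriented_orthonormal_frame_on UNIV metric frame"
  unfolding oriented_orthonormal_frame_on_def
proof (intro conjI ballI allI)
  show "smooth_on UNIV (\<lambda>x. frame x i)" for i
    unfolding frame_def by (rule smooth_on_exp)
  show "(metric x *v frame x i) \<bullet> frame x j = (if i = j then 1 else 0)" for x i j
    unfolding metric_frame by (auto simp: frame_def inner_axis_axis simp flip: exp_add)
  show "det (\<chi> i. frame x i) > 0" for x
    by (subst det_diagonal) (auto simp: frame_def axis_def intro!: prod_pos)
qed

lemma background: "background_fields_on UNIV metric frame (\<lambda>x. 0) (\<lambda>x. x $ k) (\<lambda>x. \<phi>) (\<lambda>x. \<psi>)"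
  unfolding background_fields_on_def smooth_form_on_def homogeneous_def
  using metric_on_metric orthonormal_frame smooth_on_coordinate unit
    smooth_on_const[of "0 :: 'n form"] smooth_on_const[of \<phi>] smooth_on_const[of \<psi>] by auto

lemma spinor_form_b_field:
  "exp (- x $ k) *\<^sub>R spinor_form_b cl (metric x) (frame x) 0 \<phi> \<psi> = field (\<lambda>_. True) x"
proof -
  have "spinor_form_b cl (metric x) (frame x) 0 \<phi> \<psi> = (\<Sum>I\<in>UNIV. Lform \<phi> \<psi> $ I *\<^sub>R exp (sum wt I * x $ k) *\<^sub>R axis I 1)"
    by (simp add: spinor_form_b_def spinor_form_def exp_form_0 wedge_unit_form frame_form_frame
        Lform_def eI_def foldr_eq_cprod)
  moreover have "exp ((r - 1) * x $ k) = exp (- x $ k) * exp (r * x $ k)" for r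
    by (simp add: algebra_simps flip: exp_add)
  ultimately show ?thesis
    by (simp add: field_def coef_def scaleR_sum_right mult_ac)
qed

text \<open>The transverse volume element is symmetric with square 1 and commutes with e_J here,
  whereas \<phi> and \<psi> lie in its opposite, hence orthogonal, eigenspaces.\<close>

lemma Lform_even: "even (card (J \<inter> insert k S)) \<Longrightarrow> Lform \<phi> \<psi> $ J = 0"
proof -
  let ?\<gamma> = "eI (insert k S)"
  have card: "card (insert k S) = 4" using card_S by (simp add: card_insert_if card_ge_0_finite)
  assume "even (card (J \<inter> insert k S))"
  then have "eI J (?\<gamma> \<psi>) = ?\<gamma> (eI J \<psi>)" by (subst eI_commute) (simp add: card)
  then have "\<epsilon> *\<^sub>R eI J \<psi> = ?\<gamma> (eI J \<psi>)"
    by (simp add: chirality linear_cmul[OF linear_eI])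
  then have "\<epsilon> * (eI J \<psi> \<bullet> \<phi>) = ?\<gamma> (eI J \<psi>) \<bullet> \<phi>" by (metis inner_scaleR_left)
  also have "\<dots> = - \<epsilon> * (eI J \<psi> \<bullet> \<phi>)"
    by (subst eI_symmetric) (simp_all add: card chirality)
  finally show ?thesis using \<epsilon> by (auto simp: Lform_def)
qed

lemma eI_S: "eI S \<phi> = \<epsilon> *\<^sub>R cl (axis k 1) \<phi>"
proof -
  have "sg k S = 1" using k_less by (intro sg_below) auto
  then have "cl (axis k 1) (eI S \<phi>) = - \<epsilon> *\<^sub>R \<phi>"
    using chirality(2) by (simp add: eI_insert)
  then have "cl (axis k 1) (cl (axis k 1) (eI S \<phi>)) = - \<epsilon> *\<^sub>R cl (axis k 1) \<phi>" by (simp add: cl_simps)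
  then show ?thesis by (simp add: cl_axis_square)
qed

lemma ext_deriv_field:
  "ext_deriv (field P) x $ K = (if k \<in> K then sg k K * ((sum wt (K - {k}) - 1) *
     exp ((sum wt (K - {k}) - 1) * x $ k) * coef P (K - {k})) else 0)"
proof -
  let ?r = "\<lambda>I. sum wt I - 1"
  have "(field P has_derivative (\<lambda>w. \<Sum>I\<in>UNIV. (exp (?r I * x $ k) * (?r I * w $ k)) *\<^sub>R (coef P I *\<^sub>R axis I 1))) (at x)"
    unfolding field_def by (intro has_derivative_sum frechet_derivative_exp)
  then have D: "frechet_derivative (field P) (at x) w =
      (\<Sum>I\<in>UNIV. (exp (?r I * x $ k) * (?r I * w $ k)) *\<^sub>R (coef P I *\<^sub>R axis I 1))" for w
    by (simp add: frechet_derivative_at[symmetric])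
  have Dn: "frechet_derivative (field P) (at x) w $ J = exp (?r J * x $ k) * (?r J * w $ k) * coef P J" for w J
  proof -
    have "frechet_derivative (field P) (at x) w $ J =
        (\<Sum>I\<in>UNIV. if I = J then exp (?r J * x $ k) * (?r J * w $ k) * coef P J else 0)"
      unfolding D sum_component by (rule sum.cong) (auto simp: axis_def)
    then show ?thesis by simp
  qed
  have "ext_deriv (field P) x $ K = (\<Sum>i\<in>K. if i = k then sg k K * (?r (K - {k}) *
     exp (?r (K - {k}) * x $ k) * coef P (K - {k})) else 0)"
    unfolding ext_deriv_def vec_lambda_beta shuffle_sign_singleton sg_minus_self Dn
    by (rule sum.cong) (auto simp: axis_def)
  then show ?thesis by simp
qed

lemma wedge_flux:
  "wedge (flux x) \<tau> $ K = (if S \<subseteq> K then - 2 * \<epsilon> * shuffle_sign S (K - S) * \<tau> $ (K - S) else 0)"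
proof -
  have "wedge (flux x) \<tau> $ K =
      (\<Sum>I\<in>Pow K. if I = S then - 2 * \<epsilon> * shuffle_sign S (K - S) * \<tau> $ (K - S) else 0)"
    unfolding wedge_def vec_lambda_beta flux_def by (rule sum.cong) (auto simp: axis_def)
  then show ?thesis by simp
qed

lemma sum_wt: "sum wt J = (if k \<in> J then 3 else 0) + card (J \<inter> S)"
proof -
  have "sum wt J = (\<Sum>i\<in>J. (if i = k then 3 else 0) + (if i \<in> S then 1 else 0))"
    by (rule sum.cong) (auto simp: wt_def)
  also have "\<dots> = (if k \<in> J then 3 else 0) + card (J \<inter> S)"
    by (simp add: sum.distrib sum.If_cases)
  finally show ?thesis .
qed

text \<open>For \<open>K\<close> without \<open>k\<close> the flux would need a component free of
  transverse legs, which vanishes. With one leg along \<open>S\<close> the exponent is 0, so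
  differentiation gives nothing. If \<open>K\<close> contains \<open>k\<close> and \<open>S\<close>,
  the derivative of the component with legs \<open>S\<close> meets the flux times the component with
  leg \<open>k\<close>; \<open>eI_S\<close> relates the two coefficients.\<close>

lemma twisted_deriv_field: "twisted_deriv flux (field P) x = 0"
proof (rule vec_eq_iff[THEN iffD2], rule allI)
  fix K :: "'n set"
  have finS: "finite S" by simp
  have "ext_deriv (field P) x $ K + wedge (flux x) (field P x) $ K = 0"
  proof (cases "k \<in> K")
    case False
    then have "(K - S) \<inter> insert k S = {}" by auto
    then have "coef P (K - S) = 0"
      using Lform_even[of "K - S"] by (simp add: coef_def)
    with False show ?thesis by (simp add: ext_deriv_field wedge_flux field_nth)
  next
    case k: True
    show ?thesis
    proof (cases "S \<subseteq> K")
      case False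
      then have "card (K \<inter> S) < 3" using card_S psubset_card_mono[of S "K \<inter> S"] by auto
      then have "card (K \<inter> S) = 1 \<or> even (card (K \<inter> S))" by presburger
      moreover have KS: "(K - {k}) \<inter> insert k S = K \<inter> S" "(K - {k}) \<inter> S = K \<inter> S" by auto
      moreover have "sum wt (K - {k}) = card (K \<inter> S)" by (simp add: sum_wt KS)
      moreover have "even (card (K \<inter> S)) \<Longrightarrow> coef P (K - {k}) = 0"
        using Lform_even[of "K - {k}"] by (simp add: coef_def KS)
      ultimately have "sum wt (K - {k}) = 1 \<or> coef P (K - {k}) = 0" by auto
      with False show ?thesis by (auto simp: ext_deriv_field wedge_flux)
    next
      case True
      \<comment> \<open>Three legs of weight 1 weigh as much as the single leg \<open>k\<close> of
        weight 3, so both terms carry the same exponential.\<close>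
      have KS: "(K - {k}) \<inter> S = S" "(K - S) \<inter> S = {}" using True by auto
      then have wt: "sum wt (K - {k}) = 3" "sum wt (K - S) = 3" using k card_S by (simp_all add: sum_wt)
      have "card K = Suc (card (K - {k}))" using k by (metis card.remove finite)
      moreover have "card K = card (K - S) + 3"
        using True card_S card_Diff_subset[of S K] card_mono[of K S] by simp
      ultimately have par: "even (card (K - S)) = even (card (K - {k}))" by presburger
      have "sg k K * (eI (K - {k}) \<psi> \<bullet> \<phi>) = eI K \<psi> \<bullet> cl (axis k 1) \<phi>"
        using cl_eI[of k K \<psi>] cl_skew[of "axis k 1" "eI K \<psi>" \<phi>] k by (simp add: flip_def)
      moreover have "\<epsilon> * (shuffle_sign S (K - S) * (eI (K - S) \<psi> \<bullet> \<phi>)) = eI K \<psi> \<bullet> cl (axis k 1) \<phi>"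
      proof -
        have "eI S (eI (K - S) \<psi>) = shuffle_sign S (K - S) *\<^sub>R eI K \<psi>"
          using eI_disjoint_union[of S "K - S" \<psi>] True by (simp add: Un_absorb1)
        then have "eI S (eI S (eI (K - S) \<psi>)) = shuffle_sign S (K - S) *\<^sub>R eI S (eI K \<psi>)"
          by (simp add: linear_cmul[OF linear_eI])
        then have "shuffle_sign S (K - S) * (eI (K - S) \<psi> \<bullet> \<phi>) = eI S (eI K \<psi>) \<bullet> \<phi>"
          by (simp add: eI_eI card_S)
        also have "\<dots> = \<epsilon> * (eI K \<psi> \<bullet> cl (axis k 1) \<phi>)"
          by (subst eI_symmetric) (simp_all add: card_S eI_S)
        finally show ?thesis using \<epsilon> by auto
      qed
      ultimately have "sg k K * Lform \<phi> \<psi> $ (K - {k}) = \<epsilon> * (shuffle_sign S (K - S) * Lform \<phi> \<psi> $ (K - S))"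
        by (simp add: Lform_def)
      then show ?thesis
        using k True by (simp add: ext_deriv_field wedge_flux field_nth wt coef_def par)
    qed
  qed
  then show "twisted_deriv flux (field P) x $ K = 0 $ K" by (simp add: twisted_deriv_def)
qed

lemma ext_deriv_const: "ext_deriv (\<lambda>x. \<tau>) x = (0 :: 'n form)"
  by (simp add: ext_deriv_def vec_eq_iff)

lemma closed_flux: "closed_3form_on UNIV flux"
  unfolding closed_3form_on_def smooth_form_on_def homogeneous_def flux_def
  using smooth_on_const card_S by (auto simp: axis_def ext_deriv_const)

lemma non_trivial: "non_trivial_on UNIV (\<lambda>x. 0) flux"
proof -
  have "flux 0 \<noteq> 0" using \<epsilon> by (auto simp: flux_def axis_eq_0_iff)
  then show ?thesis by (auto simp: non_trivial_on_def torsion_def ext_deriv_const)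
qed

text \<open>As the volume element is the identity, e_K \<psi> agrees with the product over the
  complement up to precisely the signs of \<open>sigma_form\<close> and the star. In odd dimension
  complementary sets have opposite parity, and the weights of the complement cancel in the
  exponent.\<close>

lemma box_field:
  assumes vol: "\<And>s. eI UNIV s = s" and odd: "odd CARD('n)"
  shows "box_form (metric x) (frame x) 0 (field P x) = field (\<lambda>e. P (\<not> e)) x"
proof (rule vec_eq_iff[THEN iffD2], rule allI)
  fix K :: "'n set"
  let ?s = "\<lambda>I. if card I mod 4 \<in> {0, 3} then 1 else - 1 :: real"
  have "box_form (metric x) (frame x) 0 (field P x) $ K = hodge_star (metric x) (frame x) (sigma_form (field P x)) $ K"
    by (simp add: box_form_def exp_form_0 wedge_unit_form)
  also have "\<dots> = (\<Sum>I\<in>UNIV. if I = - K then exp (- sum wt I * x $ k) * (?s I * field P x $ I) *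
      shuffle_sign I K * exp (sum wt K * x $ k) else 0)"
    unfolding hodge_star_def sum_component frame_eval_frame frame_form_frame sigma_form_def
    by (rule sum.cong) (auto simp: axis_def)
  also have "\<dots> = exp ((sum wt K - 1) * x $ k) * (?s (- K) * shuffle_sign (- K) K * coef P (- K))"
    by (simp add: field_nth algebra_simps flip: exp_add)
  also have "?s (- K) * shuffle_sign (- K) K * coef P (- K) = coef (\<lambda>e. P (\<not> e)) K"
  proof -
    have "card K + card (- K) = CARD('n)" using card_Un_disjoint[of K "- K"] by simp
    then have par: "even (card (- K)) \<longleftrightarrow> odd (card K)" using odd by presburger
    have "eI (- K) (eI K \<psi>) = shuffle_sign (- K) K *\<^sub>R \<psi>"
      using eI_disjoint_union[of "- K" K \<psi>] vol by simp
    then have "eI (- K) (eI (- K) (eI K \<psi>)) = shuffle_sign (- K) K *\<^sub>R eI (- K) \<psi>"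
      by (simp add: linear_cmul[OF linear_eI])
    then have "?s (- K) *\<^sub>R eI K \<psi> = shuffle_sign (- K) K *\<^sub>R eI (- K) \<psi>" by (simp only: eI_eI)
    from arg_cong[OF this, of "\<lambda>v. ?s (- K) * (v \<bullet> \<phi>)"]
    have "(?s (- K) * ?s (- K)) * (eI K \<psi> \<bullet> \<phi>) = ?s (- K) * shuffle_sign (- K) K * (eI (- K) \<psi> \<bullet> \<phi>)"
      by (simp only: inner_scaleR_left mult.assoc)
    moreover have "?s (- K) * ?s (- K) = 1" by simp
    ultimately have "Lform \<phi> \<psi> $ K = ?s (- K) * shuffle_sign (- K) K * Lform \<phi> \<psi> $ (- K)"
      by (simp only: Lform_def vec_lambda_beta mult_1)
    then show ?thesis by (simp add: coef_def par)
  qed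
  finally show "box_form (metric x) (frame x) 0 (field P x) $ K = field (\<lambda>e. P (\<not> e)) x $ K"
    by (simp add: field_nth)
qed

text \<open>At each point the form is a diagonal rescaling of a constant one, which reduces its
  stabiliser to the constant coefficients.\<close>

lemma field_scale_form:
  "field P x = exp (- x $ k) *\<^sub>R scale_form (\<lambda>i. exp (wt i * x $ k)) (\<chi> I. coef P I)"
  by (simp add: vec_eq_iff field_nth scale_form_def exp_sum[symmetric] algebra_simps sum_distrib_left flip: exp_add)

lemma stabiliser_field:
  assumes "stabiliser_conjugate_to_square G (\<chi> I. coef P I)"
  shows "stabiliser_conjugate_to_square G (field P x)"
  unfolding field_scale_form
  by (intro stabiliser_conjugate_scaleR stabiliser_conjugate_scale_form assms) simp_all

end

section \<open>The instances in dimensions 7 and 8\<close>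

lemma pairing_minus_unit: "pairing (- axis i 1, axis i 1) (- axis i 1, axis i 1) = - 1"
  by (simp add: pairing_minus inner_axis_axis)

lemma sorted_2456_7: "sorted_list_of_set {2, 4, 5, 6 :: 7} = [2, 4, 5, 6]"
  by (rule sorted_list_of_set.idem_if_sorted_distinct[of "[2, 4, 5, 6]", unfolded list.set])
    (simp_all add: less_eq_bit1_def less_7_8)

lemma sorted_2456_8: "sorted_list_of_set {2, 4, 5, 6 :: 8} = [2, 4, 5, 6]"
  by (rule sorted_list_of_set.idem_if_sorted_distinct[of "[2, 4, 5, 6]", unfolded list.set])
    (simp_all add: less_eq_bit0_def less_7_8)

text \<open>The indices are the complement of the triple {0,1,3}, which generates a quaternion
  subalgebra. Their 4-plane is coassociative, so its volume element acts on the unit by a sign; this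
  dictates the transverse directions of all examples.\<close>

lemma clifford7_2456:
  "clifford7 (axis 2 1) (clifford7 (axis 4 1) (clifford7 (axis 5 1) (clifford7 (axis 6 1) one7))) = - one7"
proof -
  have axes: "clifford7 (axis 5 1) (0, axis 6 1) = (0, - axis 1 1)"
      "clifford7 (axis 4 1) (0, - axis 1 1) = (0, axis 2 1)" "clifford7 (axis 2 1) (0, axis 2 1) = - one7"
    by (simp_all add: clifford7_def inner_7 vec_eq_7 cross7_components axis_def)
  then show ?thesis by (simp add: clifford7_one7)
qed

lemma chirality7: "c7.eI {2, 4, 5, 6} one7 = - one7"
  by (simp add: c7.eI_def sorted_2456_7 clifford7_2456)

lemma chirality8: "c8.eI {2, 4, 5, 6} one8 = - one8"
  by (simp add: c8.eI_def sorted_2456_8 clifford8_axis first7_axis one8_def clifford7_2456 bilinear_rzero[OF c7.bilinear_cl])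

lemma less_7_facts: "(2 :: 7) < 4" "(2 :: 7) < 5" "(2 :: 7) < 6" "(2 :: 8) < 4" "(2 :: 8) < 5" "(2 :: 8) < 6"
  by (simp_all add: less_7_8)

text \<open>Multiplying the unit spinor by a vector of the transverse 4-plane reverses its
  transverse chirality, which supplies the required pair.\<close>

interpretation brane7: five_brane clifford7 2 "{4, 5, 6}" "clifford7 (axis 2 1) one7" one7 "- 1"
proof
  show "card {4, 5, 6 :: 7} = 3" by simp
  show "2 < i" if "i \<in> {4, 5, 6 :: 7}" for i using that less_7_facts by auto
  show "c7.eI {2, 4, 5, 6} one7 = - 1 *\<^sub>R one7" by (simp add: chirality7)
  show "c7.eI {2, 4, 5, 6} (clifford7 (axis 2 1) one7) = - (- 1) *\<^sub>R clifford7 (axis 2 1) one7"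
    by (simp add: c7.eI_cl_axis chirality7 c7.cl_simps del: uminus_Pair)
  show "norm (clifford7 (axis 2 1) one7) = 1" "norm one7 = 1" by (simp_all add: c7.norm_cl norm_Pair)
qed simp

text \<open>A negative vector acting on \<open>rho7\<close> yields the bispinor of the example plus
  its \<open>par\<close>, which is twice the even part; hence the factor 1/2.\<close>

lemma brane7_stabiliser: "stabiliser_conjugate_to_square G2 (brane7.field (\<lambda>e. e) x)"
proof (rule brane7.stabiliser_field)
  let ?M = "neg_act (axis 2 1) :: 7 form \<Rightarrow> 7 form"
  have "stabiliser_conjugate_to_square G2 ((1 / 2) *\<^sub>R ?M rho7)"
    by (intro stabiliser_conjugate_scaleR stabiliser_conjugate_clifford[where e = "- 1"] stabiliser_rho7)
      (simp_all add: pairing_minus_unit)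
  moreover have "?M rho7 = c7.Lform (clifford7 (axis 2 1) one7) one7 + par (c7.Lform (clifford7 (axis 2 1) one7) one7)"
    by (simp add: rho7_def c7.tensor_form_def clifford_form_simps clifford_form_par c7.neg_act_Lform)
  then have "(1 / 2) *\<^sub>R ?M rho7 = (\<chi> I. brane7.coef (\<lambda>e. e) I)"
    by (simp add: vec_eq_iff par_def brane7.coef_def)
  ultimately show "stabiliser_conjugate_to_square G2 (\<chi> I. brane7.coef (\<lambda>e. e) I)" by simp
qed

lemma volume_one8: "c8.eI UNIV one8 = one8"
  by (simp add: clifford8_volume one8_def)

lemma Lform_parity:
  assumes "c8.eI UNIV \<phi> = e *\<^sub>R \<phi>" shows "(- 1) ^ card I * c8.Lform \<phi> one8 $ I = e * c8.Lform \<phi> one8 $ I"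
proof -
  have "par (c8.Lform \<phi> one8) = e *\<^sub>R c8.Lform \<phi> one8"
    using assms by (simp add: c8.par_Lform c8.Lform_simps volume_one8)
  then show ?thesis by (simp add: par_def vec_eq_iff)
qed

text \<open>\<open>struct\<close> and \<open>chir\<close> are parameters so that both types share
  one argument; parity enters through the vanishing components of the bispinor.\<close>

lemma Spin7_five_brane:
  assumes unit: "norm \<phi> = 1" and chirality: "c8.eI {2, 4, 5, 6} \<phi> = \<phi>"
    and stab: "stabiliser_conjugate_to_square Spin7 (c8.Lform \<phi> one8)"
    and struct: "\<And>\<rho>. smooth_on UNIV \<rho> \<Longrightarrow> (\<And>x. stabiliser_conjugate_to_square Spin7 (\<rho> x)) \<Longrightarrow>
      (\<And>x I. c8.Lform \<phi> one8 $ I = 0 \<Longrightarrow> \<rho> x $ I = 0) \<Longrightarrow> struct UNIV \<rho>"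
    and chir: "chir \<phi> one8"
  shows "\<exists>U \<rho> g E b F \<Psi>p \<Psi>m H. open U \<and> U \<noteq> {} \<and> struct U \<rho> \<and>
    Spin7_structure_data U \<rho> g E b F \<Psi>p \<Psi>m \<and> (\<forall>x\<in>U. chir (\<Psi>p x) (\<Psi>m x)) \<and>
    closed_integrable_with U \<rho> H \<and> non_trivial_on U b H"
proof -
  interpret five_brane clifford8 2 "{4, 5, 6}" \<phi> one8 "- 1"
  proof
    show "card {4, 5, 6 :: 8} = 3" by simp
    show "2 < i" if "i \<in> {4, 5, 6 :: 8}" for i using that less_7_facts by auto
    show "c8.eI {2, 4, 5, 6} one8 = - 1 *\<^sub>R one8" by (simp add: chirality8)
    show "c8.eI {2, 4, 5, 6} \<phi> = - (- 1) *\<^sub>R \<phi>" by (simp add: chirality)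
    show "norm \<phi> = 1" "norm one8 = 1" by (simp_all add: unit norm_eq_1[of one8] one8_inner)
  qed simp
  have "(\<chi> I. coef (\<lambda>_. True) I) = c8.Lform \<phi> one8" by (simp add: vec_eq_iff coef_def)
  then have "stabiliser_conjugate_to_square Spin7 (field (\<lambda>_. True) x)" for x
    using stab by (intro stabiliser_field) simp
  then show ?thesis
    by (intro exI[of _ UNIV] exI[of _ "field (\<lambda>_. True)"] exI[of _ metric] exI[of _ frame] exI[of _ "\<lambda>x. 0"]
        exI[of _ "\<lambda>x. x $ 2"] exI[of _ "\<lambda>x. \<phi>"] exI[of _ "\<lambda>x. one8"] exI[of _ flux])
      (simp add: struct chir smooth_field field_nth coef_def Spin7_structure_data_def background spinor_form_b_field
        closed_integrable_with_def closed_flux twisted_deriv_field non_trivial)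
qed

theorem proposition3p37:
  shows "(\<exists>U \<rho> g E b F \<Psi>p \<Psi>m H. open U \<and> U \<noteq> {} \<and>
            generalised_G2_structure U \<rho> \<and>
            G2_structure_data U \<rho> g E b F \<Psi>p \<Psi>m \<and>
            closed_strongly_integrable_with U \<rho> g E b H \<and>
            non_trivial_on U b H) \<and>
         (\<exists>U \<rho> g E b F \<Psi>p \<Psi>m H. open U \<and> U \<noteq> {} \<and>
            even_generalised_Spin7_structure U \<rho> \<and>
            Spin7_structure_data U \<rho> g E b F \<Psi>p \<Psi>m \<and>
            (\<forall>x\<in>U. equal_chirality (\<Psi>p x) (\<Psi>m x)) \<and>
            closed_integrable_with U \<rho> H \<and>
            non_trivial_on U b H) \<and>
         (\<exists>U \<rho> g E b F \<Psi>p \<Psi>m H. open U \<and> U \<noteq> {} \<and>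
            odd_generalised_Spin7_structure U \<rho> \<and>
            Spin7_structure_data U \<rho> g E b F \<Psi>p \<Psi>m \<and>
            (\<forall>x\<in>U. opposite_chirality (\<Psi>p x) (\<Psi>m x)) \<and>
            closed_integrable_with U \<rho> H \<and>
            non_trivial_on U b H)"
proof (intro conjI, goal_cases)
  case 1
  \<comment> \<open>The box operation exchanges the even and the odd part, so both closedness
    conditions are instances of one identity for \<open>brane7.field P\<close>.\<close>
  have box: "box_form (brane7.metric x) (brane7.frame x) 0 (brane7.field P x) = brane7.field (\<lambda>e. P (\<not> e)) x" for P x
    by (rule brane7.box_field) (simp_all add: clifford7_volume)
  have "even_form (brane7.field (\<lambda>e. e) x)" for x
    by (simp add: even_form_def brane7.field_nth brane7.coef_def)
  then have "generalised_G2_structure UNIV (brane7.field (\<lambda>e. e))"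
    by (simp add: generalised_G2_structure_def brane7.smooth_field brane7_stabiliser)
  moreover have "brane7.field (\<lambda>e. e) x + brane7.field Not x = brane7.field (\<lambda>_. True) x" for x
    by (simp add: vec_eq_iff brane7.field_nth brane7.coef_def)
  then have "G2_structure_data UNIV (brane7.field (\<lambda>e. e)) brane7.metric brane7.frame (\<lambda>x. 0) (\<lambda>x. x $ 2)
      (\<lambda>x. clifford7 (axis 2 1) one7) (\<lambda>x. one7)"
    by (simp add: G2_structure_data_def brane7.background brane7.spinor_form_b_field box)
  moreover have "closed_strongly_integrable_with UNIV (brane7.field (\<lambda>e. e)) brane7.metric brane7.frame (\<lambda>x. 0) brane7.flux"
    by (simp add: closed_strongly_integrable_with_def brane7.closed_flux brane7.twisted_deriv_field box)
  ultimately show ?case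
    using brane7.non_trivial
    by (intro exI[of _ UNIV] exI[of _ "brane7.field (\<lambda>e. e)"] exI[of _ brane7.metric] exI[of _ brane7.frame] exI[of _ "\<lambda>x. 0"]
        exI[of _ "\<lambda>x. x $ 2"] exI[of _ "\<lambda>x. clifford7 (axis 2 1) one7"] exI[of _ "\<lambda>x. one7"] exI[of _ brane7.flux] conjI) simp_all
next
  case 2
  \<comment> \<open>The last axis is not transverse and changes the half-spinor only, while axis 2
    reverses the transverse chirality as well; together they return to the half-spinor space of
    \<open>one8\<close>.\<close>
  let ?\<phi> = "clifford8 (axis 2 1) (clifford8 (axis 7 1) one8)"
  let ?M = "\<lambda>i. neg_act (axis i 1) :: 8 form \<Rightarrow> 8 form"
  have "stabiliser_conjugate_to_square Spin7 (?M 2 (?M 7 rho8))"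
    by (intro stabiliser_conjugate_clifford[where e = "- 1"] stabiliser_rho8) (simp_all add: pairing_minus_unit)
  then have stab: "stabiliser_conjugate_to_square Spin7 (c8.Lform ?\<phi> one8)"
    by (simp only: rho8_def c8.neg_act_Lform)
  have "c8.eI UNIV ?\<phi> = 1 *\<^sub>R ?\<phi>"
    by (simp add: c8.eI_UNIV_cl volume_one8 c8.cl_simps)
  then have par: "c8.Lform ?\<phi> one8 $ I = 0" if "odd (card I)" for I
    using Lform_parity[of _ 1 I] that by fastforce
  have "norm ?\<phi> = 1" "c8.eI {2, 4, 5, 6} ?\<phi> = ?\<phi>"
    by (simp_all add: c8.norm_cl norm_eq_1[of one8] one8_inner c8.eI_cl_axis chirality8 c8.cl_simps)
  then show ?case
    using stab
  proof (rule Spin7_five_brane)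
    show "even_generalised_Spin7_structure UNIV \<rho>"
      if "smooth_on UNIV \<rho>" "\<And>x. stabiliser_conjugate_to_square Spin7 (\<rho> x)"
        "\<And>x I. c8.Lform ?\<phi> one8 $ I = 0 \<Longrightarrow> \<rho> x $ I = 0" for \<rho>
      by (simp add: even_generalised_Spin7_structure_def even_form_def that(1,2) that(3)[OF par])
    show "equal_chirality ?\<phi> one8"
      by (simp add: equal_chirality_def Delta_plus_def clifford8_axis one8_def c7.cl_simps)
  qed
next
  case 3
  \<comment> \<open>A single transverse vector reverses both the transverse and the total chirality,
    as odd type demands.\<close>
  let ?\<phi> = "clifford8 (axis 2 1) one8"
  have "stabiliser_conjugate_to_square Spin7 (neg_act (axis 2 1) rho8)"
    by (intro stabiliser_conjugate_clifford[where e = "- 1"] stabiliser_rho8) (simp_all add: pairing_minus_unit)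
  then have stab: "stabiliser_conjugate_to_square Spin7 (c8.Lform ?\<phi> one8)"
    by (simp only: rho8_def c8.neg_act_Lform)
  have "c8.eI UNIV ?\<phi> = - 1 *\<^sub>R ?\<phi>"
    by (simp add: c8.eI_UNIV_cl volume_one8)
  then have par: "c8.Lform ?\<phi> one8 $ I = 0" if "even (card I)" for I
    using Lform_parity[of _ "- 1" I] that by fastforce
  have "norm ?\<phi> = 1" "c8.eI {2, 4, 5, 6} ?\<phi> = ?\<phi>"
    by (simp_all add: c8.norm_cl norm_eq_1[of one8] one8_inner c8.eI_cl_axis chirality8 c8.cl_simps)
  then show ?case
    using stab
  proof (rule Spin7_five_brane)
    show "odd_generalised_Spin7_structure UNIV \<rho>"
      if "smooth_on UNIV \<rho>" "\<And>x. stabiliser_conjugate_to_square Spin7 (\<rho> x)"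
        "\<And>x I. c8.Lform ?\<phi> one8 $ I = 0 \<Longrightarrow> \<rho> x $ I = 0" for \<rho>
      by (simp add: odd_generalised_Spin7_structure_def odd_form_def that(1,2) that(3)[OF par])
    show "opposite_chirality ?\<phi> one8"
      by (simp add: opposite_chirality_def Delta_plus_def Delta_minus_def clifford8_axis one8_def c7.cl_simps)
  qed
qed

end
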